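(* Let $(M,q,B,g,\mathcal{E})$ be a submersed ambient structure. Set $\mathrm{B}(\phi,v)_x:=(D_{\mathrm{V}\phi}\mathrm{H})_xv-(D_v\mathrm{H})_x\mathrm{V}\phi$ for $\phi\in T_xM$, $v\in\mathcal{H}_xM$ (so $\mathrm{B}(\epsilon,v)_x=\mathrm{B}_v\epsilon$ for $\epsilon\in\mathcal{V}_xM$, and $\mathrm{B}(\xi,v)_x=0$ if $\xi\in\mathcal{H}_xM$), and extend $\mathrm{B}$ to a smooth map from $M$ to $L(\mathcal{E}\otimes\mathcal{E},\mathcal{E})$. Let $\hat g$ be a smooth positive-definite operator-valued function from $\mathcal{H}M$ to $L(\mathcal{E},\mathcal{E})$ such that $\hat g_{(x_1,v_1)}=\hat g_{(x_2,v_2)}$ if $dq(x_1,v_1)=dq(x_2,v_2)$. Define $$\Gamma^{\mathcal{Q}}[v]_x\omega:=\Gamma_{\mathcal{H}}(\mathrm{H}\omega,v)_x-\mathrm{B}(\omega,v)_x,\qquad G_{\mathcal{Q},(x,v)}:=\begin{bmatrix}I&(\Gamma^{\mathcal{Q}})^T[v]_x\\0&I\end{bmatrix}\begin{bmatrix}g_x&0\\0&\hat g_{(x,v)}\end{bmatrix}\begin{bmatrix}I&0\\\Gamma^{\mathcal{Q}}[v]_x&I\end{bmatrix}.$$ Then $\Gamma^{\mathcal{Q}}$ is an operator-valued function from $\mathcal{H}M$ to $L(\mathcal{E},\mathcal{E})$ and $G_{\mathcal{Q}}$ is a metric operator from $\mathcal{H}M$ to $L(\mathcal{E}^2,\mathcal{E}^2)$,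 defining a Riemannian metric on $\mathcal{H}M$. Let $g_B$ be the metric on $B$. For $(x,v)\in\mathcal{H}M$ and $(b,w)=dq(x,v)$, $\hat g$ induces an inner product $\hat g_{B,(b,w)}$ on $T_bB$, evaluated on $\xi^B,\eta^B\in T_bB$ as $\langle\xi^M,\hat g_{(x,v)}\eta^M\rangle_{\mathcal{E}}$, with $\xi^M,\eta^M$ the horizontal lifts of $\xi^B,\eta^B$ at $x$; it is well-defined, independent of the lifts. Equip $TB$ with the natural metric $G_B$ associated with $g_B$ and $\hat g_B$. Under the metrics $G_{\mathcal{Q}}$ and $G_B$, $dq|_{\mathcal{H}M}:\mathcal{H}M\to TB$ is a Riemannian submersion. Let $\mathrm{H}_{g,x}$ and $\mathrm{H}_{\hat g,(x,v)}$ be the projections of $\mathcal{E}$ onto $\mathcal{H}_xM$ under the inner products given by $g_x$ and $\hat g_{(x,v)}$. Under $G_{\mathcal{Q}}$, the projection of $\mathcal{E}^2$ to $\mathcal{Q}_{(x,v)}\mathcal{H}M$ is $$\mathrm{H}_{G_{\mathcal{Q}},(x,v)}=\begin{bmatrix}I&0\\-\Gamma^{\mathcal{Q}}[v]_x&I\end{bmatrix}\begin{bmatrix}\mathrm{H}_{g,x}&0\\0&\mathrm{H}_{\hat g,(x,v)}\end{bmatrix}\begin{bmatrix}I&0\\\Gamma^{\mathcal{Q}}[v]_x&I\end{bmatrix}.$$ As a Riemannian metric on $\mathcal{H}M$, $G_{\mathcal{Q}}$ depends only on the values of $g$ and $\hat g$ evaluated on tangent vectors of $M$. The bundle $\mathcal{V}\mathcal{H}M$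 is the vertical bundle and $\mathcal{Q}\mathcal{H}M$ is the horizontal bundle of $\mathcal{H}M$ under the Riemannian submersion $dq|_{\mathcal{H}M}$. Let $\mathrm{Q}$ be the idempotent bundle map $T\mathcal{H}M\to T\mathcal{H}M$ sending $(\Delta_m,\Delta_t)\in T_{(x,v)}\mathcal{H}M$ to $(\mathrm{H}_x\Delta_m,(D_{\mathrm{H}_x\Delta_m}\mathrm{H})_xv+\mathrm{H}_x\Delta_t)$, whose image is $\mathcal{Q}\mathcal{H}M$. Then $\mathrm{Q}$ is the projection from $T\mathcal{H}M$ to $\mathcal{Q}\mathcal{H}M$ under $G_{\mathcal{Q}}$; thus $\mathrm{Q}$ is the restriction of $\mathrm{H}_{G_{\mathcal{Q}}}$ to $T\mathcal{H}M$.
   Context: $\mathcal{E}$ is a finite-dimensional inner product space; $M\subset\mathcal{E}$ a differentiably embedded Riemannian manifold with metric operator $g$ (smooth $M\to L(\mathcal{E},\mathcal{E})$, $g_x$ self-adjoint positive-definite, $\langle\xi,g_x\eta\rangle_{\mathcal{E}}$ the Riemannian inner product of $\xi,\eta\in T_xM$). A submersed ambient structure $(M,q,B,g,\mathcal{E})$ is this with a Riemannian submersion $q:M\to B$. $\mathcal{V}M=\ker dq$, $\mathcal{H}M$ its orthogonal complement in $TM$; $\Pi_x,\mathrm{H}_x,\mathrm{V}_x$ are the projections of $\mathcal{E}$ onto $T_xM,\mathcal{H}_xM,\mathcal{V}_xM$ orthogonal for $\langle\cdot,g_x\cdot\rangle_{\mathcal{E}}$, smooth in $x$. $D$ is directional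 derivative. $\Gamma:M\to L(\mathcal{E}\otimes\mathcal{E},\mathcal{E})$ is a Christoffel function: smooth with $\nabla_XY=D_XY+\Gamma(X,Y)$ for vector fields ($\nabla$ Levi-Civita); $\Gamma_{\mathcal{H}}(\xi,\omega)=-(D_\xi\mathrm{H})\omega+\mathrm{H}((D_\xi\Pi)\omega+\Gamma(\xi,\omega))$ for $\xi\in T_xM,\omega\in\mathcal{E}$. $\mathcal{H}M=\{(x,v):x\in M,\mathrm{H}_xv=v\}\subset\mathcal{E}^2$; $T_{(x,v)}\mathcal{H}M=\{(\Delta_m,\Delta_t):\Pi_x\Delta_m=\Delta_m,(D_{\Delta_m}\mathrm{H})_xv+\mathrm{H}_x\Delta_t=\Delta_t\}$; $\mathcal{Q}\mathcal{H}M$ is the subbundle where $\mathrm{H}_x\Delta_m=\Delta_m$. The map $dq|_{\mathcal{H}M}:\mathcal{H}M\to TB$ is a differentiable submersion with vertical bundle $\mathcal{V}\mathcal{H}M=\ker d(dq|_{\mathcal{H}M})$, whose fiber at $(x,v)$ is $\{(\epsilon,\mathrm{B}_v\epsilon):\epsilon\in\mathcal{V}_xM\}$ with $\mathrm{B}_v\epsilon=(D_\epsilon\mathrm{H})_xv-(D_v\mathrm{H})_x\epsilon$. A superscript $T$ denotes the adjoint under $\langle\cdot,\cdot\rangle_{\mathcal{E}}$. The natural metric $G_B$ on $TB$ associated with $g_B$ and $\hat g_B$ is $G_B(\Delta,\Delta')=g_B(d\pi_B\Delta,d\pi_B\Delta')+\hat g_{B,(b,w)}(C\Delta,C\Delta')$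 for $\Delta,\Delta'\in T_{(b,w)}TB$, where $\pi_B:TB\to B$ is the projection and $C:TTB\to TB$ is the connection map of the Levi-Civita connection of $B$ (the bundle map with $C(dZ(\delta))=\nabla^B_\delta Z$ for vector fields $Z:B\to TB$).
   Formalization: Invariance of ĝ is read as equality of the forms induced on T_bB via horizontal lifts; the printed Q is shown idempotent with image QHM, but the projection claims are for Q plus (0,(D_vH)VΔ_m), as the printed Q is not G_Q-orthogonal; dim B>0 is assumed. *)

theory Defs
  imports "HOL-Analysis.Analysis"
begin

section \<open>Smoothness and embedded submanifolds\<close>

primrec Ck_on :: "nat \<Rightarrow> 'a::euclidean_space set \<Rightarrow> ('a \<Rightarrow> 'c::real_normed_vector) \<Rightarrow> bool" where
  "Ck_on 0 S f \<longleftrightarrow> continuous_on S f"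
| "Ck_on (Suc k) S f \<longleftrightarrow>
     (\<forall>x\<in>S. f differentiable (at x)) \<and> (\<forall>u. Ck_on k S (\<lambda>x. frechet_derivative f (at x) u))"

text \<open>Only used for open \<open>S\<close>.\<close>

definition Cinf_on :: "'a::euclidean_space set \<Rightarrow> ('a \<Rightarrow> 'c::real_normed_vector) \<Rightarrow> bool" where
  "Cinf_on S f \<longleftrightarrow> (\<forall>k. Ck_on k S f)"

text \<open>Smoothness on an arbitrary subset of a Euclidean space: local extendability to a smooth
  function on an open set.\<close>

definition smooth_on :: "'a::euclidean_space set \<Rightarrow> ('a \<Rightarrow> 'c::real_normed_vector) \<Rightarrow> bool" where
  "smooth_on N f \<longleftrightarrow>
     (\<forall>x\<in>N. \<exists>U F. open U \<and> x \<in> U \<and> Cinf_on U F \<and> (\<forall>y\<in>U \<inter> N. F y = f y))"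

definition embedded_submanifold :: "'a::euclidean_space set \<Rightarrow> bool" where
  "embedded_submanifold N \<longleftrightarrow>
     (\<exists>k. \<forall>x\<in>N. \<exists>U V (\<phi> :: 'a \<Rightarrow> 'a) \<psi> S.
        open U \<and> x \<in> U \<and> open V \<and> homeomorphism U V \<phi> \<psi> \<and> Cinf_on U \<phi> \<and> Cinf_on V \<psi> \<and>
        subspace S \<and> dim S = k \<and> \<phi> ` (U \<inter> N) = V \<inter> S)"

definition tangent_space :: "'a::euclidean_space set \<Rightarrow> 'a \<Rightarrow> 'a set" where
  "tangent_space N x =
     {u. \<exists>c e. e > 0 \<and> Cinf_on {-e<..<e} c \<and> (\<forall>t\<in>{-e<..<e}. c t \<in> N) \<and> c (0::real) = x \<and>
           (c has_vector_derivative u) (at 0)}"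

text \<open>The directional derivative at \<open>x\<close> of a function on \<open>N\<close>. The derivative within \<open>N\<close> is only
  determined on \<open>tangent_space N x\<close>; it is only used there.\<close>

definition dirD :: "'a::euclidean_space set \<Rightarrow> ('a \<Rightarrow> 'c::real_normed_vector) \<Rightarrow> 'a \<Rightarrow> 'a \<Rightarrow> 'c" where
  "dirD N f x \<xi> = frechet_derivative f (at x within N) \<xi>"

definition emb_vector_field :: "'a::euclidean_space set \<Rightarrow> ('a \<Rightarrow> 'a) \<Rightarrow> bool" where
  "emb_vector_field N X \<longleftrightarrow> smooth_on N X \<and> (\<forall>x\<in>N. X x \<in> tangent_space N x)"

definition metric_operator :: "'c::euclidean_space set \<Rightarrow> ('c \<Rightarrow> 'a::euclidean_space \<Rightarrow>\<^sub>L 'a) \<Rightarrow> bool" where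
  "metric_operator N G \<longleftrightarrow>
     smooth_on N G \<and>
     (\<forall>x\<in>N. (\<forall>u w. u \<bullet> G x w = G x u \<bullet> w) \<and> (\<forall>u. u \<noteq> 0 \<longrightarrow> 0 < u \<bullet> G x u))"

text \<open>The Riemannian metric on \<open>N\<close> is \<open>u \<bullet> G x w\<close> for \<open>u, w \<in> tangent_space N x\<close>.\<close>

definition riemannian_embedded :: "'a::euclidean_space set \<Rightarrow> ('a \<Rightarrow> 'a \<Rightarrow>\<^sub>L 'a) \<Rightarrow> bool" where
  "riemannian_embedded N G \<longleftrightarrow> embedded_submanifold N \<and> metric_operator N G"

text \<open>The operator \<open>\<nabla>\<^sub>X Y = D\<^sub>X Y + \<Gamma>(X, Y)\<close> is the Levi-Civita connection: it preserves vector fields,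
  is torsion free (the Lie bracket is \<open>D\<^sub>X Y - D\<^sub>Y X\<close>) and metric. Tensoriality in \<open>X\<close>
  and the Leibniz rule in \<open>Y\<close> hold automatically for an operator of this form.\<close>

definition christoffel_function ::
    "'a::euclidean_space set \<Rightarrow> ('a \<Rightarrow> 'a \<Rightarrow>\<^sub>L 'a) \<Rightarrow> ('a \<Rightarrow> 'a \<Rightarrow>\<^sub>L 'a \<Rightarrow>\<^sub>L 'a) \<Rightarrow> bool" where
  "christoffel_function N G \<Gamma> \<longleftrightarrow>
     smooth_on N \<Gamma> \<and>
     (let nabla = (\<lambda>X Y x. dirD N Y x (X x) + blinfun_apply (blinfun_apply (\<Gamma> x) (X x)) (Y x)) in
      \<forall>X Y Z. emb_vector_field N X \<longrightarrow> emb_vector_field N Y \<longrightarrow> emb_vector_field N Z \<longrightarrow>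
        emb_vector_field N (nabla X Y) \<and>
        (\<forall>x\<in>N. nabla X Y x - nabla Y X x = dirD N Y x (X x) - dirD N X x (Y x)) \<and>
        (\<forall>x\<in>N. dirD N (\<lambda>y. Y y \<bullet> G y (Z y)) x (X x) =
                 nabla X Y x \<bullet> G x (Z x) + Y x \<bullet> G x (nabla X Z x)))"

section \<open>Abstract smooth manifolds\<close>

text \<open>A manifold is given by its set of points and an atlas indexed by the points:
  \<open>chart X p\<close>, with domain \<open>chart_dom X p\<close>, is a chart around \<open>p\<close>. Every smooth structure arises in
  this way. The tangent space at \<open>p\<close> is identified with the model space \<open>'e\<close> through \<open>chart X p\<close>,
  so that a point of the tangent bundle is a pair in \<open>points X \<times> UNIV\<close>.\<close>

record ('p, 'e) manifold =
  points :: "'p set"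
  chart_dom :: "'p \<Rightarrow> 'p set"
  chart :: "'p \<Rightarrow> 'p \<Rightarrow> 'e"

definition chart_inv :: "('p, 'e) manifold \<Rightarrow> 'p \<Rightarrow> 'e \<Rightarrow> 'p" where
  "chart_inv X p = inv_into (chart_dom X p) (chart X p)"

definition mfd_topology :: "('p, 'e::euclidean_space) manifold \<Rightarrow> 'p topology" where
  "mfd_topology X =
     topology (\<lambda>U. U \<subseteq> points X \<and> (\<forall>p\<in>points X. open (chart X p ` (U \<inter> chart_dom X p))))"

definition smooth_manifold :: "('p, 'e::euclidean_space) manifold \<Rightarrow> bool" where
  "smooth_manifold X \<longleftrightarrow>
     (\<forall>p\<in>points X. p \<in> chart_dom X p \<and> chart_dom X p \<subseteq> points X \<and>
        inj_on (chart X p) (chart_dom X p) \<and> open (chart X p ` chart_dom X p)) \<and>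
     (\<forall>p\<in>points X. \<forall>r\<in>points X.
        open (chart X p ` (chart_dom X p \<inter> chart_dom X r)) \<and>
        Cinf_on (chart X p ` (chart_dom X p \<inter> chart_dom X r)) (chart X r \<circ> chart_inv X p)) \<and>
     Hausdorff_space (mfd_topology X) \<and> second_countable (mfd_topology X)"

text \<open>At the point \<open>s\<close>, the change of tangent coordinates from the chart indexed by \<open>p\<close> to the one
  indexed by \<open>r\<close>.\<close>

definition coord_change ::
    "('p, 'e::euclidean_space) manifold \<Rightarrow> 'p \<Rightarrow> 'p \<Rightarrow> 'p \<Rightarrow> 'e \<Rightarrow> 'e" where
  "coord_change X p r s = frechet_derivative (chart X r \<circ> chart_inv X p) (at (chart X p s))"

definition tangent_bundle ::
    "('p, 'e::euclidean_space) manifold \<Rightarrow> ('p \<times> 'e, 'e \<times> 'e) manifold" where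
  "tangent_bundle X =
     \<lparr> points = points X \<times> UNIV,
       chart_dom = (\<lambda>(p, w). chart_dom X p \<times> UNIV),
       chart = (\<lambda>(p, w) (s, u). (chart X p s, coord_change X s p s u)) \<rparr>"

definition mfd_deriv ::
    "('p, 'e::euclidean_space) manifold \<Rightarrow> ('r, 'f::euclidean_space) manifold \<Rightarrow>
      ('p \<Rightarrow> 'r) \<Rightarrow> 'p \<Rightarrow> 'e \<Rightarrow> 'f" where
  "mfd_deriv X Y f p = frechet_derivative (chart Y (f p) \<circ> f \<circ> chart_inv X p) (at (chart X p p))"

definition smooth_fun_on ::
    "('p, 'e::euclidean_space) manifold \<Rightarrow> 'p set \<Rightarrow> ('p \<Rightarrow> real) \<Rightarrow> bool" where
  "smooth_fun_on X U f \<longleftrightarrow>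
     (\<forall>p\<in>points X. Cinf_on (chart X p ` (U \<inter> chart_dom X p)) (f \<circ> chart_inv X p))"

definition fun_deriv ::
    "('p, 'e::euclidean_space) manifold \<Rightarrow> ('p \<Rightarrow> real) \<Rightarrow> 'p \<Rightarrow> 'e \<Rightarrow> real" where
  "fun_deriv X f p = frechet_derivative (f \<circ> chart_inv X p) (at (chart X p p))"

text \<open>The components of a vector field \<open>Z\<close> in the chart indexed by \<open>p\<close>.\<close>

definition local_rep ::
    "('p, 'e::euclidean_space) manifold \<Rightarrow> 'p \<Rightarrow> ('p \<Rightarrow> 'e) \<Rightarrow> 'e \<Rightarrow> 'e" where
  "local_rep X p Z y = (let s = chart_inv X p y in coord_change X s p s (Z s))"

definition vector_field_on ::
    "('p, 'e::euclidean_space) manifold \<Rightarrow> 'p set \<Rightarrow> ('p \<Rightarrow> 'e) \<Rightarrow> bool" where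
  "vector_field_on X U Z \<longleftrightarrow>
     (\<forall>p\<in>points X. Cinf_on (chart X p ` (U \<inter> chart_dom X p)) (local_rep X p Z))"

definition lie_bracket ::
    "('p, 'e::euclidean_space) manifold \<Rightarrow> ('p \<Rightarrow> 'e) \<Rightarrow> ('p \<Rightarrow> 'e) \<Rightarrow> 'p \<Rightarrow> 'e" where
  "lie_bracket X Y Z p =
     frechet_derivative (local_rep X p Z) (at (chart X p p)) (Y p)
     - frechet_derivative (local_rep X p Y) (at (chart X p p)) (Z p)"

definition inner_product :: "('e::real_vector \<Rightarrow> 'e \<Rightarrow> real) \<Rightarrow> bool" where
  "inner_product b \<longleftrightarrow> bilinear b \<and> (\<forall>u w. b u w = b w u) \<and> (\<forall>u. u \<noteq> 0 \<longrightarrow> 0 < b u u)"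

definition riemannian_metric ::
    "('p, 'e::euclidean_space) manifold \<Rightarrow> ('p \<Rightarrow> 'e \<Rightarrow> 'e \<Rightarrow> real) \<Rightarrow> bool" where
  "riemannian_metric X \<gamma> \<longleftrightarrow>
     (\<forall>p\<in>points X. inner_product (\<gamma> p)) \<and>
     (\<forall>p\<in>points X. \<forall>u w.
        Cinf_on (chart X p ` chart_dom X p)
          (\<lambda>y. let s = chart_inv X p y in
               \<gamma> s (coord_change X p s s u) (coord_change X p s s w)))"

text \<open>\<open>nab Y p \<delta>\<close> is the covariant derivative of \<open>Y\<close> at \<open>p\<close> in the direction \<open>\<delta>\<close>. A connection acts
  on vector fields on all open subsets. The last two conditions are
  vanishing torsion and compatibility with the metric.\<close>

definition levi_civita ::
    "('p, 'e::euclidean_space) manifold \<Rightarrow> ('p \<Rightarrow> 'e \<Rightarrow> 'e \<Rightarrow> real) \<Rightarrow>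
      (('p \<Rightarrow> 'e) \<Rightarrow> 'p \<Rightarrow> 'e \<Rightarrow> 'e) \<Rightarrow> bool" where
  "levi_civita X \<gamma> nab \<longleftrightarrow>
     (\<forall>U. openin (mfd_topology X) U \<longrightarrow>
       (\<forall>Y Z f. vector_field_on X U Y \<longrightarrow> vector_field_on X U Z \<longrightarrow>
          smooth_fun_on X U f \<longrightarrow>
          vector_field_on X U (\<lambda>p. nab Y p (Z p)) \<and>
          ((\<forall>p\<in>U. Y p = Z p) \<longrightarrow> (\<forall>p\<in>U. nab Y p = nab Z p)) \<and>
          (\<forall>p\<in>U. linear (nab Y p)) \<and>
          (\<forall>p\<in>U. \<forall>\<delta>. nab (\<lambda>s. Y s + Z s) p \<delta> = nab Y p \<delta> + nab Z p \<delta>) \<and>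
          (\<forall>p\<in>U. \<forall>\<delta>. nab (\<lambda>s. f s *\<^sub>R Y s) p \<delta> = fun_deriv X f p \<delta> *\<^sub>R Y p + f p *\<^sub>R nab Y p \<delta>) \<and>
          (\<forall>p\<in>U. nab Z p (Y p) - nab Y p (Z p) = lie_bracket X Y Z p) \<and>
          (\<forall>p\<in>U. \<forall>\<delta>. fun_deriv X (\<lambda>s. \<gamma> s (Y s) (Z s)) p \<delta> =
                       \<gamma> p (nab Y p \<delta>) (Z p) + \<gamma> p (Y p) (nab Z p \<delta>))))"

text \<open>The first two conditions say that \<open>C\<close> is a smooth bundle map from the tangent bundle of the
  tangent bundle to the tangent bundle, covering the projection.\<close>

definition connection_map ::
    "('p, 'e::euclidean_space) manifold \<Rightarrow> (('p \<Rightarrow> 'e) \<Rightarrow> 'p \<Rightarrow> 'e \<Rightarrow> 'e) \<Rightarrow>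
      ('p \<times> 'e \<Rightarrow> 'e \<times> 'e \<Rightarrow> 'e) \<Rightarrow> bool" where
  "connection_map X nab C \<longleftrightarrow>
     (\<forall>p\<in>points (tangent_bundle X). linear (C p)) \<and>
     (\<forall>p\<in>points (tangent_bundle X). \<forall>\<Delta>.
        Cinf_on (chart (tangent_bundle X) p ` chart_dom (tangent_bundle X) p)
          (\<lambda>z. let s = chart_inv (tangent_bundle X) p z in
               coord_change X (fst s) (fst p) (fst s)
                 (C s (coord_change (tangent_bundle X) p s s \<Delta>)))) \<and>
     (\<forall>U Z. openin (mfd_topology X) U \<longrightarrow> vector_field_on X U Z \<longrightarrow>
        (\<forall>p\<in>U. \<forall>\<delta>. C (p, Z p) (mfd_deriv X (tangent_bundle X) (\<lambda>s. (s, Z s)) p \<delta>) = nab Z p \<delta>))"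

definition natural_metric ::
    "('p, 'e::euclidean_space) manifold \<Rightarrow> ('p \<Rightarrow> 'e \<Rightarrow> 'e \<Rightarrow> real) \<Rightarrow>
      ('p \<times> 'e \<Rightarrow> 'e \<Rightarrow> 'e \<Rightarrow> real) \<Rightarrow> ('p \<times> 'e \<Rightarrow> 'e \<times> 'e \<Rightarrow> 'e) \<Rightarrow>
      'p \<times> 'e \<Rightarrow> 'e \<times> 'e \<Rightarrow> 'e \<times> 'e \<Rightarrow> real" where
  "natural_metric X \<gamma> \<gamma>' C p \<Delta> \<Delta>' =
     \<gamma> (fst p) (mfd_deriv (tangent_bundle X) X fst p \<Delta>) (mfd_deriv (tangent_bundle X) X fst p \<Delta>')
     + \<gamma>' p (C p \<Delta>) (C p \<Delta>')"

section \<open>Riemannian submersions from embedded to abstract manifolds\<close>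

definition smooth_to ::
    "'a::euclidean_space set \<Rightarrow> ('p, 'e::euclidean_space) manifold \<Rightarrow> ('a \<Rightarrow> 'p) \<Rightarrow> bool" where
  "smooth_to N X f \<longleftrightarrow>
     (\<forall>x\<in>N. f x \<in> points X \<and>
        (\<exists>U. open U \<and> x \<in> U \<and> f ` (U \<inter> N) \<subseteq> chart_dom X (f x) \<and>
             smooth_on (U \<inter> N) (chart X (f x) \<circ> f)))"

definition emb_deriv ::
    "'a::euclidean_space set \<Rightarrow> ('p, 'e::euclidean_space) manifold \<Rightarrow> ('a \<Rightarrow> 'p) \<Rightarrow> 'a \<Rightarrow> 'a \<Rightarrow> 'e" where
  "emb_deriv N X f x = dirD N (chart X (f x) \<circ> f) x"

text \<open>The differential of \<open>f\<close> as a map into the tangent bundle.\<close>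

definition tangent_map ::
    "'a::euclidean_space set \<Rightarrow> ('p, 'e::euclidean_space) manifold \<Rightarrow> ('a \<Rightarrow> 'p) \<Rightarrow>
      'a \<times> 'a \<Rightarrow> 'p \<times> 'e" where
  "tangent_map N X f = (\<lambda>(x, v). (f x, emb_deriv N X f x v))"

definition vertical_space ::
    "'a::euclidean_space set \<Rightarrow> ('p, 'e::euclidean_space) manifold \<Rightarrow> ('a \<Rightarrow> 'p) \<Rightarrow> 'a \<Rightarrow> 'a set" where
  "vertical_space N X f x = {\<xi> \<in> tangent_space N x. emb_deriv N X f x \<xi> = 0}"

definition horizontal_space ::
    "'a::euclidean_space set \<Rightarrow> ('a \<Rightarrow> 'a \<Rightarrow>\<^sub>L 'a) \<Rightarrow> ('p, 'e::euclidean_space) manifold \<Rightarrow>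
      ('a \<Rightarrow> 'p) \<Rightarrow> 'a \<Rightarrow> 'a set" where
  "horizontal_space N G X f x =
     {\<xi> \<in> tangent_space N x. \<forall>\<epsilon>\<in>vertical_space N X f x. \<xi> \<bullet> G x \<epsilon> = 0}"

definition riemannian_submersion ::
    "'a::euclidean_space set \<Rightarrow> ('a \<Rightarrow> 'a \<Rightarrow>\<^sub>L 'a) \<Rightarrow> ('p, 'e::euclidean_space) manifold \<Rightarrow>
      ('p \<Rightarrow> 'e \<Rightarrow> 'e \<Rightarrow> real) \<Rightarrow> ('a \<Rightarrow> 'p) \<Rightarrow> bool" where
  "riemannian_submersion N G X \<gamma> f \<longleftrightarrow>
     riemannian_embedded N G \<and> smooth_manifold X \<and> riemannian_metric X \<gamma> \<and>
     smooth_to N X f \<and> f ` N = points X \<and>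
     (\<forall>x\<in>N. emb_deriv N X f x ` tangent_space N x = UNIV) \<and>
     (\<forall>x\<in>N. \<forall>\<xi>\<in>horizontal_space N G X f x. \<forall>\<eta>\<in>horizontal_space N G X f x.
        \<gamma> (f x) (emb_deriv N X f x \<xi>) (emb_deriv N X f x \<eta>) = \<xi> \<bullet> G x \<eta>)"

section \<open>Operators\<close>

definition is_oproj :: "('a::euclidean_space \<Rightarrow>\<^sub>L 'a) \<Rightarrow> 'a set \<Rightarrow> ('a \<Rightarrow>\<^sub>L 'a) \<Rightarrow> bool" where
  "is_oproj G W P \<longleftrightarrow> (\<forall>z. P z \<in> W) \<and> (\<forall>z. \<forall>w\<in>W. (z - P z) \<bullet> G w = 0)"

definition oproj :: "('a::euclidean_space \<Rightarrow>\<^sub>L 'a) \<Rightarrow> 'a set \<Rightarrow> 'a \<Rightarrow>\<^sub>L 'a" where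
  "oproj G W = (THE P. is_oproj G W P)"

definition op_adjoint :: "('a::euclidean_space \<Rightarrow>\<^sub>L 'b::euclidean_space) \<Rightarrow> 'b \<Rightarrow>\<^sub>L 'a" where
  "op_adjoint A = Blinfun (adjoint (blinfun_apply A))"

text \<open>The operator with block matrix \<open>[A, B; C, D]\<close>.\<close>

definition block ::
    "('a::euclidean_space \<Rightarrow>\<^sub>L 'a) \<Rightarrow> ('a \<Rightarrow>\<^sub>L 'a) \<Rightarrow> ('a \<Rightarrow>\<^sub>L 'a) \<Rightarrow> ('a \<Rightarrow>\<^sub>L 'a) \<Rightarrow>
      ('a \<times> 'a) \<Rightarrow>\<^sub>L ('a \<times> 'a)" where
  "block A B C D = Blinfun (\<lambda>(u, w). (A u + B w, C u + D w))"

section \<open>Submersed ambient structures\<close>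

text \<open>The ambient inner product space is the type \<open>'a\<close>.\<close>

record (overloaded) ('a, 'p, 'e) ambient =
  tot :: "'a set"
  sub :: "'a \<Rightarrow> 'p"
  base :: "('p, 'e) manifold"
  base_metric :: "'p \<Rightarrow> 'e \<Rightarrow> 'e \<Rightarrow> real"
  met :: "'a \<Rightarrow> 'a \<Rightarrow>\<^sub>L 'a"

definition TM :: "('a::euclidean_space, 'p, 'e::euclidean_space) ambient \<Rightarrow> 'a \<Rightarrow> 'a set" where
  "TM A x = tangent_space (tot A) x"

definition VM :: "('a::euclidean_space, 'p, 'e::euclidean_space) ambient \<Rightarrow> 'a \<Rightarrow> 'a set" where
  "VM A x = vertical_space (tot A) (base A) (sub A) x"

definition HM_fib :: "('a::euclidean_space, 'p, 'e::euclidean_space) ambient \<Rightarrow> 'a \<Rightarrow> 'a set" where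
  "HM_fib A x = horizontal_space (tot A) (met A) (base A) (sub A) x"

definition Pi_pr :: "('a::euclidean_space, 'p, 'e::euclidean_space) ambient \<Rightarrow> 'a \<Rightarrow> 'a \<Rightarrow>\<^sub>L 'a" where
  "Pi_pr A x = oproj (met A x) (TM A x)"

definition H_pr :: "('a::euclidean_space, 'p, 'e::euclidean_space) ambient \<Rightarrow> 'a \<Rightarrow> 'a \<Rightarrow>\<^sub>L 'a" where
  "H_pr A x = oproj (met A x) (HM_fib A x)"

definition V_pr :: "('a::euclidean_space, 'p, 'e::euclidean_space) ambient \<Rightarrow> 'a \<Rightarrow> 'a \<Rightarrow>\<^sub>L 'a" where
  "V_pr A x = oproj (met A x) (VM A x)"

definition submersed_ambient ::
    "('a::euclidean_space, 'p, 'e::euclidean_space) ambient \<Rightarrow> bool" where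
  "submersed_ambient A \<longleftrightarrow>
     riemannian_submersion (tot A) (met A) (base A) (base_metric A) (sub A) \<and>
     smooth_on (tot A) (Pi_pr A) \<and> smooth_on (tot A) (H_pr A) \<and> smooth_on (tot A) (V_pr A)"

abbreviation DH :: "('a::euclidean_space, 'p, 'e::euclidean_space) ambient \<Rightarrow> 'a \<Rightarrow> 'a \<Rightarrow> 'a \<Rightarrow>\<^sub>L 'a" where
  "DH A \<equiv> dirD (tot A) (H_pr A)"

abbreviation DPi :: "('a::euclidean_space, 'p, 'e::euclidean_space) ambient \<Rightarrow> 'a \<Rightarrow> 'a \<Rightarrow> 'a \<Rightarrow>\<^sub>L 'a" where
  "DPi A \<equiv> dirD (tot A) (Pi_pr A)"

definition Gamma_H ::
    "('a::euclidean_space, 'p, 'e::euclidean_space) ambient \<Rightarrow> ('a \<Rightarrow> 'a \<Rightarrow>\<^sub>L 'a \<Rightarrow>\<^sub>L 'a) \<Rightarrow>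
      'a \<Rightarrow> 'a \<Rightarrow> 'a \<Rightarrow> 'a" where
  "Gamma_H A \<Gamma> x \<xi> \<omega> =
     - (DH A x \<xi>) \<omega> + H_pr A x ((DPi A x \<xi>) \<omega> + blinfun_apply (blinfun_apply (\<Gamma> x) \<xi>) \<omega>)"

definition HM :: "('a::euclidean_space, 'p, 'e::euclidean_space) ambient \<Rightarrow> ('a \<times> 'a) set" where
  "HM A = {(x, v). x \<in> tot A \<and> H_pr A x v = v}"

definition THM ::
    "('a::euclidean_space, 'p, 'e::euclidean_space) ambient \<Rightarrow> 'a \<times> 'a \<Rightarrow> ('a \<times> 'a) set" where
  "THM A p = tangent_space (HM A) p"

definition QHM ::
    "('a::euclidean_space, 'p, 'e::euclidean_space) ambient \<Rightarrow> 'a \<times> 'a \<Rightarrow> ('a \<times> 'a) set" where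
  "QHM A p = {\<Delta> \<in> THM A p. H_pr A (fst p) (fst \<Delta>) = fst \<Delta>}"

text \<open>\<open>B_vert A x v \<epsilon>\<close> is \<open>B\<^sub>v \<epsilon>\<close> at \<open>x\<close>.\<close>

definition B_vert ::
    "('a::euclidean_space, 'p, 'e::euclidean_space) ambient \<Rightarrow> 'a \<Rightarrow> 'a \<Rightarrow> 'a \<Rightarrow> 'a" where
  "B_vert A x v \<epsilon> = (DH A x \<epsilon>) v - (DH A x v) \<epsilon>"

definition VHM ::
    "('a::euclidean_space, 'p, 'e::euclidean_space) ambient \<Rightarrow> 'a \<times> 'a \<Rightarrow> ('a \<times> 'a) set" where
  "VHM A = (\<lambda>(x, v). {(\<epsilon>, B_vert A x v \<epsilon>) | \<epsilon>. \<epsilon> \<in> VM A x})"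

definition dq :: "('a::euclidean_space, 'p, 'e::euclidean_space) ambient \<Rightarrow> 'a \<times> 'a \<Rightarrow> 'p \<times> 'e" where
  "dq A = tangent_map (tot A) (base A) (sub A)"

definition B_extension ::
    "('a::euclidean_space, 'p, 'e::euclidean_space) ambient \<Rightarrow> ('a \<Rightarrow> 'a \<Rightarrow>\<^sub>L 'a \<Rightarrow>\<^sub>L 'a) \<Rightarrow> bool" where
  "B_extension A B \<longleftrightarrow>
     smooth_on (tot A) B \<and>
     (\<forall>x\<in>tot A. \<forall>\<phi>\<in>TM A x. \<forall>v\<in>HM_fib A x.
        blinfun_apply (blinfun_apply (B x) \<phi>) v =
          (DH A x (V_pr A x \<phi>)) v - (DH A x v) (V_pr A x \<phi>))"

definition GammaQ_fun ::
    "('a::euclidean_space, 'p, 'e::euclidean_space) ambient \<Rightarrow> ('a \<Rightarrow> 'a \<Rightarrow>\<^sub>L 'a \<Rightarrow>\<^sub>L 'a) \<Rightarrow>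
      ('a \<Rightarrow> 'a \<Rightarrow>\<^sub>L 'a \<Rightarrow>\<^sub>L 'a) \<Rightarrow> 'a \<times> 'a \<Rightarrow> 'a \<Rightarrow> 'a" where
  "GammaQ_fun A \<Gamma> B = (\<lambda>(x, v) \<omega>.
     Gamma_H A \<Gamma> x (H_pr A x \<omega>) v - blinfun_apply (blinfun_apply (B x) \<omega>) v)"

definition GammaQ ::
    "('a::euclidean_space, 'p, 'e::euclidean_space) ambient \<Rightarrow> ('a \<Rightarrow> 'a \<Rightarrow>\<^sub>L 'a \<Rightarrow>\<^sub>L 'a) \<Rightarrow>
      ('a \<Rightarrow> 'a \<Rightarrow>\<^sub>L 'a \<Rightarrow>\<^sub>L 'a) \<Rightarrow> 'a \<times> 'a \<Rightarrow> 'a \<Rightarrow>\<^sub>L 'a" where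
  "GammaQ A \<Gamma> B p = Blinfun (GammaQ_fun A \<Gamma> B p)"

definition G_Q ::
    "('a::euclidean_space, 'p, 'e::euclidean_space) ambient \<Rightarrow> ('a \<Rightarrow> 'a \<Rightarrow>\<^sub>L 'a \<Rightarrow>\<^sub>L 'a) \<Rightarrow>
      ('a \<Rightarrow> 'a \<Rightarrow>\<^sub>L 'a \<Rightarrow>\<^sub>L 'a) \<Rightarrow> ('a \<times> 'a \<Rightarrow> 'a \<Rightarrow>\<^sub>L 'a) \<Rightarrow>
      'a \<times> 'a \<Rightarrow> ('a \<times> 'a) \<Rightarrow>\<^sub>L ('a \<times> 'a)" where
  "G_Q A \<Gamma> B ghat p =
     block id_blinfun (op_adjoint (GammaQ A \<Gamma> B p)) 0 id_blinfun
     o\<^sub>L block (met A (fst p)) 0 0 (ghat p)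
     o\<^sub>L block id_blinfun 0 (GammaQ A \<Gamma> B p) id_blinfun"

definition H_GQ ::
    "('a::euclidean_space, 'p, 'e::euclidean_space) ambient \<Rightarrow> ('a \<Rightarrow> 'a \<Rightarrow>\<^sub>L 'a \<Rightarrow>\<^sub>L 'a) \<Rightarrow>
      ('a \<Rightarrow> 'a \<Rightarrow>\<^sub>L 'a \<Rightarrow>\<^sub>L 'a) \<Rightarrow> ('a \<times> 'a \<Rightarrow> 'a \<Rightarrow>\<^sub>L 'a) \<Rightarrow>
      'a \<times> 'a \<Rightarrow> ('a \<times> 'a) \<Rightarrow>\<^sub>L ('a \<times> 'a)" where
  "H_GQ A \<Gamma> B ghat p =
     block id_blinfun 0 (- GammaQ A \<Gamma> B p) id_blinfun
     o\<^sub>L block (oproj (met A (fst p)) (HM_fib A (fst p))) 0 0 (oproj (ghat p) (HM_fib A (fst p)))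
     o\<^sub>L block id_blinfun 0 (GammaQ A \<Gamma> B p) id_blinfun"

definition hlift :: "('a::euclidean_space, 'p, 'e::euclidean_space) ambient \<Rightarrow> 'a \<Rightarrow> 'e \<Rightarrow> 'a" where
  "hlift A x \<xi> = (THE \<eta>. \<eta> \<in> HM_fib A x \<and> emb_deriv (tot A) (base A) (sub A) x \<eta> = \<xi>)"

text \<open>The bilinear form on the tangent space of the base at \<open>sub A x\<close> obtained from the operator
  \<open>ghat (x, v)\<close> through horizontal lifts at \<open>x\<close>.\<close>

definition lifted_form ::
    "('a::euclidean_space, 'p, 'e::euclidean_space) ambient \<Rightarrow> ('a \<times> 'a \<Rightarrow> 'a \<Rightarrow>\<^sub>L 'a) \<Rightarrow>
      'a \<times> 'a \<Rightarrow> 'e \<Rightarrow> 'e \<Rightarrow> real" where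
  "lifted_form A ghat p \<xi> \<eta> = hlift A (fst p) \<xi> \<bullet> ghat p (hlift A (fst p) \<eta>)"

text \<open>The form at a point of the tangent bundle of the base, computed at some preimage in \<open>HM A\<close>.\<close>

definition ghat_base ::
    "('a::euclidean_space, 'p, 'e::euclidean_space) ambient \<Rightarrow> ('a \<times> 'a \<Rightarrow> 'a \<Rightarrow>\<^sub>L 'a) \<Rightarrow>
      'p \<times> 'e \<Rightarrow> 'e \<Rightarrow> 'e \<Rightarrow> real" where
  "ghat_base A ghat r = lifted_form A ghat (SOME p. p \<in> HM A \<and> dq A p = r)"

text \<open>Equality of the operators \<open>ghat p\<close>, \<open>ghat p'\<close> over the same point of the tangent bundle is
  understood after transport to the common base: as operators on the ambient space they act on lifts
  to different horizontal spaces, and literal equality does not make the induced form well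
  defined (\<open>\<real>\<^sup>2\<close> without the origin, \<open>sub x = norm x\<close>, \<open>ghat\<close> constantly \<open>diag(1, 2)\<close>).\<close>

definition base_invariant ::
    "('a::euclidean_space, 'p, 'e::euclidean_space) ambient \<Rightarrow> ('a \<times> 'a \<Rightarrow> 'a \<Rightarrow>\<^sub>L 'a) \<Rightarrow> bool" where
  "base_invariant A ghat \<longleftrightarrow>
     (\<forall>p\<in>HM A. \<forall>p'\<in>HM A. dq A p = dq A p' \<longrightarrow> lifted_form A ghat p = lifted_form A ghat p')"

definition Q_map ::
    "('a::euclidean_space, 'p, 'e::euclidean_space) ambient \<Rightarrow> 'a \<times> 'a \<Rightarrow> 'a \<times> 'a \<Rightarrow> 'a \<times> 'a" where
  "Q_map A = (\<lambda>(x, v) (\<Delta>m, \<Delta>t).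
     (H_pr A x \<Delta>m, (DH A x (H_pr A x \<Delta>m)) v + H_pr A x \<Delta>t))"

text \<open>\<open>Q_map\<close> is idempotent with image \<open>QHM\<close>, but it sends the vertical vector \<open>(\<epsilon>, B\<^sub>v \<epsilon>)\<close> to
  \<open>(0, - (D\<^sub>v H) \<epsilon>)\<close>, so the orthogonal projection to \<open>QHM\<close> differs from it by the following
  term. It does not vanish in general: take \<open>\<real>\<^sup>2\<close> without the origin, the metric operator \<open>I / norm x ^ 2\<close> and the
  submersion \<open>x / norm x\<close> to the circle; at \<open>x = (1, 0)\<close>, \<open>v = (0, 1)\<close>, \<open>\<epsilon> = (1, 0)\<close> one
  has \<open>(D\<^sub>v H) \<epsilon> = - v\<close>.\<close>

definition Q_proj ::
    "('a::euclidean_space, 'p, 'e::euclidean_space) ambient \<Rightarrow> 'a \<times> 'a \<Rightarrow> 'a \<times> 'a \<Rightarrow> 'a \<times> 'a" where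
  "Q_proj A p \<Delta> =
     Q_map A p \<Delta> + (0, (DH A (fst p) (snd p)) (V_pr A (fst p) (fst \<Delta>)))"

end

theory Submission
  imports Defs
begin

text \<open>
  Everything rests on one identity. For a tangent vector \<open>\<Delta> = (\<Delta>m, \<Delta>t)\<close> of the horizontal bundle
  at \<open>(x, v)\<close>, the vector \<open>\<Delta>t + \<Gamma>Q \<Delta>m\<close> is horizontal, and the differential of the submersion
  takes it to the value of the connection map of the base at the image of \<open>\<Delta>\<close> under the
  differential of \<open>dq A\<close> (lemma \<open>ddq_identities\<close>). So \<open>G_Q\<close> is the sum of the metric of the total
  space on \<open>\<Delta>m\<close> and of \<open>ghat\<close> on the horizontal lift of the covariant part of the image, which is the
  pattern of the natural metric downstairs. On vectors with horizontal \<open>\<Delta>m\<close> the two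
  metrics agree, which is the Riemannian submersion property. The kernel consists of the vectors
  with vertical \<open>\<Delta>m\<close> and \<open>\<Delta>t + \<Gamma>Q \<Delta>m = 0\<close>, which gives the vertical bundle and, by taking the
  orthogonal complement, the horizontal one. The identity also expresses \<open>\<Delta>t + \<Gamma>Q \<Delta>m\<close> through data that
  do not involve the values of the metric operators outside the tangent spaces, which is why \<open>G_Q\<close>
  depends on the values on tangent vectors only.

  The identity is O'Neill's relation between the Levi-Civita connections of total space and base. Let \<open>F\<close>
  be the submersion in a chart of the base. The derivative of \<open>DF y (H y u)\<close> along a horizontal
  \<open>\<xi>\<close>, plus the Christoffel term of the base, minus the image of the horizontal part of
  \<open>\<Gamma>(\<xi>, u)\<close>, is a bilinear map \<open>S(\<xi>, u)\<close>. It is symmetric because both connections are torsion free,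
  and the isometry property of the submersion makes its inner product with the image of \<open>w\<close> skew in
  \<open>u\<close> and \<open>w\<close>; such a map vanishes (lemma \<open>connection_relation\<close>). The Christoffel function is only
  constrained through vector fields, and the fields \<open>\<Pi>\<^sub>y a\<close> with constant \<open>a\<close> suffice to extract its symmetry, the symmetry of
  the second fundamental form and the compatibility with the metric at each point.

  The remaining work is smoothness. The horizontal bundle is embedded because it becomes a product
  locally under \<open>(x, v) \<mapsto> (x, K(x) v)\<close> with a smooth family \<open>K\<close> of invertible operators
  (lemma \<open>embedded_HM\<close>). The natural metric is smooth because the form \<open>ghat_base\<close> can be computed along a smooth local
  section \<open>\<sigma>\<close> of the submersion, where horizontal lifts are \<open>H (D\<sigma> w)\<close> (lemmas
  \<open>local_section\<close> and \<open>Cinf_ghat_base\<close>).\<close>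

section \<open>Smooth functions on open sets\<close>

lemma Ck_on_subset: "Ck_on k S f \<Longrightarrow> T \<subseteq> S \<Longrightarrow> Ck_on k T f"
proof (induction k arbitrary: f)
  case 0
  then show ?case by (auto intro: continuous_on_subset)
next
  case (Suc k)
  then show ?case by (auto simp: subset_iff)
qed

lemma Ck_on_cong:
  assumes "open S" "\<And>x. x \<in> S \<Longrightarrow> f x = g x" "Ck_on k S f"
  shows "Ck_on k S g"
  using assms(2,3)
proof (induction k arbitrary: f g)
  case 0
  then show ?case by (simp cong: continuous_on_cong)
next
  case (Suc k)
  have der: "(g has_derivative frechet_derivative f (at x)) (at x)" if "x \<in> S" for x
    using Suc.prems that \<open>open S\<close>
    by (intro has_derivative_transform_within_open[of f _ x UNIV S g])
       (auto simp: frechet_derivative_works[symmetric])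
  have eq: "frechet_derivative g (at x) = frechet_derivative f (at x)" if "x \<in> S" for x
    using frechet_derivative_at[OF der[OF that]] by simp
  have "Ck_on k S (\<lambda>x. frechet_derivative g (at x) u)" for u
    using Suc.IH[of "\<lambda>x. frechet_derivative f (at x) u" "\<lambda>x. frechet_derivative g (at x) u"] Suc.prems(2) eq
    by simp
  then show ?case using der by (auto simp: differentiable_def)
qed

lemma Ck_on_SucI:
  assumes "open S" "\<And>x. x \<in> S \<Longrightarrow> (f has_derivative f' x) (at x)" "\<And>u. Ck_on k S (\<lambda>x. f' x u)"
  shows "Ck_on (Suc k) S f"
proof -
  have "f' x = frechet_derivative f (at x)" if "x \<in> S" for x
    using frechet_derivative_at[OF assms(2)[OF that]] .
  then have "Ck_on k S (\<lambda>x. frechet_derivative f (at x) u)" for u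
    using Ck_on_cong[OF assms(1) _ assms(3)[of u]] by simp
  then show ?thesis using assms(2) by (auto simp: differentiable_def)
qed

lemma Ck_on_SucD:
  assumes "Ck_on (Suc k) S f"
  shows "x \<in> S \<Longrightarrow> (f has_derivative frechet_derivative f (at x)) (at x)"
    "Ck_on k S (\<lambda>x. frechet_derivative f (at x) u)"
  using assms by (auto simp: frechet_derivative_works[symmetric])

lemma Ck_on_lower: "Ck_on (Suc k) S f \<Longrightarrow> Ck_on k S f"
proof (induction k arbitrary: f)
  case 0
  then show ?case
    by (auto intro!: continuous_at_imp_continuous_on differentiable_imp_continuous_within)
next
  case (Suc k)
  then show ?case by (metis Ck_on.simps(2))
qed

lemma Ck_on_local:
  assumes "\<And>x. x \<in> S \<Longrightarrow> \<exists>U. open U \<and> x \<in> U \<and> Ck_on k U f"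
  shows "Ck_on k S f"
  using assms
proof (induction k arbitrary: f)
  case 0
  show ?case unfolding Ck_on.simps
  proof (rule continuous_at_imp_continuous_on, rule ballI)
    fix x assume "x \<in> S"
    then obtain U where "open U" "x \<in> U" "continuous_on U f" using 0[of x] unfolding Ck_on.simps by blast
    then show "isCont f x" by (simp add: continuous_on_eq_continuous_at)
  qed
next
  case (Suc k)
  have "Ck_on k S (\<lambda>x. frechet_derivative f (at x) u)" for u
  proof (rule Suc.IH)
    fix x assume "x \<in> S"
    then obtain U where "open U" "x \<in> U" "Ck_on (Suc k) U f" using Suc.prems by blast
    then show "\<exists>U. open U \<and> x \<in> U \<and> Ck_on k U (\<lambda>x. frechet_derivative f (at x) u)" by auto
  qed
  moreover have "f differentiable (at x)" if "x \<in> S" for x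
    using Suc.prems[OF that] by auto
  ultimately show ?case by simp
qed

lemma Ck_on_const: "Ck_on k S (\<lambda>x. c)"
proof (induction k arbitrary: c)
  case (Suc k)
  then show ?case by simp
qed simp

lemma Ck_on_linear:
  assumes "open S" "bounded_linear L" "Ck_on k S f"
  shows "Ck_on k S (\<lambda>x. L (f x))"
  using assms(3)
proof (induction k arbitrary: f)
  case 0
  then show ?case using bounded_linear.continuous_on[OF assms(2)] by simp
next
  case (Suc k)
  show ?case
    by (rule Ck_on_SucI[OF assms(1) bounded_linear.has_derivative[OF assms(2) Ck_on_SucD(1)[OF Suc.prems]]])
       (auto intro: Suc.IH Ck_on_SucD(2)[OF Suc.prems])
qed

lemma Ck_on_add:
  assumes "open S" "Ck_on k S f" "Ck_on k S g"
  shows "Ck_on k S (\<lambda>x. f x + g x)"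
  using assms(2,3)
proof (induction k arbitrary: f g)
  case 0
  then show ?case by (auto intro: continuous_intros)
next
  case (Suc k)
  show ?case
    by (rule Ck_on_SucI[OF assms(1) has_derivative_add[OF Ck_on_SucD(1)[OF Suc.prems(1)] Ck_on_SucD(1)[OF Suc.prems(2)]]])
       (auto intro: Suc.IH Ck_on_SucD(2)[OF Suc.prems(1)] Ck_on_SucD(2)[OF Suc.prems(2)])
qed

lemma Ck_on_sum:
  assumes "open S" "\<And>i. i \<in> I \<Longrightarrow> Ck_on k S (f i)"
  shows "Ck_on k S (\<lambda>x. \<Sum>i\<in>I. f i x)"
  using assms(2)
  by (induction I rule: infinite_finite_induct) (auto intro: Ck_on_const Ck_on_add[OF assms(1)])

lemma Ck_on_bilinear:
  assumes "open S" "bounded_bilinear b" "Ck_on k S f" "Ck_on k S g"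
  shows "Ck_on k S (\<lambda>x. b (f x) (g x))"
  using assms(3,4)
proof (induction k arbitrary: f g)
  case 0
  then show ?case using bounded_bilinear.continuous_on[OF assms(2)] by auto
next
  case (Suc k)
  show ?case
    by (rule Ck_on_SucI[OF assms(1) bounded_bilinear.FDERIV[OF assms(2) Ck_on_SucD(1)[OF Suc.prems(1)] Ck_on_SucD(1)[OF Suc.prems(2)]]])
       (assumption, assumption, intro Ck_on_add[OF assms(1)] Suc.IH Ck_on_SucD(2)[OF Suc.prems(1)] Ck_on_SucD(2)[OF Suc.prems(2)]
         Ck_on_lower[OF Suc.prems(1)] Ck_on_lower[OF Suc.prems(2)])
qed

lemma linear_basis_expansion:
  assumes "linear f"
  shows "f (x::'a::euclidean_space) = (\<Sum>i\<in>Basis. (x \<bullet> i) *\<^sub>R f i)"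
  by (metis (no_types, lifting) assms euclidean_representation linear_scale linear_sum sum.cong)

text \<open>The chain rule is expanded in the basis of the middle space: the induction hypothesis then applies to
  each function \<open>y \<mapsto> frechet_derivative f (at y) i\<close> with a fixed direction \<open>i\<close>.\<close>

lemma Ck_on_compose:
  fixes g :: "'a::euclidean_space \<Rightarrow> 'b::euclidean_space"
  assumes "open S" "open T" "g ` S \<subseteq> T" "Ck_on k S g" "Ck_on k T f"
  shows "Ck_on k S (\<lambda>x. f (g x))"
  using assms(4,5)
proof (induction k arbitrary: f)
  case 0
  then show ?case using continuous_on_compose2[of T f S g] assms(3) by auto
next
  case (Suc k)
  have d: "((\<lambda>x. f (g x)) has_derivative (\<lambda>u. \<Sum>i\<in>Basis. (frechet_derivative g (at x) u \<bullet> i) *\<^sub>R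
       frechet_derivative f (at (g x)) i)) (at x)" if "x \<in> S" for x
  proof -
    have f: "(f has_derivative frechet_derivative f (at (g x))) (at (g x))"
      using Ck_on_SucD(1)[OF Suc.prems(2)] that assms(3) by auto
    have "((f \<circ> g) has_derivative frechet_derivative f (at (g x)) \<circ> frechet_derivative g (at x)) (at x)"
      by (rule diff_chain_at[OF Ck_on_SucD(1)[OF Suc.prems(1) that] f])
    moreover have "frechet_derivative f (at (g x)) \<circ> frechet_derivative g (at x) =
      (\<lambda>u. \<Sum>i\<in>Basis. (frechet_derivative g (at x) u \<bullet> i) *\<^sub>R frechet_derivative f (at (g x)) i)"
      unfolding o_def by (rule ext, rule linear_basis_expansion, rule has_derivative_linear[OF f])
    ultimately show ?thesis by (simp add: o_def)
  qed
  show ?case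
  proof (rule Ck_on_SucI[OF assms(1) d], assumption, rule Ck_on_sum[OF assms(1)])
    fix u i
    show "Ck_on k S (\<lambda>x. (frechet_derivative g (at x) u \<bullet> i) *\<^sub>R frechet_derivative f (at (g x)) i)"
      by (intro Ck_on_bilinear[OF assms(1) bounded_bilinear_scaleR]
          Ck_on_linear[OF assms(1) bounded_linear_inner_left] Ck_on_SucD(2)[OF Suc.prems(1)]
          Suc.IH Ck_on_lower[OF Suc.prems(1)] Ck_on_SucD(2)[OF Suc.prems(2)])
  qed
qed

lemma Cinf_on_Ck: "Cinf_on S f \<Longrightarrow> Ck_on k S f"
  by (simp add: Cinf_on_def)

lemma Cinf_on_subset: "Cinf_on S f \<Longrightarrow> T \<subseteq> S \<Longrightarrow> Cinf_on T f"
  unfolding Cinf_on_def using Ck_on_subset by blast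

lemma Cinf_on_cong:
  "open S \<Longrightarrow> (\<And>x. x \<in> S \<Longrightarrow> f x = g x) \<Longrightarrow> Cinf_on S f \<Longrightarrow> Cinf_on S g"
  unfolding Cinf_on_def using Ck_on_cong by blast

lemma Cinf_on_local:
  assumes "\<And>x. x \<in> S \<Longrightarrow> \<exists>U g. open U \<and> x \<in> U \<and> Cinf_on U g \<and> (\<forall>y\<in>U. f y = g y)"
  shows "Cinf_on S f"
  unfolding Cinf_on_def
proof (intro allI Ck_on_local)
  fix k x assume "x \<in> S"
  then obtain U g where "open U" "x \<in> U" "Cinf_on U g" "\<forall>y\<in>U. f y = g y" using assms by blast
  then show "\<exists>U. open U \<and> x \<in> U \<and> Ck_on k U f"
    using Ck_on_cong[of U g f k] by (metis Cinf_on_def)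
qed

lemma Cinf_on_const [intro]: "Cinf_on S (\<lambda>x. c)"
  by (simp add: Cinf_on_def Ck_on_const)

lemma Cinf_on_linear: "open S \<Longrightarrow> bounded_linear L \<Longrightarrow> Cinf_on S f \<Longrightarrow> Cinf_on S (\<lambda>x. L (f x))"
  by (simp add: Cinf_on_def Ck_on_linear)

lemma Cinf_on_add: "open S \<Longrightarrow> Cinf_on S f \<Longrightarrow> Cinf_on S g \<Longrightarrow> Cinf_on S (\<lambda>x. f x + g x)"
  by (simp add: Cinf_on_def Ck_on_add)

lemma Cinf_on_diff: "open S \<Longrightarrow> Cinf_on S f \<Longrightarrow> Cinf_on S g \<Longrightarrow> Cinf_on S (\<lambda>x. f x - g x)"
  using Cinf_on_add[of S f "\<lambda>x. - g x"] Cinf_on_linear[OF _ bounded_linear_minus[OF bounded_linear_ident], of S g]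
  by simp

lemma Cinf_on_sum: "open S \<Longrightarrow> (\<And>i. i \<in> I \<Longrightarrow> Cinf_on S (f i)) \<Longrightarrow> Cinf_on S (\<lambda>x. \<Sum>i\<in>I. f i x)"
  by (simp add: Cinf_on_def Ck_on_sum)

lemma Cinf_on_bilinear:
  "open S \<Longrightarrow> bounded_bilinear b \<Longrightarrow> Cinf_on S f \<Longrightarrow> Cinf_on S g \<Longrightarrow> Cinf_on S (\<lambda>x. b (f x) (g x))"
  by (simp add: Cinf_on_def Ck_on_bilinear)

lemma Cinf_on_compose:
  fixes g :: "'a::euclidean_space \<Rightarrow> 'b::euclidean_space"
  shows "open S \<Longrightarrow> open T \<Longrightarrow> g ` S \<subseteq> T \<Longrightarrow> Cinf_on S g \<Longrightarrow> Cinf_on T f \<Longrightarrow> Cinf_on S (\<lambda>x. f (g x))"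
  by (simp add: Cinf_on_def Ck_on_compose)

lemma Cinf_on_bounded_linear:
  fixes L :: "'a::euclidean_space \<Rightarrow> 'b::real_normed_vector"
  assumes "bounded_linear L"
  shows "Cinf_on S L"
proof -
  have "Ck_on k UNIV L" for k
  proof (cases k)
    case 0
    then show ?thesis using assms by (simp add: linear_continuous_on)
  next
    case (Suc j)
    show ?thesis unfolding Suc
      by (rule Ck_on_SucI[of UNIV L "\<lambda>x. L"])
         (auto intro: Ck_on_const bounded_linear_imp_has_derivative assms)
  qed
  then show ?thesis using Ck_on_subset unfolding Cinf_on_def by blast
qed

lemma Cinf_on_ident: "Cinf_on S (\<lambda>x. x)"
  by (rule Cinf_on_bounded_linear) (rule bounded_linear_ident)

lemma Cinf_on_fst: "Cinf_on S fst"
  by (rule Cinf_on_bounded_linear) (rule bounded_linear_fst)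

lemma Cinf_on_snd: "Cinf_on S snd"
  by (rule Cinf_on_bounded_linear) (rule bounded_linear_snd)

lemma bounded_linear_Pair0: "bounded_linear (\<lambda>x. (x, 0))" "bounded_linear (\<lambda>x. (0, x))"
  by (auto intro!: bounded_linear_Pair bounded_linear_ident bounded_linear_zero)

lemma Cinf_on_Pair:
  assumes "open S" "Cinf_on S f" "Cinf_on S g"
  shows "Cinf_on S (\<lambda>x. (f x, g x))"
  using Cinf_on_add[OF assms(1) Cinf_on_linear[OF assms(1) bounded_linear_Pair0(1) assms(2)]
    Cinf_on_linear[OF assms(1) bounded_linear_Pair0(2) assms(3)]] by simp

lemma Cinf_on_has_derivative:
  "Cinf_on S f \<Longrightarrow> x \<in> S \<Longrightarrow> (f has_derivative frechet_derivative f (at x)) (at x)"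
  using Ck_on_SucD(1)[of 0 S f] unfolding Cinf_on_def by blast

lemma Cinf_on_frechet_derivative: "Cinf_on S f \<Longrightarrow> Cinf_on S (\<lambda>x. frechet_derivative f (at x) u)"
  unfolding Cinf_on_def using Ck_on_SucD(2) by blast

lemma Cinf_on_continuous_on: "Cinf_on S f \<Longrightarrow> continuous_on S f"
  using Cinf_on_Ck[of S f 0] by simp

text \<open>As an operator-valued function the derivative can itself be differentiated, and enters
  bilinear product rules.\<close>

definition bderiv :: "('a::euclidean_space \<Rightarrow> 'b::real_normed_vector) \<Rightarrow> 'a \<Rightarrow> 'a \<Rightarrow>\<^sub>L 'b" where
  "bderiv f x = Blinfun (frechet_derivative f (at x))"

lemma bderiv_apply: "Cinf_on S f \<Longrightarrow> x \<in> S \<Longrightarrow> blinfun_apply (bderiv f x) = frechet_derivative f (at x)"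
  unfolding bderiv_def
  by (intro bounded_linear_Blinfun_apply has_derivative_bounded_linear) (rule Cinf_on_has_derivative)

lemma has_derivative_bderiv: "Cinf_on S f \<Longrightarrow> x \<in> S \<Longrightarrow> (f has_derivative bderiv f x) (at x)"
  using Cinf_on_has_derivative bderiv_apply by metis

lemma bderiv_eqI: "(f has_derivative f') (at x) \<Longrightarrow> blinfun_apply (bderiv f x) = f'"
  unfolding bderiv_def using frechet_derivative_at
  by (metis bounded_linear_Blinfun_apply has_derivative_bounded_linear)

definition blinfun_rank1 :: "'a::euclidean_space \<Rightarrow> 'b::real_normed_vector \<Rightarrow> 'a \<Rightarrow>\<^sub>L 'b" where
  "blinfun_rank1 i y = blinfun_scaleR_left y o\<^sub>L blinfun_inner_left i"

lemma blinfun_rank1_apply [simp]: "blinfun_rank1 i y x = (x \<bullet> i) *\<^sub>R y"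
  by (simp add: blinfun_rank1_def blinfun_inner_left.rep_eq)

lemma bounded_linear_rank1: "bounded_linear (blinfun_rank1 i)"
  unfolding blinfun_rank1_def
  by (intro bounded_linear_compose[OF bounded_bilinear.bounded_linear_left[OF bounded_bilinear_blinfun_compose]]
      bounded_linear_blinfun_scaleR_left)

lemma Blinfun_rank1_expansion:
  fixes f :: "'a::euclidean_space \<Rightarrow> 'b::real_normed_vector"
  assumes "linear f"
  shows "Blinfun f = (\<Sum>i\<in>Basis. blinfun_rank1 i (f i))"
proof (rule blinfun_eqI)
  fix x
  have "blinfun_apply (Blinfun f) x = f x"
    by (simp add: bounded_linear_Blinfun_apply assms[unfolded linear_conv_bounded_linear])
  also have "\<dots> = (\<Sum>i\<in>Basis. (x \<bullet> i) *\<^sub>R f i)" by (rule linear_basis_expansion[OF assms])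
  finally show "blinfun_apply (Blinfun f) x = blinfun_apply (\<Sum>i\<in>Basis. blinfun_rank1 i (f i)) x"
    by (simp add: blinfun.sum_left)
qed

text \<open>On a finite-dimensional space an operator is a finite sum of rank one operators, so
  smoothness of an operator-valued function can be tested on each vector.\<close>

lemma Cinf_on_Blinfun:
  fixes f :: "'s::euclidean_space \<Rightarrow> 'a::euclidean_space \<Rightarrow> 'b::real_normed_vector"
  assumes "open S" "\<And>x. x \<in> S \<Longrightarrow> linear (f x)" "\<And>u. Cinf_on S (\<lambda>x. f x u)"
  shows "Cinf_on S (\<lambda>x. Blinfun (f x))"
proof (rule Cinf_on_cong[OF assms(1)])
  show "Cinf_on S (\<lambda>x. \<Sum>i\<in>Basis. blinfun_rank1 i (f x i))"
    by (intro Cinf_on_sum[OF assms(1)] Cinf_on_linear[OF assms(1) bounded_linear_rank1] assms(3))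
qed (simp add: assms(2) Blinfun_rank1_expansion)

lemma Cinf_on_bderiv: "open S \<Longrightarrow> Cinf_on S f \<Longrightarrow> Cinf_on S (bderiv f)"
  unfolding bderiv_def
  by (rule Cinf_on_Blinfun)
     (auto intro: Cinf_on_frechet_derivative has_derivative_linear[OF Cinf_on_has_derivative])

lemma Cinf_on_blinfun_apply:
  "open S \<Longrightarrow> Cinf_on S f \<Longrightarrow> Cinf_on S g \<Longrightarrow> Cinf_on S (\<lambda>x. blinfun_apply (f x) (g x))"
  by (rule Cinf_on_bilinear[OF _ bounded_bilinear_blinfun_apply])

lemma Cinf_on_blinfun_compose:
  "open S \<Longrightarrow> Cinf_on S f \<Longrightarrow> Cinf_on S g \<Longrightarrow> Cinf_on S (\<lambda>x. f x o\<^sub>L g x)"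
  by (rule Cinf_on_bilinear[OF _ bounded_bilinear_blinfun_compose])


text \<open>The resolvent identity \<open>R y - R x = - R y (K y - K x) R x\<close> first gives continuity of the inverse and then
  its derivative \<open>- R K' R\<close>. That derivative is built from \<open>R\<close> and a smooth function, so the order of
  differentiability can be raised step by step.\<close>

lemma Ck_on_operator_inverse:
  fixes K R :: "'s::euclidean_space \<Rightarrow> 'b::euclidean_space \<Rightarrow>\<^sub>L 'b"
  assumes "open S" "Cinf_on S K"
    and inv: "\<And>x. x \<in> S \<Longrightarrow> R x o\<^sub>L K x = id_blinfun" "\<And>x. x \<in> S \<Longrightarrow> K x o\<^sub>L R x = id_blinfun"
  shows "Ck_on k S R"
proof -
  have resolvent: "R y - R x = - (R y o\<^sub>L (K y - K x) o\<^sub>L R x)" if "x \<in> S" "y \<in> S" for x y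
  proof (rule blinfun_eqI)
    fix w
    have "R y (K y (R x w)) = R x w" "K x (R x w) = w"
      using inv(1)[OF that(2)] inv(2)[OF that(1)]
      by (metis blinfun_apply_blinfun_compose blinfun_apply_id_blinfun)+
    then show "blinfun_apply (R y - R x) w = blinfun_apply (- (R y o\<^sub>L (K y - K x) o\<^sub>L R x)) w"
      by (simp add: blinfun.diff_left blinfun.diff_right blinfun.minus_left)
  qed
  have Kd: "(K has_derivative frechet_derivative K (at x)) (at x)" if "x \<in> S" for x
    by (rule Cinf_on_has_derivative[OF assms(2) that])
  have lim: "(R \<longlongrightarrow> R x) (at x)" if x: "x \<in> S" for x
  proof -
    have K0: "((\<lambda>y. norm (K y - K x)) \<longlongrightarrow> 0) (at x)"
      using has_derivative_continuous[OF Kd[OF x]] by (simp add: isCont_def LIM_zero tendsto_norm_zero)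
    define c where "c = norm (R x) + 1"
    have c: "c > 0" unfolding c_def by (simp add: add_nonneg_pos)
    have ev: "\<forall>\<^sub>F y in at x. norm (K y - K x) < 1 / (2 * c)"
      using K0 c by (intro order_tendstoD) auto
    have evS: "\<forall>\<^sub>F y in at x. y \<in> S"
      using assms(1) x by (simp add: eventually_at_topological) blast
    have "\<forall>\<^sub>F y in at x. norm (R y - R x) \<le> 2 * c * c * norm (K y - K x)"
      using ev evS
    proof eventually_elim
      case (elim y)
      define d where "d = norm (K y - K x)"
      have d: "d * c \<le> 1/2" "d \<ge> 0" using elim(1) c unfolding d_def by (auto simp: field_simps)
      have rx: "norm (R x) \<le> c" unfolding c_def by simp
      have "norm (R y - R x) \<le> norm (R y o\<^sub>L (K y - K x)) * norm (R x)"
        using resolvent[OF x elim(2)] norm_blinfun_compose by (metis norm_minus_cancel)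
      also have "\<dots> \<le> (norm (R y) * d) * c"
        unfolding d_def using rx by (intro mult_mono norm_blinfun_compose) auto
      finally have 1: "norm (R y - R x) \<le> norm (R y) * (d * c)" by (simp add: mult.assoc)
      also have "\<dots> \<le> norm (R y) * (1/2)" using d by (intro mult_left_mono) auto
      finally have "norm (R y - R x) \<le> norm (R y) / 2" by simp
      moreover have "norm (R y) \<le> norm (R y - R x) + norm (R x)"
        by (metis diff_add_cancel norm_triangle_ineq)
      ultimately have "norm (R y) \<le> 2 * c" using rx by linarith
      then have "norm (R y) * (d * c) \<le> (2 * c) * (d * c)" using d c by (intro mult_right_mono) auto
      then show ?case using 1 unfolding d_def by (simp add: algebra_simps)
    qed
    moreover have "((\<lambda>y. 2 * c * c * norm (K y - K x)) \<longlongrightarrow> 0) (at x)"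
      by (rule tendsto_mult_right_zero[OF K0])
    ultimately have "((\<lambda>y. R y - R x) \<longlongrightarrow> 0) (at x)" by (rule Lim_null_comparison)
    then show ?thesis by (simp add: LIM_zero_iff)
  qed
  have Rd: "(R has_derivative (\<lambda>u. - (R x o\<^sub>L frechet_derivative K (at x) u o\<^sub>L R x))) (at x)" if x: "x \<in> S" for x
  proof -
    let ?D = "frechet_derivative K (at x)"
    have bl: "bounded_linear ?D" by (rule has_derivative_bounded_linear[OF Kd[OF x]])
    have bl': "bounded_linear (\<lambda>u. - (R x o\<^sub>L ?D u o\<^sub>L R x))"
      by (intro bounded_linear_minus bounded_linear_compose[OF bounded_bilinear.bounded_linear_left[OF bounded_bilinear_blinfun_compose]]
        bounded_linear_compose[OF bounded_bilinear.bounded_linear_right[OF bounded_bilinear_blinfun_compose]] bl)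
    \<comment> \<open>the error of the linear approximation of \<open>R\<close> is \<open>-R y (K y - K x - DK) R x - (R y - R x) DK R x\<close>\<close>
    have evS: "\<forall>\<^sub>F y in at x. y \<in> S"
      using assms(1) x by (simp add: eventually_at_topological) blast
    let ?e = "\<lambda>y. (K y - K x - ?D (y - x)) /\<^sub>R norm (y - x)"
    have e: "(?e \<longlongrightarrow> 0) (at x)" using Kd[OF x] by (simp add: has_derivative_def)
    obtain k where k: "\<And>u. norm (?D u) \<le> norm u * k" using bounded_linear.bounded[OF bl] by auto
    have Bf: "Bfun (\<lambda>y. ?D (y - x) /\<^sub>R norm (y - x)) (at x)"
    proof (rule BfunI, rule always_eventually, rule allI)
      fix y
      show "norm (?D (y - x) /\<^sub>R norm (y - x)) \<le> \<bar>k\<bar>"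
      proof (cases "y = x")
        case False
        then have "norm (?D (y - x)) / norm (y - x) \<le> k"
          using k[of "y - x"] by (simp add: divide_le_eq mult.commute)
        then show ?thesis by (simp add: divide_inverse mult.commute)
      qed simp
    qed
    have Z0: "Zfun (\<lambda>y. R y - R x) (at x)" using lim[OF x] by (simp add: tendsto_Zfun_iff)
    have Z: "Zfun (\<lambda>y. (R y - R x) o\<^sub>L (?D (y - x) /\<^sub>R norm (y - x))) (at x)"
      by (rule bounded_bilinear.Zfun_prod_Bfun[OF bounded_bilinear_blinfun_compose Z0 Bf])
    have T1: "((\<lambda>y. (R y - R x) o\<^sub>L (?D (y - x) /\<^sub>R norm (y - x)) o\<^sub>L R x) \<longlongrightarrow> 0) (at x)"
      using bounded_bilinear.tendsto_left_zero[OF bounded_bilinear_blinfun_compose] Z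
      by (simp add: tendsto_Zfun_iff)
    have T2: "((\<lambda>y. R y o\<^sub>L ?e y o\<^sub>L R x) \<longlongrightarrow> R x o\<^sub>L 0 o\<^sub>L R x) (at x)"
      by (intro bounded_bilinear.tendsto[OF bounded_bilinear_blinfun_compose] lim[OF x] e tendsto_const)
    have T: "((\<lambda>y. - (R y o\<^sub>L ?e y o\<^sub>L R x) - ((R y - R x) o\<^sub>L (?D (y - x) /\<^sub>R norm (y - x)) o\<^sub>L R x)) \<longlongrightarrow> 0) (at x)"
      using tendsto_diff[OF tendsto_minus[OF T2] T1] by simp
    have "((\<lambda>y. (R y - R x - (- (R x o\<^sub>L ?D (y - x) o\<^sub>L R x))) /\<^sub>R norm (y - x)) \<longlongrightarrow> 0) (at x)"
    proof (rule Lim_transform_eventually[OF T])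
      show "\<forall>\<^sub>F y in at x. - (R y o\<^sub>L ?e y o\<^sub>L R x) - ((R y - R x) o\<^sub>L (?D (y - x) /\<^sub>R norm (y - x)) o\<^sub>L R x)
         = (R y - R x - (- (R x o\<^sub>L ?D (y - x) o\<^sub>L R x))) /\<^sub>R norm (y - x)"
        using evS
      proof eventually_elim
        case (elim y)
        have "R y (K y w) = w" "K x (R x w) = w" for w
          using inv(1)[OF elim] inv(2)[OF x]
          by (metis blinfun_apply_blinfun_compose blinfun_apply_id_blinfun)+
        then show ?case
          by (intro blinfun_eqI)
             (simp add: blinfun.diff_left blinfun.diff_right blinfun.minus_left blinfun.minus_right
               blinfun.scaleR_left blinfun.scaleR_right scaleR_diff_right scaleR_add_right
               blinfun.add_left)
      qed
    qed
    then show ?thesis using bl' by (simp add: has_derivative_def)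
  qed
  show ?thesis
  proof (induction k)
    case 0
    show ?case using lim by (auto intro!: continuous_at_imp_continuous_on simp: isCont_def)
  next
    case (Suc k)
    show ?case
    proof (rule Ck_on_SucI[OF assms(1) Rd], assumption)
      fix u
      show "Ck_on k S (\<lambda>x. - (R x o\<^sub>L frechet_derivative K (at x) u o\<^sub>L R x))"
        by (rule Ck_on_linear[OF assms(1) bounded_linear_minus[OF bounded_linear_ident]])
          (intro Ck_on_bilinear[OF assms(1) bounded_bilinear_blinfun_compose] Suc
            Cinf_on_Ck Cinf_on_frechet_derivative assms(2))
    qed
  qed
qed

lemma Cinf_on_operator_inverse:
  fixes K R :: "'s::euclidean_space \<Rightarrow> 'b::euclidean_space \<Rightarrow>\<^sub>L 'b"
  assumes "open S" "Cinf_on S K" "\<And>x. x \<in> S \<Longrightarrow> R x o\<^sub>L K x = id_blinfun" "\<And>x. x \<in> S \<Longrightarrow> K x o\<^sub>L R x = id_blinfun"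
  shows "Cinf_on S R"
  unfolding Cinf_on_def using Ck_on_operator_inverse[OF assms] by blast


text \<open>The derivative of the local inverse \<open>g\<close> at \<open>y\<close> is the inverse of the operator \<open>bderiv f (g y)\<close>. It is thus a
  smooth function composed with \<open>g\<close>, and each order of differentiability of \<open>g\<close> yields the next one.\<close>

theorem smooth_inverse_function:
  fixes f :: "'a::euclidean_space \<Rightarrow> 'a"
  assumes "open U" "Cinf_on U f" "x0 \<in> U" "inj (blinfun_apply (bderiv f x0))"
  obtains U' V g where "open U'" "U' \<subseteq> U" "x0 \<in> U'" "open V" "f x0 \<in> V" "homeomorphism U' V f g" "Cinf_on V g"
proof -
  let ?f' = "bderiv f"
  obtain L where L: "linear L" "L \<circ> blinfun_apply (?f' x0) = id"
    using linear_injective_left_inverse[OF _ assms(4)] blinfun.bounded_linear_right bounded_linear.linear by blast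
  have inv: "Blinfun L o\<^sub>L ?f' x0 = id_blinfun"
    using L by (intro blinfun_eqI)
      (simp add: bounded_linear_Blinfun_apply linear_conv_bounded_linear fun_eq_iff)
  obtain U' V g g' where *: "open U'" "U' \<subseteq> U" "x0 \<in> U'" "open V" "f x0 \<in> V" "homeomorphism U' V f g"
    and g: "\<And>y. y \<in> V \<Longrightarrow> (g has_derivative (g' y)) (at y)"
      "\<And>y. y \<in> V \<Longrightarrow> g' y = inv (blinfun_apply (?f' (g y)))"
      "\<And>y. y \<in> V \<Longrightarrow> bij (blinfun_apply (?f' (g y)))"
    by (rule inverse_function_theorem[where U=U and f=f and f'="bderiv f" and ?x0.0=x0 and invf="Blinfun L"])
       (auto intro: has_derivative_bderiv[OF assms(2)] Cinf_on_continuous_on Cinf_on_bderiv assms(1-3) inv)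
  have gV: "g ` V = U'" and fg: "\<And>y. y \<in> V \<Longrightarrow> f (g y) = y" and gf: "\<And>x. x \<in> U' \<Longrightarrow> g (f x) = x"
    and cg: "continuous_on V g"
    using *(6) by (auto simp: homeomorphism_def)
  define R where "R = (\<lambda>x. Blinfun (g' (f x)))"
  have bl: "bounded_linear (g' y)" if "y \<in> V" for y
    using g(1)[OF that] has_derivative_bounded_linear by blast
  have fU: "f x \<in> V" if "x \<in> U'" for x using *(6) that by (auto simp: homeomorphism_def)
  have Rapp: "blinfun_apply (R x) = inv (blinfun_apply (?f' x))" and bij: "bij (blinfun_apply (?f' x))" if "x \<in> U'" for x
    using g(2,3)[OF fU[OF that]] gf[OF that] bl[OF fU[OF that]] unfolding R_def
    by (simp_all add: bounded_linear_Blinfun_apply)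
  have R: "Cinf_on U' R"
  proof (rule Cinf_on_operator_inverse[OF *(1)])
    show "Cinf_on U' ?f'" using Cinf_on_subset[OF Cinf_on_bderiv[OF assms(1,2)] *(2)] .
    show "R x o\<^sub>L ?f' x = id_blinfun" "?f' x o\<^sub>L R x = id_blinfun" if "x \<in> U'" for x
      using bij[OF that]
      by (auto intro!: blinfun_eqI simp: Rapp[OF that] bij_is_inj bij_is_surj surj_f_inv_f)
  qed
  have "Ck_on k V g" for k
  proof (induction k)
    case 0
    then show ?case using cg by simp
  next
    case (Suc k)
    show ?case
    proof (rule Ck_on_SucI[OF *(4) g(1)], assumption)
      fix u
      have "Ck_on k V (\<lambda>y. R (g y) u)"
        using gV by (intro Ck_on_compose[OF *(4,1) _ Suc, where f = "\<lambda>x. R x u"]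
          Ck_on_linear[OF *(1) blinfun.bounded_linear_left] Cinf_on_Ck R) auto
      moreover have "R (g y) u = g' y u" if "y \<in> V" for y
        unfolding R_def using fg[OF that] bl[OF that] by (simp add: bounded_linear_Blinfun_apply)
      ultimately show "Ck_on k V (\<lambda>y. g' y u)"
        by (rule Ck_on_cong[OF *(4), rotated])
    qed
  qed
  then show thesis using that[OF *] by (simp add: Cinf_on_def)
qed

subsection \<open>Symmetry of the second derivative\<close>

text \<open>Both mixed derivatives are limits of the same second difference quotient, by the
  mean value theorem applied in the two possible orders.\<close>

lemma second_derivative_swap_real:
  fixes f :: "'a::euclidean_space \<Rightarrow> real"
  assumes "open S" "Cinf_on S f" "x \<in> S"
  shows "frechet_derivative (\<lambda>y. frechet_derivative f (at y) u) (at x) v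
       = frechet_derivative (\<lambda>y. frechet_derivative f (at y) v) (at x) u"
proof -
  define D2 where "D2 a b y = frechet_derivative (\<lambda>z. frechet_derivative f (at z) a) (at y) b" for a b y
  define q where "q h = f (x + h *\<^sub>R u + h *\<^sub>R v) - f (x + h *\<^sub>R u) - f (x + h *\<^sub>R v) + f x" for h :: real
  have cD2: "isCont (D2 a b) x" for a b
    unfolding D2_def using assms
    by (intro continuous_on_interior[of S] Cinf_on_continuous_on Cinf_on_frechet_derivative) (auto simp: interior_open)
  obtain r where r: "r > 0" "ball x r \<subseteq> S" using assms(1,3) openE by blast
  define N where "N = norm u + norm v + 1"
  have N: "N > 0" "norm u \<le> N" "norm v \<le> N" unfolding N_def by (auto simp: add_nonneg_pos)
  have inS: "x + s *\<^sub>R a + t *\<^sub>R b \<in> S" if "0 \<le> s" "s \<le> h" "0 \<le> t" "t \<le> h" "h * N < r"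
      "{a, b} = {u, v}" for s t h a b
  proof -
    have "norm (s *\<^sub>R a + t *\<^sub>R b) \<le> s * norm a + t * norm b"
      using that by (metis abs_of_nonneg norm_scaleR norm_triangle_ineq)
    also have "\<dots> \<le> h * norm a + h * norm b" using that by (intro add_mono mult_right_mono) auto
    also have "\<dots> = h * (norm u + norm v)" using that(6) by (auto simp: doubleton_eq_iff algebra_simps)
    also have "\<dots> \<le> h * N" unfolding N_def using that by (intro mult_left_mono) auto
    finally have "norm (s *\<^sub>R a + t *\<^sub>R b) < r" using that by simp
    then have "x + (s *\<^sub>R a + t *\<^sub>R b) \<in> ball x r" by (metis add_diff_cancel_left' dist_commute dist_norm mem_ball)
    then show ?thesis using r(2) by (auto simp: add.assoc)
  qed
  \<comment> \<open>two applications of the mean value theorem to the second difference quotient\<close>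
  have mvt: "\<exists>s t. 0 < s \<and> s < h \<and> 0 < t \<and> t < h \<and>
       f (x + h *\<^sub>R a + h *\<^sub>R b) - f (x + h *\<^sub>R a) - f (x + h *\<^sub>R b) + f x = h * h * D2 a b (x + s *\<^sub>R a + t *\<^sub>R b)"
    if h: "0 < h" "h * N < r" and ab: "{a, b} = {u, v}" for h a b
  proof -
    let ?d = "\<lambda>y. frechet_derivative f (at y)"
    have "\<exists>s>0. s < h \<and> (f (x + h *\<^sub>R a + h *\<^sub>R b) - f (x + h *\<^sub>R a)) - (f (x + 0 *\<^sub>R a + h *\<^sub>R b) - f (x + 0 *\<^sub>R a))
       = (h - 0) * (?d (x + s *\<^sub>R a + h *\<^sub>R b) a - ?d (x + s *\<^sub>R a) a)"
    proof (rule MVT2[OF h(1)])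
      fix s assume s: "0 \<le> s" "s \<le> h"
      have S1: "x + s *\<^sub>R a + h *\<^sub>R b \<in> S" "x + s *\<^sub>R a \<in> S"
        using inS[of s h h a b] inS[of s h 0 a b] s h ab by auto
      have "((\<lambda>s. f (x + s *\<^sub>R a + h *\<^sub>R b)) has_derivative (\<lambda>c. ?d (x + s *\<^sub>R a + h *\<^sub>R b) (c *\<^sub>R a))) (at s)"
        by (rule has_derivative_compose[where g=f and f="\<lambda>s. x + s *\<^sub>R a + h *\<^sub>R b", OF _ Cinf_on_has_derivative[OF assms(2) S1(1)]]) (auto intro!: derivative_eq_intros)
      moreover have "((\<lambda>s. f (x + s *\<^sub>R a)) has_derivative (\<lambda>c. ?d (x + s *\<^sub>R a) (c *\<^sub>R a))) (at s)"
        by (rule has_derivative_compose[where g=f and f="\<lambda>s. x + s *\<^sub>R a", OF _ Cinf_on_has_derivative[OF assms(2) S1(2)]]) (auto intro!: derivative_eq_intros)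
      ultimately have "((\<lambda>s. f (x + s *\<^sub>R a + h *\<^sub>R b) - f (x + s *\<^sub>R a)) has_derivative
         (\<lambda>c. ?d (x + s *\<^sub>R a + h *\<^sub>R b) (c *\<^sub>R a) - ?d (x + s *\<^sub>R a) (c *\<^sub>R a))) (at s)"
        by (rule has_derivative_diff)
      moreover have "(\<lambda>c. ?d (x + s *\<^sub>R a + h *\<^sub>R b) (c *\<^sub>R a) - ?d (x + s *\<^sub>R a) (c *\<^sub>R a))
        = (*) (?d (x + s *\<^sub>R a + h *\<^sub>R b) a - ?d (x + s *\<^sub>R a) a)"
        using has_derivative_linear[OF Cinf_on_has_derivative[OF assms(2) S1(1)]]
          has_derivative_linear[OF Cinf_on_has_derivative[OF assms(2) S1(2)]]
        by (simp add: linear_scale fun_eq_iff algebra_simps)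
      ultimately show "((\<lambda>s. f (x + s *\<^sub>R a + h *\<^sub>R b) - f (x + s *\<^sub>R a)) has_real_derivative
         ?d (x + s *\<^sub>R a + h *\<^sub>R b) a - ?d (x + s *\<^sub>R a) a) (at s)"
        by (simp add: has_field_derivative_def)
    qed
    then obtain s where s: "0 < s" "s < h" and eq1:
       "f (x + h *\<^sub>R a + h *\<^sub>R b) - f (x + h *\<^sub>R a) - f (x + h *\<^sub>R b) + f x
       = h * (?d (x + s *\<^sub>R a + h *\<^sub>R b) a - ?d (x + s *\<^sub>R a) a)" by (auto simp: algebra_simps)
    have "\<exists>t>0. t < h \<and> ?d (x + s *\<^sub>R a + h *\<^sub>R b) a - ?d (x + s *\<^sub>R a + 0 *\<^sub>R b) a
       = (h - 0) * D2 a b (x + s *\<^sub>R a + t *\<^sub>R b)"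
    proof (rule MVT2[OF h(1)])
      fix t assume t: "0 \<le> t" "t \<le> h"
      have S1: "x + s *\<^sub>R a + t *\<^sub>R b \<in> S" using inS[of s h t a b] s t h ab by auto
      note d2 = Cinf_on_has_derivative[OF Cinf_on_frechet_derivative[OF assms(2), of a] S1]
      have "((\<lambda>t. ?d (x + s *\<^sub>R a + t *\<^sub>R b) a) has_derivative
        (\<lambda>c. frechet_derivative (\<lambda>z. ?d z a) (at (x + s *\<^sub>R a + t *\<^sub>R b)) (c *\<^sub>R b))) (at t)"
        by (rule has_derivative_compose[where g="\<lambda>z. ?d z a" and f="\<lambda>t. x + s *\<^sub>R a + t *\<^sub>R b", OF _ d2]) (auto intro!: derivative_eq_intros)
      moreover have "(\<lambda>c. frechet_derivative (\<lambda>z. ?d z a) (at (x + s *\<^sub>R a + t *\<^sub>R b)) (c *\<^sub>R b))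
         = (*) (D2 a b (x + s *\<^sub>R a + t *\<^sub>R b))"
        using has_derivative_linear[OF d2] by (simp add: linear_scale fun_eq_iff D2_def)
      ultimately show "((\<lambda>t. ?d (x + s *\<^sub>R a + t *\<^sub>R b) a) has_real_derivative D2 a b (x + s *\<^sub>R a + t *\<^sub>R b)) (at t)"
        by (simp add: has_field_derivative_def)
    qed
    then show ?thesis using s eq1 by auto
  qed
  have key: "\<bar>D2 u v x - D2 v u x\<bar> \<le> e" if "e > 0" for e
  proof -
    have ex: "\<exists>d>0. \<forall>y. dist y x < d \<longrightarrow> \<bar>D2 a b y - D2 a b x\<bar> < e / 2" for a b
      using cD2[of a b] half_gt_zero[OF \<open>e > 0\<close>] unfolding continuous_at_eps_delta dist_real_def by blast
    obtain d1 where d1: "d1 > 0" "\<And>y. dist y x < d1 \<Longrightarrow> \<bar>D2 u v y - D2 u v x\<bar> < e / 2" using ex by blast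
    obtain d2 where d2: "d2 > 0" "\<And>y. dist y x < d2 \<Longrightarrow> \<bar>D2 v u y - D2 v u x\<bar> < e / 2" using ex by blast
    define h where "h = min r (min d1 d2) / (2 * N)"
    have h: "0 < h" "h * N < r" "h * N < d1" "h * N < d2"
      unfolding h_def using r(1) d1(1) d2(1) N(1) by (auto simp: field_simps min_def)
    have near: "dist (x + s *\<^sub>R a + t *\<^sub>R b) x \<le> h * N" if "0 < s" "s < h" "0 < t" "t < h" "{a, b} = {u, v}" for s t a b
    proof -
      have "norm (s *\<^sub>R a + t *\<^sub>R b) \<le> s * norm a + t * norm b"
        using that by (metis abs_of_nonneg less_imp_le norm_scaleR norm_triangle_ineq)
      also have "\<dots> \<le> h * norm a + h * norm b" using that by (intro add_mono mult_right_mono) auto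
      also have "\<dots> = h * (norm u + norm v)" using that(5) by (auto simp: doubleton_eq_iff algebra_simps)
      also have "\<dots> \<le> h * N" unfolding N_def using h by (intro mult_left_mono) auto
      finally show ?thesis by (simp add: dist_norm add.assoc)
    qed
    obtain s t where st: "0 < s" "s < h" "0 < t" "t < h" "q h = h * h * D2 u v (x + s *\<^sub>R u + t *\<^sub>R v)"
      using mvt[OF h(1,2), of u v] unfolding q_def by auto
    obtain s' t' where st': "0 < s'" "s' < h" "0 < t'" "t' < h" "q h = h * h * D2 v u (x + s' *\<^sub>R v + t' *\<^sub>R u)"
      using mvt[OF h(1,2), of v u] unfolding q_def by (auto simp: algebra_simps)
    have "D2 u v (x + s *\<^sub>R u + t *\<^sub>R v) = D2 v u (x + s' *\<^sub>R v + t' *\<^sub>R u)" using st(5) st'(5) h(1) by simp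
    moreover have "\<bar>D2 u v (x + s *\<^sub>R u + t *\<^sub>R v) - D2 u v x\<bar> < e / 2"
      using near[OF st(1-4)] h by (intro d1(2)) force
    moreover have "\<bar>D2 v u (x + s' *\<^sub>R v + t' *\<^sub>R u) - D2 v u x\<bar> < e / 2"
      using near[OF st'(1-4)] h by (intro d2(2)) force
    ultimately show ?thesis by linarith
  qed
  have "D2 u v x = D2 v u x"
  proof (rule ccontr)
    assume "D2 u v x \<noteq> D2 v u x"
    then show False using key[of "\<bar>D2 u v x - D2 v u x\<bar> / 2"] by simp
  qed
  then show ?thesis unfolding D2_def .
qed

lemma second_derivative_swap:
  fixes f :: "'a::euclidean_space \<Rightarrow> 'b::euclidean_space"
  assumes "open S" "Cinf_on S f" "x \<in> S"
  shows "frechet_derivative (\<lambda>y. frechet_derivative f (at y) u) (at x) v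
       = frechet_derivative (\<lambda>y. frechet_derivative f (at y) v) (at x) u"
proof (rule euclidean_eqI)
  fix i :: 'b assume "i \<in> Basis"
  have d: "frechet_derivative (\<lambda>y. frechet_derivative f (at y) a) (at x) b \<bullet> i
    = frechet_derivative (\<lambda>y. frechet_derivative (\<lambda>z. f z \<bullet> i) (at y) a) (at x) b" for a b
  proof -
    have eq: "frechet_derivative (\<lambda>z. f z \<bullet> i) (at y) = (\<lambda>u. frechet_derivative f (at y) u \<bullet> i)" if "y \<in> S" for y
      using has_derivative_inner_left[OF Cinf_on_has_derivative[OF assms(2) that], of i]
      by (rule frechet_derivative_at[symmetric])
    have "((\<lambda>y. frechet_derivative f (at y) a \<bullet> i) has_derivative
       (\<lambda>b. frechet_derivative (\<lambda>y. frechet_derivative f (at y) a) (at x) b \<bullet> i)) (at x)"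
      by (rule has_derivative_inner_left[OF Cinf_on_has_derivative[OF Cinf_on_frechet_derivative[OF assms(2)] assms(3)]])
    then have "((\<lambda>y. frechet_derivative (\<lambda>z. f z \<bullet> i) (at y) a) has_derivative
       (\<lambda>b. frechet_derivative (\<lambda>y. frechet_derivative f (at y) a) (at x) b \<bullet> i)) (at x)"
      by (rule has_derivative_transform_within_open[OF _ assms(1,3)]) (simp add: eq)
    then show ?thesis by (metis frechet_derivative_at)
  qed
  show "frechet_derivative (\<lambda>y. frechet_derivative f (at y) u) (at x) v \<bullet> i
       = frechet_derivative (\<lambda>y. frechet_derivative f (at y) v) (at x) u \<bullet> i"
    unfolding d
    by (rule second_derivative_swap_real[OF assms(1) Cinf_on_linear[OF assms(1) bounded_linear_inner_left assms(2)] assms(3)])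
qed

section \<open>Smooth functions on subsets, and tangent spaces\<close>

lemma smooth_on_extE:
  assumes "smooth_on N f" "x \<in> N"
  obtains U F where "open U" "x \<in> U" "Cinf_on U F" "\<forall>y\<in>U \<inter> N. F y = f y"
proof -
  have "\<exists>U F. open U \<and> x \<in> U \<and> Cinf_on U F \<and> (\<forall>y\<in>U \<inter> N. F y = f y)"
    using assms(1)[unfolded smooth_on_def] assms(2) by (rule bspec)
  then show thesis
  proof (elim exE conjE)
    fix U F assume "open U" "x \<in> U" "Cinf_on U F" "\<forall>y\<in>U \<inter> N. F y = f y"
    then show thesis by (intro that[of U F]) auto
  qed
qed

lemma smooth_onI:
  assumes "\<And>x. x \<in> N \<Longrightarrow> \<exists>U F. open U \<and> x \<in> U \<and> Cinf_on U F \<and> (\<forall>y\<in>U \<inter> N. F y = f y)"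
  shows "smooth_on N f"
  unfolding smooth_on_def using assms by (rule ballI)

lemma smooth_on_subset:
  assumes "smooth_on N f" "M \<subseteq> N"
  shows "smooth_on M f"
proof (rule smooth_onI)
  fix x assume "x \<in> M"
  obtain U F where "open U" "x \<in> U" "Cinf_on U F" "\<forall>y\<in>U \<inter> N. F y = f y"
    using smooth_on_extE[OF assms(1) subsetD[OF assms(2) \<open>x \<in> M\<close>]] .
  then show "\<exists>U F. open U \<and> x \<in> U \<and> Cinf_on U F \<and> (\<forall>y\<in>U \<inter> M. F y = f y)"
    using assms(2) by (intro exI[of _ U] exI[of _ F]) auto
qed

lemma smooth_on_cong:
  assumes "smooth_on N f" "\<And>x. x \<in> N \<Longrightarrow> f x = g x"
  shows "smooth_on N g"
proof (rule smooth_onI)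
  fix x assume "x \<in> N"
  obtain U F where "open U" "x \<in> U" "Cinf_on U F" "\<forall>y\<in>U \<inter> N. F y = f y"
    using smooth_on_extE[OF assms(1) \<open>x \<in> N\<close>] .
  then show "\<exists>U F. open U \<and> x \<in> U \<and> Cinf_on U F \<and> (\<forall>y\<in>U \<inter> N. F y = g y)"
    using assms(2) by (intro exI[of _ U] exI[of _ F]) auto
qed

lemma Cinf_on_imp_smooth_on: "open U \<Longrightarrow> Cinf_on U f \<Longrightarrow> N \<subseteq> U \<Longrightarrow> smooth_on N f"
  by (rule smooth_onI) (intro exI[of _ U] exI[of _ f], auto)

lemma smooth_on_imp_Cinf_on: "open U \<Longrightarrow> smooth_on U f \<Longrightarrow> Cinf_on U f"
proof (rule Cinf_on_local)
  fix x assume "open U" "smooth_on U f" "x \<in> U"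
  obtain V F where V: "open V" "x \<in> V" "Cinf_on V F" "\<forall>y\<in>V \<inter> U. F y = f y"
    using smooth_on_extE[OF \<open>smooth_on U f\<close> \<open>x \<in> U\<close>] .
  then show "\<exists>V F. open V \<and> x \<in> V \<and> Cinf_on V F \<and> (\<forall>y\<in>V. f y = F y)"
    using \<open>open U\<close> \<open>x \<in> U\<close>
    by (intro exI[of _ "V \<inter> U"] exI[of _ F]) (auto intro: Cinf_on_subset)
qed

lemma smooth_on_local:
  assumes "\<And>x. x \<in> N \<Longrightarrow> \<exists>U. open U \<and> x \<in> U \<and> smooth_on (U \<inter> N) f"
  shows "smooth_on N f"
  unfolding smooth_on_def
proof
  fix x assume "x \<in> N"
  then obtain U where U: "open U" "x \<in> U" "smooth_on (U \<inter> N) f" using assms by blast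
  have "x \<in> U \<inter> N" using U(2) \<open>x \<in> N\<close> by simp
  obtain V F where V: "open V" "x \<in> V" "Cinf_on V F" "\<forall>y\<in>V \<inter> (U \<inter> N). F y = f y"
    using smooth_on_extE[OF U(3) \<open>x \<in> U \<inter> N\<close>] .
  then show "\<exists>U F. open U \<and> x \<in> U \<and> Cinf_on U F \<and> (\<forall>y\<in>U \<inter> N. F y = f y)"
    using U by (intro exI[of _ "V \<inter> U"] exI[of _ F]) (auto intro: Cinf_on_subset)
qed

lemma smooth_on_const: "smooth_on N (\<lambda>x. c)"
  by (rule Cinf_on_imp_smooth_on[of UNIV]) auto

lemma smooth_on_bounded_linear: "bounded_linear L \<Longrightarrow> smooth_on N L"
  by (rule Cinf_on_imp_smooth_on[of UNIV]) (auto intro: Cinf_on_bounded_linear)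

lemma smooth_on_fst: "smooth_on N fst"
  by (rule smooth_on_bounded_linear) (rule bounded_linear_fst)

lemma smooth_on_snd: "smooth_on N snd"
  by (rule smooth_on_bounded_linear) (rule bounded_linear_snd)

lemma smooth_on_bilinear:
  assumes "bounded_bilinear b" "smooth_on N f" "smooth_on N g"
  shows "smooth_on N (\<lambda>x. b (f x) (g x))"
  unfolding smooth_on_def
proof
  fix x assume "x \<in> N"
  obtain U F where U: "open U" "x \<in> U" "Cinf_on U F" "\<forall>y\<in>U \<inter> N. F y = f y"
    using smooth_on_extE[OF assms(2) \<open>x \<in> N\<close>] .
  obtain V G where V: "open V" "x \<in> V" "Cinf_on V G" "\<forall>y\<in>V \<inter> N. G y = g y"
    using smooth_on_extE[OF assms(3) \<open>x \<in> N\<close>] .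
  have "Cinf_on (U \<inter> V) (\<lambda>y. b (F y) (G y))"
    using U V by (intro Cinf_on_bilinear[OF _ assms(1)]) (auto intro: Cinf_on_subset)
  then show "\<exists>U F. open U \<and> x \<in> U \<and> Cinf_on U F \<and> (\<forall>y\<in>U \<inter> N. F y = b (f y) (g y))"
    using U V by (intro exI[of _ "U \<inter> V"] exI[of _ "\<lambda>y. b (F y) (G y)"]) auto
qed

lemma smooth_on_linear:
  assumes "bounded_linear L" "smooth_on N f"
  shows "smooth_on N (\<lambda>x. L (f x))"
proof -
  have "bounded_bilinear (\<lambda>(r::real) x. r *\<^sub>R L x)"
    by (rule bounded_bilinear.comp[OF bounded_bilinear_scaleR bounded_linear_ident assms(1), simplified])
  from smooth_on_bilinear[OF this smooth_on_const[where c=1] assms(2)] show ?thesis by simp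
qed

lemma smooth_on_Pair:
  assumes "smooth_on N f" "smooth_on N g"
  shows "smooth_on N (\<lambda>x. (f x, g x))"
  unfolding smooth_on_def
proof
  fix x assume "x \<in> N"
  obtain U F where U: "open U" "x \<in> U" "Cinf_on U F" "\<forall>y\<in>U \<inter> N. F y = f y"
    using smooth_on_extE[OF assms(1) \<open>x \<in> N\<close>] .
  obtain V G where V: "open V" "x \<in> V" "Cinf_on V G" "\<forall>y\<in>V \<inter> N. G y = g y"
    using smooth_on_extE[OF assms(2) \<open>x \<in> N\<close>] .
  have "Cinf_on (U \<inter> V) (\<lambda>y. (F y, G y))"
    using U V by (intro Cinf_on_Pair) (auto intro: Cinf_on_subset)
  then show "\<exists>U F. open U \<and> x \<in> U \<and> Cinf_on U F \<and> (\<forall>y\<in>U \<inter> N. F y = (f y, g y))"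
    using U V by (intro exI[of _ "U \<inter> V"] exI[of _ "\<lambda>y. (F y, G y)"]) auto
qed

lemma smooth_on_add: "smooth_on N f \<Longrightarrow> smooth_on N g \<Longrightarrow> smooth_on N (\<lambda>x. f x + g x)"
  using smooth_on_linear[OF bounded_linear_add[OF bounded_linear_fst bounded_linear_snd] smooth_on_Pair[of N f g]]
  by simp

lemma smooth_on_diff: "smooth_on N f \<Longrightarrow> smooth_on N g \<Longrightarrow> smooth_on N (\<lambda>x. f x - g x)"
  using smooth_on_linear[OF bounded_linear_sub[OF bounded_linear_fst bounded_linear_snd] smooth_on_Pair[of N f g]]
  by simp

lemma smooth_on_minus: "smooth_on N f \<Longrightarrow> smooth_on N (\<lambda>x. - f x)"
  by (rule smooth_on_linear[OF bounded_linear_minus[OF bounded_linear_ident]])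

lemma smooth_on_sum: "(\<And>i. i \<in> I \<Longrightarrow> smooth_on N (f i)) \<Longrightarrow> smooth_on N (\<lambda>x. \<Sum>i\<in>I. f i x)"
  by (induction I rule: infinite_finite_induct) (auto intro: smooth_on_const smooth_on_add)

lemmas smooth_on_blinfun_apply = smooth_on_bilinear[OF bounded_bilinear_blinfun_apply]
lemmas smooth_on_blinfun_compose = smooth_on_bilinear[OF bounded_bilinear_blinfun_compose]
lemmas smooth_on_inner = smooth_on_bilinear[OF bounded_bilinear_inner]
lemmas smooth_on_scaleR = smooth_on_bilinear[OF bounded_bilinear_scaleR]

lemma smooth_on_Blinfun:
  fixes f :: "'s::euclidean_space \<Rightarrow> 'a::euclidean_space \<Rightarrow> 'b::real_normed_vector"
  assumes "\<And>x. x \<in> S \<Longrightarrow> linear (f x)" "\<And>u. smooth_on S (\<lambda>x. f x u)"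
  shows "smooth_on S (\<lambda>x. Blinfun (f x))"
proof (rule smooth_on_cong)
  show "smooth_on S (\<lambda>x. \<Sum>i\<in>Basis. blinfun_rank1 i (f x i))"
    by (intro smooth_on_sum smooth_on_linear[OF bounded_linear_rank1] assms(2))
qed (simp add: assms(1) Blinfun_rank1_expansion)

lemma smooth_on_compose:
  fixes g :: "'a::euclidean_space \<Rightarrow> 'b::euclidean_space"
  assumes "smooth_on S g" "smooth_on T f" "g ` S \<subseteq> T"
  shows "smooth_on S (\<lambda>x. f (g x))"
  unfolding smooth_on_def
proof
  fix x assume "x \<in> S"
  obtain U G where U: "open U" "x \<in> U" "Cinf_on U G" "\<forall>y\<in>U \<inter> S. G y = g y"
    using smooth_on_extE[OF assms(1) \<open>x \<in> S\<close>] .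
  have gx: "g x \<in> T" using \<open>x \<in> S\<close> assms(3) by blast
  obtain V F where V: "open V" "g x \<in> V" "Cinf_on V F" "\<forall>y\<in>V \<inter> T. F y = f y"
    using smooth_on_extE[OF assms(2) gx] .
  have W: "open (U \<inter> G -` V)"
    using continuous_open_preimage[OF Cinf_on_continuous_on[OF U(3)] U(1) V(1)] .
  have "Cinf_on (U \<inter> G -` V) (\<lambda>y. F (G y))"
    by (rule Cinf_on_compose[OF W V(1) _ Cinf_on_subset[OF U(3)] V(3)]) auto
  then show "\<exists>U F. open U \<and> x \<in> U \<and> Cinf_on U F \<and> (\<forall>y\<in>U \<inter> S. F y = f (g y))"
    using U V W assms(3) \<open>x \<in> S\<close>
    by (intro exI[of _ "U \<inter> G -` V"] exI[of _ "\<lambda>y. F (G y)"]) (auto simp: image_subset_iff)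
qed

subsection \<open>Tangent spaces and directional derivatives\<close>

lemma dirD_localize:
  assumes "open U" "x \<in> U"
  shows "dirD (U \<inter> N) f x = dirD N f x"
proof -
  have "at x within (U \<inter> N) = at x within N"
    by (rule at_within_nhd[OF assms(2,1)]) auto
  then show ?thesis unfolding dirD_def by (intro ext) simp
qed

lemma tangent_spaceI:
  assumes "0 < e" "Cinf_on {-e<..<e} c" "\<And>t. t \<in> {-e<..<e} \<Longrightarrow> c t \<in> N" "c (0::real) = x"
    "(c has_vector_derivative u) (at 0)"
  shows "u \<in> tangent_space N x"
  using assms unfolding tangent_space_def by blast

lemma tangent_spaceE:
  assumes "u \<in> tangent_space N x"
  obtains c e where "0 < e" "Cinf_on {-e<..<e} c" "\<forall>t\<in>{-e<..<e}. c t \<in> N" "c (0::real) = x"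
    "(c has_vector_derivative u) (at 0)"
  using assms unfolding tangent_space_def by blast

lemma tangent_space_mem: "u \<in> tangent_space N x \<Longrightarrow> x \<in> N"
  by (metis greaterThanLessThan_iff neg_less_0_iff_less tangent_spaceE)

lemma continuous_on_open_interval_nbhd:
  assumes "(0::real) < e" "continuous_on {-e<..<e} c" "open U" "c 0 \<in> U"
  obtains d where "0 < d" "d \<le> e" "\<And>t. t \<in> {-d<..<d} \<Longrightarrow> c t \<in> U"
proof -
  have "open ({-e<..<e} \<inter> c -` U)" using continuous_open_preimage[OF assms(2) _ assms(3)] by simp
  moreover have "0 \<in> {-e<..<e} \<inter> c -` U" using assms by auto
  ultimately obtain d where d: "d > 0" "ball 0 d \<subseteq> {-e<..<e} \<inter> c -` U" by (meson openE)
  show thesis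
  proof (rule that[of "min d e"])
    show "c t \<in> U" if "t \<in> {- min d e<..<min d e}" for t
    proof -
      have "t \<in> ball 0 d" using that by (auto simp: dist_real_def)
      then show ?thesis using d by blast
    qed
  qed (use d assms in auto)
qed

lemma tangent_space_localize:
  assumes "open U" "x \<in> U"
  shows "tangent_space (U \<inter> N) x = tangent_space N x"
proof
  show "tangent_space (U \<inter> N) x \<subseteq> tangent_space N x"
    unfolding tangent_space_def by blast
  show "tangent_space N x \<subseteq> tangent_space (U \<inter> N) x"
  proof
    fix u assume "u \<in> tangent_space N x"
    then obtain c e where c: "0 < e" "Cinf_on {-e<..<e} c" "\<forall>t\<in>{-e<..<e}. c t \<in> N" "c (0::real) = x"
      "(c has_vector_derivative u) (at 0)" by (rule tangent_spaceE)
    obtain d where d: "0 < d" "d \<le> e" "\<And>t. t \<in> {-d<..<d} \<Longrightarrow> c t \<in> U"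
      using continuous_on_open_interval_nbhd[OF c(1) Cinf_on_continuous_on[OF c(2)] assms(1)] c(4) assms(2) by metis
    show "u \<in> tangent_space (U \<inter> N) x"
      using c d by (intro tangent_spaceI[of d c]) (auto intro: Cinf_on_subset)
  qed
qed

text \<open>A derivative within \<open>N\<close> is not unique, but on a tangent vector it is the derivative along a curve in
  \<open>N\<close>. This is what makes \<open>dirD\<close> meaningful on tangent vectors, and reduces its calculus there to that of
  derivatives.\<close>

lemma has_derivative_along_curve:
  assumes f: "(f has_derivative D) (at x within N)"
    and c: "0 < e" "\<forall>t\<in>{-e<..<e}. c t \<in> N" "c (0::real) = x" "(c has_vector_derivative u) (at 0)"
  shows "((\<lambda>t. f (c t)) has_vector_derivative D u) (at 0)"
proof -
  have c': "(c has_vector_derivative u) (at 0 within {-e<..<e})"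
    using c(4) has_vector_derivative_at_within by blast
  have f': "(f has_derivative D) (at (c 0) within c ` {-e<..<e})"
    using has_derivative_subset[OF f, of "c ` {-e<..<e}"] c(2,3) by auto
  have "(f \<circ> c has_vector_derivative D u) (at 0 within {-e<..<e})"
    by (rule vector_derivative_diff_chain_within[OF c' f'])
  then show ?thesis using c(1) by (simp add: o_def at_within_open[of 0 "{-e<..<e}"])
qed

lemma dirD_eqI:
  assumes f: "(f has_derivative D) (at x within N)" and u: "u \<in> tangent_space N x"
  shows "dirD N f x u = D u"
proof -
  obtain c e where c: "0 < e" "Cinf_on {-e<..<e} c" "\<forall>t\<in>{-e<..<e}. c t \<in> N" "c (0::real) = x"
    "(c has_vector_derivative u) (at 0)" using u by (rule tangent_spaceE)
  have "(f has_derivative dirD N f x) (at x within N)"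
    using f unfolding dirD_def[abs_def] using frechet_derivative_works differentiable_def by blast
  then show ?thesis
    using has_derivative_along_curve[OF _ c(1,3,4,5)] f vector_derivative_unique_at by blast
qed

lemma dirD_cong:
  assumes "\<And>y. y \<in> N \<Longrightarrow> f y = g y" "x \<in> N"
  shows "dirD N f x = dirD N g x"
proof -
  have "(f has_derivative D) (at x within N) \<longleftrightarrow> (g has_derivative D) (at x within N)" for D
    using assms by (metis has_derivative_transform)
  then show ?thesis unfolding dirD_def frechet_derivative_def by simp
qed

lemma smooth_on_has_derivative:
  assumes "smooth_on N f" "x \<in> N"
  shows "(f has_derivative dirD N f x) (at x within N)"
proof -
  obtain U F where U: "open U" "x \<in> U" "Cinf_on U F" "\<forall>y\<in>U \<inter> N. F y = f y"
    using smooth_on_extE[OF assms] .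
  have "(F has_derivative bderiv F x) (at x within (U \<inter> N))"
    using has_derivative_bderiv[OF U(3,2)] has_derivative_at_withinI by blast
  then have "(f has_derivative bderiv F x) (at x within (U \<inter> N))"
    using U(2,4) assms(2) by (intro has_derivative_transform[where g=f and f=F and s="U \<inter> N"]) auto
  moreover have "at x within (U \<inter> N) = at x within N"
    by (rule at_within_nhd[OF U(2,1)]) auto
  ultimately show ?thesis unfolding dirD_def[abs_def]
    using frechet_derivative_works differentiable_def by metis
qed

lemma dirD_linear_fun: "smooth_on N f \<Longrightarrow> x \<in> N \<Longrightarrow> linear (dirD N f x)"
  using has_derivative_linear[OF smooth_on_has_derivative] .

lemma dirD_ext:
  assumes "open U" "x \<in> U" "Cinf_on U F" "\<And>y. y \<in> U \<inter> N \<Longrightarrow> F y = f y" "u \<in> tangent_space N x"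
  shows "dirD N f x u = bderiv F x u"
proof (rule dirD_eqI[OF _ assms(5)])
  have "(F has_derivative bderiv F x) (at x within (U \<inter> N))"
    using has_derivative_bderiv[OF assms(3,2)] has_derivative_at_withinI by blast
  then have "(f has_derivative bderiv F x) (at x within (U \<inter> N))"
    using assms tangent_space_mem[OF assms(5)] by (intro has_derivative_transform[where g=f and f=F and s="U \<inter> N"]) auto
  moreover have "at x within (U \<inter> N) = at x within N"
    by (rule at_within_nhd[OF assms(2,1)]) auto
  ultimately show "(f has_derivative bderiv F x) (at x within N)" by simp
qed

lemma dirD_bilinear:
  assumes "bounded_bilinear b" "smooth_on N f" "smooth_on N g" "u \<in> tangent_space N x"
  shows "dirD N (\<lambda>y. b (f y) (g y)) x u = b (f x) (dirD N g x u) + b (dirD N f x u) (g x)"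
  using tangent_space_mem[OF assms(4)]
  by (intro dirD_eqI[OF _ assms(4)] bounded_bilinear.FDERIV[OF assms(1)] smooth_on_has_derivative assms)

lemma dirD_const: "u \<in> tangent_space N x \<Longrightarrow> dirD N (\<lambda>y. c) x u = 0"
  by (rule dirD_eqI[OF has_derivative_const])

lemma dirD_diff:
  assumes "smooth_on N f" "smooth_on N g" "u \<in> tangent_space N x"
  shows "dirD N (\<lambda>y. f y - g y) x u = dirD N f x u - dirD N g x u"
  using tangent_space_mem[OF assms(3)]
  by (intro dirD_eqI[OF _ assms(3)] has_derivative_diff smooth_on_has_derivative assms)

lemmas dirD_blinfun_apply = dirD_bilinear[OF bounded_bilinear_blinfun_apply]
lemmas dirD_blinfun_compose = dirD_bilinear[OF bounded_bilinear_blinfun_compose]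
lemmas dirD_inner = dirD_bilinear[OF bounded_bilinear_inner]

lemma dirD_blinfun_apply_const:
  assumes "smooth_on N f" "u \<in> tangent_space N x"
  shows "dirD N (\<lambda>y. blinfun_apply (f y) w) x u = dirD N f x u w"
  using dirD_blinfun_apply[OF assms(1) smooth_on_const assms(2), of w] dirD_const[OF assms(2), of w]
  by (simp add: blinfun.zero_right)

lemma dirD_compose:
  fixes g :: "'a::euclidean_space \<Rightarrow> 'b::euclidean_space"
  assumes "smooth_on S g" "smooth_on T f" "g ` S \<subseteq> T" "u \<in> tangent_space S x"
  shows "dirD S (\<lambda>y. f (g y)) x u = dirD T f (g x) (dirD S g x u)"
proof -
  have x: "x \<in> S" by (rule tangent_space_mem[OF assms(4)])
  have "(f has_derivative dirD T f (g x)) (at (g x) within g ` S)"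
    using smooth_on_has_derivative[OF assms(2), of "g x"] assms(3) x has_derivative_subset by blast
  from diff_chain_within[OF smooth_on_has_derivative[OF assms(1) x] this]
  show ?thesis using dirD_eqI[OF _ assms(4)] by (fastforce simp: o_def)
qed

lemma tangent_space_image:
  fixes g :: "'a::euclidean_space \<Rightarrow> 'b::euclidean_space"
  assumes "smooth_on S g" "g ` S \<subseteq> T" "u \<in> tangent_space S x"
  shows "dirD S g x u \<in> tangent_space T (g x)"
proof -
  obtain c e where c: "0 < e" "Cinf_on {-e<..<e} c" "\<forall>t\<in>{-e<..<e}. c t \<in> S" "c (0::real) = x"
    "(c has_vector_derivative u) (at 0)" using assms(3) by (rule tangent_spaceE)
  have "smooth_on {-e<..<e} (\<lambda>t. g (c t))"
    using c by (intro smooth_on_compose[OF _ assms(1)] Cinf_on_imp_smooth_on[OF _ c(2)]) auto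
  then have "Cinf_on {-e<..<e} (\<lambda>t. g (c t))" by (intro smooth_on_imp_Cinf_on) auto
  moreover have "((\<lambda>t. g (c t)) has_vector_derivative dirD S g x u) (at 0)"
    using c tangent_space_mem[OF assms(3)]
    by (intro has_derivative_along_curve[OF smooth_on_has_derivative[OF assms(1)]]) auto
  ultimately show ?thesis using c assms(2) by (intro tangent_spaceI[OF c(1)]) auto
qed

lemma tangent_space_open: "open U \<Longrightarrow> x \<in> U \<Longrightarrow> tangent_space U x = UNIV"
proof safe
  fix u :: 'a assume U: "open U" "x \<in> U"
  let ?c = "\<lambda>t::real. x + t *\<^sub>R u"
  have cont: "continuous_on {-1<..<1} ?c" by (intro continuous_intros)
  obtain d where d: "0 < d" "d \<le> 1" "\<And>t. t \<in> {-d<..<d} \<Longrightarrow> ?c t \<in> U"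
    using continuous_on_open_interval_nbhd[OF _ cont U(1)] U(2) by auto
  show "u \<in> tangent_space U x"
    using d(1,3)
    by (intro tangent_spaceI[of d ?c])
      (auto intro!: Cinf_on_add Cinf_on_const derivative_eq_intros
        Cinf_on_bounded_linear[where L="\<lambda>t. t *\<^sub>R u"] bounded_linear_scaleR_left)
qed simp

lemma dirD_open: "open U \<Longrightarrow> x \<in> U \<Longrightarrow> dirD U f x = frechet_derivative f (at x)"
  unfolding dirD_def by (simp add: at_within_open[of x U])

text \<open>In a slice chart, curves in \<open>N\<close> are curves in the subspace \<open>S\<close>, whose velocities lie in \<open>S\<close> because \<open>S\<close> is
  closed. Conversely, a straight line in \<open>S\<close> realises each vector of \<open>S\<close>.\<close>

lemma tangent_space_eq_chart:
  fixes N :: "'a::euclidean_space set"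
  assumes "open U" "x \<in> U" "open V" "homeomorphism U V \<phi> \<psi>" "Cinf_on U \<phi>" "Cinf_on V \<psi>"
    "subspace S" "\<phi> ` (U \<inter> N) = V \<inter> S" "x \<in> N"
  shows "tangent_space N x = bderiv \<psi> (\<phi> x) ` S"
proof -
  have inv: "\<And>y. y \<in> U \<Longrightarrow> \<psi> (\<phi> y) = y" "\<And>z. z \<in> V \<Longrightarrow> \<phi> (\<psi> z) = z" "\<phi> ` U = V" "\<psi> ` V = U"
    using assms(4) by (auto simp: homeomorphism_def)
  have \<psi>S: "\<psi> z \<in> N" if "z \<in> V \<inter> S" for z using that assms(8) inv(1) by (metis IntD1 IntD2 imageE)
  have px: "\<phi> x \<in> V \<inter> S" using assms(2,8,9) by blast
  have sm: "smooth_on (U \<inter> N) \<phi>" "smooth_on (V \<inter> S) \<psi>"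
    using assms by (auto intro: Cinf_on_imp_smooth_on)
  have TS: "tangent_space (V \<inter> S) (\<phi> x) = S"
  proof -
    have "tangent_space S (\<phi> x) = S"
    proof
      show "tangent_space S (\<phi> x) \<subseteq> S"
      proof
        fix u assume "u \<in> tangent_space S (\<phi> x)"
        then obtain c e where c: "0 < e" "\<forall>t\<in>{-e<..<e}. c t \<in> S" "c (0::real) = \<phi> x"
          "(c has_vector_derivative u) (at 0)" by (rule tangent_spaceE)
        have "((\<lambda>t. (c (0 + t) - c 0) /\<^sub>R t) \<longlongrightarrow> u) (at 0)"
        proof -
          have "((\<lambda>y. ((c y - c 0) - (y - 0) *\<^sub>R u) /\<^sub>R norm (y - 0)) \<longlongrightarrow> 0) (at 0)"
            using c(4) by (simp add: has_vector_derivative_def has_derivative_def)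
          then have "((\<lambda>y. (c y - c 0) /\<^sub>R y - u) \<longlongrightarrow> 0) (at 0)"
          proof (rule Lim_null_comparison[rotated, OF tendsto_norm_zero])
            show "\<forall>\<^sub>F y in at (0::real). norm ((c y - c 0) /\<^sub>R y - u)
               \<le> norm (((c y - c 0) - (y - 0) *\<^sub>R u) /\<^sub>R norm (y - 0))"
            proof (rule eventually_at_filter[THEN iffD2], rule always_eventually, intro allI impI)
              fix y :: real assume "y \<noteq> 0"
              then have "(c y - c 0) /\<^sub>R y - u = ((c y - c 0) - (y - 0) *\<^sub>R u) /\<^sub>R y"
                by (simp add: scaleR_diff_right)
              then show "norm ((c y - c 0) /\<^sub>R y - u) \<le> norm (((c y - c 0) - (y - 0) *\<^sub>R u) /\<^sub>R norm (y - 0))"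
                by (simp only: norm_scaleR) simp
            qed
          qed
          then show ?thesis by (simp add: LIM_zero_iff)
        qed
        moreover have "\<forall>\<^sub>F t in at 0. (c (0 + t) - c 0) /\<^sub>R t \<in> S"
        proof -
          have "\<forall>\<^sub>F t in at (0::real). t \<in> {-e<..<e}"
            using c(1) by (intro eventually_at_in_open') auto
          then show ?thesis
          proof eventually_elim
            case (elim t)
            then show ?case using bspec[OF c(2), of t] bspec[OF c(2), of 0] c(1) assms(7)
              by (simp add: subspace_diff subspace_scale)
          qed
        qed
        ultimately show "u \<in> S"
          by (intro Lim_in_closed_set[OF closed_subspace[OF assms(7)], of "\<lambda>t. (c (0 + t) - c 0) /\<^sub>R t" "at 0"]) simp_all
      qed
      show "S \<subseteq> tangent_space S (\<phi> x)"
      proof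
        fix u assume "u \<in> S"
        then show "u \<in> tangent_space S (\<phi> x)"
          using px assms(7)
          by (intro tangent_spaceI[of 1 "\<lambda>t. \<phi> x + t *\<^sub>R u"])
           (auto intro!: Cinf_on_add Cinf_on_const derivative_eq_intros
              Cinf_on_bounded_linear[where L="\<lambda>t. t *\<^sub>R u"] bounded_linear_scaleR_left
              simp: subspace_add subspace_scale)
      qed
    qed
    then show ?thesis using tangent_space_localize[OF assms(3), of "\<phi> x" S] px by simp
  qed
  have d\<psi>: "dirD (V \<inter> S) \<psi> (\<phi> x) s = bderiv \<psi> (\<phi> x) s" if "s \<in> S" for s
    using px TS that by (intro dirD_ext[OF assms(3) _ assms(6)]) auto
  have "tangent_space N x = tangent_space (U \<inter> N) x" using tangent_space_localize[OF assms(1,2)] by simp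
  also have "\<dots> = bderiv \<psi> (\<phi> x) ` S"
  proof
    show "tangent_space (U \<inter> N) x \<subseteq> bderiv \<psi> (\<phi> x) ` S"
    proof
      fix u assume u: "u \<in> tangent_space (U \<inter> N) x"
      have "dirD (U \<inter> N) \<phi> x u \<in> S"
        using tangent_space_image[OF sm(1) _ u, of "V \<inter> S"] assms(8) TS by blast
      moreover have "dirD (U \<inter> N) (\<lambda>y. \<psi> (\<phi> y)) x u = dirD (V \<inter> S) \<psi> (\<phi> x) (dirD (U \<inter> N) \<phi> x u)"
        using assms(8) by (intro dirD_compose[OF sm(1) sm(2) _ u]) auto
      moreover have "dirD (U \<inter> N) (\<lambda>y. \<psi> (\<phi> y)) x u = u"
        using inv(1) assms(2,9) dirD_cong[of "U \<inter> N" "\<lambda>y. \<psi> (\<phi> y)" "\<lambda>y. y" x] dirD_eqI[OF has_derivative_ident u]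
        by auto
      ultimately show "u \<in> bderiv \<psi> (\<phi> x) ` S" using d\<psi> by (metis image_eqI)
    qed
    show "bderiv \<psi> (\<phi> x) ` S \<subseteq> tangent_space (U \<inter> N) x"
    proof
      fix u assume "u \<in> bderiv \<psi> (\<phi> x) ` S"
      then obtain s where s: "s \<in> S" "u = bderiv \<psi> (\<phi> x) s" by blast
      have "dirD (V \<inter> S) \<psi> (\<phi> x) s \<in> tangent_space (U \<inter> N) (\<psi> (\<phi> x))"
        using s(1) TS \<psi>S inv(4) by (intro tangent_space_image[OF sm(2)]) auto
      then show "u \<in> tangent_space (U \<inter> N) x" using s d\<psi> inv(1) assms(2) by simp
    qed
  qed
  finally show ?thesis .
qed

lemma embedded_submanifold_chartE:
  fixes N :: "'a::euclidean_space set"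
  assumes "embedded_submanifold N" "x \<in> N"
  obtains U V and \<phi> \<psi> :: "'a \<Rightarrow> 'a" and S where "open U" "x \<in> U" "open V" "homeomorphism U V \<phi> \<psi>" "Cinf_on U \<phi>" "Cinf_on V \<psi>"
    "subspace S" "\<phi> ` (U \<inter> N) = V \<inter> S"
  using assms(1) unfolding embedded_submanifold_def
proof (elim exE)
  fix k
  assume *: "\<forall>x\<in>N. \<exists>U V (\<phi> :: 'a \<Rightarrow> 'a) \<psi> S.
        open U \<and> x \<in> U \<and> open V \<and> homeomorphism U V \<phi> \<psi> \<and> Cinf_on U \<phi> \<and> Cinf_on V \<psi> \<and>
        subspace S \<and> dim S = k \<and> \<phi> ` (U \<inter> N) = V \<inter> S"
  show thesis using bspec[OF * assms(2)] by (elim exE conjE) (rule that)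
qed

lemma subspace_tangent_space:
  fixes N :: "'a::euclidean_space set"
  assumes "embedded_submanifold N" "x \<in> N"
  shows "subspace (tangent_space N x)"
proof -
  obtain U V and \<phi> \<psi> :: "'a \<Rightarrow> 'a" and S where *: "open U" "x \<in> U" "open V" "homeomorphism U V \<phi> \<psi>" "Cinf_on U \<phi>" "Cinf_on V \<psi>"
    "subspace S" "\<phi> ` (U \<inter> N) = V \<inter> S"
    using embedded_submanifold_chartE[OF assms] .
  show ?thesis unfolding tangent_space_eq_chart[OF * assms(2)]
    by (intro linear_subspace_image *(7) bounded_linear.linear blinfun.bounded_linear_right)
qed

section \<open>Orthogonal projections for positive definite operators\<close>

definition pos_def_op :: "('a::euclidean_space \<Rightarrow>\<^sub>L 'a) \<Rightarrow> bool" where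
  "pos_def_op G \<longleftrightarrow> (\<forall>u w. u \<bullet> G w = G u \<bullet> w) \<and> (\<forall>u. u \<noteq> 0 \<longrightarrow> 0 < u \<bullet> G u)"

lemma pos_def_op_sym: "pos_def_op G \<Longrightarrow> u \<bullet> G w = w \<bullet> G u"
  unfolding pos_def_op_def by (metis inner_commute)

lemma pos_def_op_zero: "pos_def_op G \<Longrightarrow> u \<bullet> G u = 0 \<Longrightarrow> u = 0"
  unfolding pos_def_op_def by (metis less_irrefl)

lemma is_oproj_unique:
  assumes "pos_def_op G" "subspace W" "is_oproj G W P" "is_oproj G W Q"
  shows "P = Q"
proof (rule blinfun_eqI)
  fix z
  let ?d = "P z - Q z"
  have W: "?d \<in> W" using assms by (simp add: is_oproj_def subspace_diff)
  have "(z - Q z) \<bullet> G ?d - (z - P z) \<bullet> G ?d = 0"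
    using assms(3,4) W unfolding is_oproj_def by simp
  then have "?d \<bullet> G ?d = 0" by (simp add: inner_diff_left)
  then show "P z = Q z" using pos_def_op_zero[OF assms(1), of ?d] by simp
qed

text \<open>With the Euclidean projection \<open>E\<close> to \<open>W\<close>, the operator \<open>K = E G E + (1 - E)\<close> is injective because \<open>G\<close>
  is positive definite. The projection for \<open>G\<close> is then the inverse of \<open>K\<close> after \<open>E G\<close>.\<close>

lemma is_oproj_exists:
  fixes G :: "'a::euclidean_space \<Rightarrow>\<^sub>L 'a"
  assumes "pos_def_op G" "subspace W"
  shows "\<exists>P. is_oproj G W P"
proof -
  obtain b where b: "b \<subseteq> W" "pairwise orthogonal b" "\<And>x. x \<in> b \<Longrightarrow> norm x = 1" "independent b" "span b = W"
    using orthonormal_basis_subspace[OF assms(2)] by metis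
  have fb: "finite b" using independent_imp_finite[OF b(4)] .
  \<comment> \<open>the Euclidean orthogonal projection to \<open>W\<close>\<close>
  define E where "E = (\<lambda>z. \<Sum>i\<in>b. (z \<bullet> i) *\<^sub>R i)"
  have linE: "linear E" unfolding E_def
    by (intro linear_compose_sum ballI) (simp add: linear_iff inner_add_left scaleR_add_left)
  have EW: "E z \<in> W" for z
    unfolding E_def using b(1) assms(2) by (intro subspace_sum) (auto intro: subspace_scale)
  have Eb: "(z - E z) \<bullet> j = 0" if "j \<in> b" for z j
  proof -
    have "E z \<bullet> j = (\<Sum>i\<in>b. if i = j then z \<bullet> j else 0)"
      unfolding E_def inner_sum_left
    proof (rule sum.cong[OF refl])
      fix i assume "i \<in> b"
      then show "((z \<bullet> i) *\<^sub>R i) \<bullet> j = (if i = j then z \<bullet> j else 0)"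
        using b(2) b(3)[of j] that by (auto simp: pairwise_def orthogonal_def dot_square_norm)
    qed
    also have "\<dots> = z \<bullet> j" using fb that by (simp add: sum.delta')
    finally show ?thesis by (simp add: inner_diff_left)
  qed
  have Eorth: "(z - E z) \<bullet> w = 0" if "w \<in> W" for z w
  proof -
    have "orthogonal (z - E z) w"
      using that b(5) Eb by (intro orthogonal_to_span[of w b]) (auto simp: orthogonal_def)
    then show ?thesis by (simp add: orthogonal_def)
  qed
  have Efix: "E w = w" if "w \<in> W" for w
    using Eorth[of "w - E w" w] EW[of w] that assms(2) by (simp add: subspace_diff)
  define K where "K = (\<lambda>y. E (G (E y)) + (y - E y))"
  have linK: "linear K" unfolding K_def
    using linE by (intro linear_compose_add linear_compose_sub linear_ident linear_compose[OF _ linE, unfolded o_def]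
      bounded_linear.linear[OF blinfun.bounded_linear_right] linear_compose[OF linE, unfolded o_def])
  have Kdec: "E y = y \<and> E (G y) = w" if "K y = w" "w \<in> W" for y w
  proof -
    have "y - E y = w - E (G (E y))" using that(1) unfolding K_def by (simp add: algebra_simps)
    then have "y - E y \<in> W" using that(2) EW assms(2) by (simp add: subspace_diff)
    then have "(y - E y) \<bullet> (y - E y) = 0" by (rule Eorth)
    then have "E y = y" by simp
    then show ?thesis using that(1) unfolding K_def by simp
  qed
  have "inj K"
  proof (rule linear_injective_0[OF linK, THEN iffD2], intro allI impI)
    fix y assume "K y = 0"
    then have y: "E y = y" "E (G y) = 0" using Kdec[of y 0] assms(2) by (auto simp: subspace_0)
    have "(G y - E (G y)) \<bullet> y = 0" using Eorth[of y] EW[of y] y(1) by simp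
    then show "y = 0" using y(2) pos_def_op_zero[OF assms(1)] by (simp add: inner_commute)
  qed
  then obtain L where L: "linear L" "\<forall>x. L (K x) = x" "\<forall>x. K (L x) = x"
    using linear_injective_isomorphism[OF linK] by blast
  define P where "P = (\<lambda>z. L (E (G z)))"
  have linP: "linear P" unfolding P_def
    by (intro linear_compose[OF _ L(1), unfolded o_def] linear_compose[OF _ linE, unfolded o_def]
      bounded_linear.linear[OF blinfun.bounded_linear_right])
  then have Papp: "blinfun_apply (Blinfun P) = P"
    by (simp add: bounded_linear_Blinfun_apply linear_conv_bounded_linear)
  have P: "E (P z) = P z" "E (G (P z)) = E (G z)" for z
    using Kdec[of "P z" "E (G z)"] L(3) EW unfolding P_def by auto
  have "(z - P z) \<bullet> G w = 0" if "w \<in> W" for z w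
  proof -
    have "(z - P z) \<bullet> G w = G (z - P z) \<bullet> w" using assms(1) unfolding pos_def_op_def by blast
    also have "\<dots> = E (G (z - P z)) \<bullet> w" using Eorth[OF that, of "G (z - P z)"] by (simp add: inner_diff_left)
    also have "E (G (z - P z)) = 0" using P(2)[of z] linE by (simp add: blinfun.diff_right linear_diff)
    finally show ?thesis by simp
  qed
  then have "is_oproj G W (Blinfun P)" unfolding is_oproj_def Papp using P(1) EW by metis
  then show ?thesis by blast
qed

lemma is_oproj_oproj:
  assumes "pos_def_op G" "subspace W"
  shows "is_oproj G W (oproj G W)"
  unfolding oproj_def
  using is_oproj_exists[OF assms] is_oproj_unique[OF assms] by (metis theI)

lemma oproj_eqI: "pos_def_op G \<Longrightarrow> subspace W \<Longrightarrow> is_oproj G W P \<Longrightarrow> oproj G W = P"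
  using is_oproj_unique is_oproj_oproj by metis

lemma oproj_mem: "pos_def_op G \<Longrightarrow> subspace W \<Longrightarrow> oproj G W z \<in> W"
  using is_oproj_oproj unfolding is_oproj_def by metis

lemma oproj_orth: "pos_def_op G \<Longrightarrow> subspace W \<Longrightarrow> w \<in> W \<Longrightarrow> (z - oproj G W z) \<bullet> G w = 0"
  using is_oproj_oproj unfolding is_oproj_def by metis

lemma oproj_zero:
  assumes "pos_def_op G" "subspace W" "\<And>w. w \<in> W \<Longrightarrow> z \<bullet> G w = 0"
  shows "oproj G W z = 0"
proof -
  let ?p = "oproj G W z"
  have p: "?p \<in> W" by (rule oproj_mem[OF assms(1,2)])
  have "?p \<bullet> G ?p = 0" using oproj_orth[OF assms(1,2) p, of z] assms(3)[OF p] by (simp add: inner_diff_left)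
  then show ?thesis by (rule pos_def_op_zero[OF assms(1)])
qed

lemma oproj_fix:
  assumes "pos_def_op G" "subspace W" "w \<in> W"
  shows "oproj G W w = w"
proof -
  have "w - oproj G W w \<in> W" using assms oproj_mem subspace_diff by metis
  from oproj_orth[OF assms(1,2) this, of w] show ?thesis
    using pos_def_op_zero[OF assms(1), of "w - oproj G W w"] by simp
qed

lemma oproj_selfadjoint:
  assumes "pos_def_op G" "subspace W"
  shows "u \<bullet> G (oproj G W w) = oproj G W u \<bullet> G w"
proof -
  have "(u - oproj G W u) \<bullet> G (oproj G W w) = 0" "(w - oproj G W w) \<bullet> G (oproj G W u) = 0"
    by (intro oproj_orth oproj_mem assms)+
  then show ?thesis
    using pos_def_op_sym[OF assms(1), of "oproj G W u" "oproj G W w"] pos_def_op_sym[OF assms(1), of w "oproj G W u"]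
    by (simp add: inner_diff_left)
qed

section \<open>Charts and coordinate changes\<close>

text \<open>The conditions on the charts alone. They imply what is needed about the topology
  to verify the Hausdorff property and second countability of the tangent bundle afterwards.\<close>

locale atlas =
  fixes X :: "('p, 'e::euclidean_space) manifold"
  assumes chart_domains: "\<And>p. p \<in> points X \<Longrightarrow> p \<in> chart_dom X p \<and> chart_dom X p \<subseteq> points X \<and>
        inj_on (chart X p) (chart_dom X p) \<and> open (chart X p ` chart_dom X p)"
    and chart_transitions: "\<And>p r. p \<in> points X \<Longrightarrow> r \<in> points X \<Longrightarrow>
        open (chart X p ` (chart_dom X p \<inter> chart_dom X r)) \<and>
        Cinf_on (chart X p ` (chart_dom X p \<inter> chart_dom X r)) (chart X r \<circ> chart_inv X p)"

lemma smooth_manifold_iff: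
  "smooth_manifold X \<longleftrightarrow> atlas X \<and> Hausdorff_space (mfd_topology X) \<and> second_countable (mfd_topology X)"
  unfolding smooth_manifold_def atlas_def by blast

context atlas begin

abbreviation "pts \<equiv> points X"
abbreviation "cdom \<equiv> chart_dom X"
abbreviation "cimg p \<equiv> chart X p ` chart_dom X p"
abbreviation "cc \<equiv> coord_change X"
abbreviation "tau p r \<equiv> chart X r \<circ> chart_inv X p"
abbreviation "ovl p r \<equiv> chart X p ` (chart_dom X p \<inter> chart_dom X r)"

lemma center: "p \<in> pts \<Longrightarrow> p \<in> cdom p"
  and dom_subset: "p \<in> pts \<Longrightarrow> cdom p \<subseteq> pts"
  and chart_inj: "p \<in> pts \<Longrightarrow> inj_on (chart X p) (cdom p)"
  and open_cimg: "p \<in> pts \<Longrightarrow> open (cimg p)"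
  using chart_domains by blast+

lemma dom_pts: "p \<in> pts \<Longrightarrow> s \<in> cdom p \<Longrightarrow> s \<in> pts"
  using dom_subset by blast

lemma chart_inv_chart: "p \<in> pts \<Longrightarrow> s \<in> cdom p \<Longrightarrow> chart_inv X p (chart X p s) = s"
  unfolding chart_inv_def by (rule inv_into_f_f[OF chart_inj])

lemma chart_chart_inv: "y \<in> cimg p \<Longrightarrow> chart X p (chart_inv X p y) = y"
  unfolding chart_inv_def by (rule f_inv_into_f)

lemma chart_inv_dom: "y \<in> cimg p \<Longrightarrow> chart_inv X p y \<in> cdom p"
  unfolding chart_inv_def by (rule inv_into_into)

lemma open_ovl: "p \<in> pts \<Longrightarrow> r \<in> pts \<Longrightarrow> open (ovl p r)"
  and Cinf_tau: "p \<in> pts \<Longrightarrow> r \<in> pts \<Longrightarrow> Cinf_on (ovl p r) (tau p r)"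
  using chart_transitions by blast+

lemma ovl_iff: "p \<in> pts \<Longrightarrow> y \<in> ovl p r \<longleftrightarrow> y \<in> cimg p \<and> chart_inv X p y \<in> cdom r"
proof
  assume p: "p \<in> pts" and "y \<in> ovl p r"
  then show "y \<in> cimg p \<and> chart_inv X p y \<in> cdom r" by (auto simp: chart_inv_chart)
next
  assume p: "p \<in> pts" and y: "y \<in> cimg p \<and> chart_inv X p y \<in> cdom r"
  then have "chart X p (chart_inv X p y) \<in> ovl p r" using chart_inv_dom by blast
  then show "y \<in> ovl p r" using y by (simp add: chart_chart_inv)
qed

lemma tau_has_derivative:
  assumes "p \<in> pts" "r \<in> pts" "s \<in> cdom p" "s \<in> cdom r"
  shows "(tau p r has_derivative cc p r s) (at (chart X p s))"
  unfolding coord_change_def using assms by (intro Cinf_on_has_derivative[OF Cinf_tau]) auto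

lemma linear_cc: "p \<in> pts \<Longrightarrow> r \<in> pts \<Longrightarrow> s \<in> cdom p \<Longrightarrow> s \<in> cdom r \<Longrightarrow> linear (cc p r s)"
  using has_derivative_linear[OF tau_has_derivative] .

lemma cc_same:
  assumes "p \<in> pts" "s \<in> cdom p"
  shows "cc p p s u = u"
proof -
  have "((\<lambda>y. y) has_derivative (\<lambda>u. u)) (at (chart X p s))" by (rule has_derivative_ident)
  then have "(tau p p has_derivative (\<lambda>u. u)) (at (chart X p s))"
  proof (rule has_derivative_transform_within_open)
    show "open (cimg p)" by (rule open_cimg[OF assms(1)])
    show "chart X p s \<in> cimg p" using assms(2) by blast
    show "y = tau p p y" if "y \<in> cimg p" for y using chart_chart_inv[OF that] by simp
  qed
  then show ?thesis unfolding coord_change_def by (metis frechet_derivative_at)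
qed

lemma cc_trans:
  assumes "p \<in> pts" "r \<in> pts" "t \<in> pts" "s \<in> cdom p" "s \<in> cdom r" "s \<in> cdom t"
  shows "cc r t s (cc p r s u) = cc p t s u"
proof -
  have d: "(tau r t has_derivative cc r t s) (at (tau p r (chart X p s)))"
    using tau_has_derivative[of r t s] assms by (simp add: chart_inv_chart)
  have "(tau r t \<circ> tau p r has_derivative cc r t s \<circ> cc p r s) (at (chart X p s))"
    by (rule diff_chain_at[OF tau_has_derivative d]) (use assms in auto)
  then have "(tau p t has_derivative cc r t s \<circ> cc p r s) (at (chart X p s))"
  proof (rule has_derivative_transform_within_open)
    show "open (ovl p r)" using assms open_ovl by blast
    show "chart X p s \<in> ovl p r" using assms by blast
    show "(tau r t \<circ> tau p r) y = tau p t y" if "y \<in> ovl p r" for y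
      using that assms by (auto simp: ovl_iff chart_inv_chart)
  qed
  then have "cc p t s = cc r t s \<circ> cc p r s"
    unfolding coord_change_def[of X p t] by (metis frechet_derivative_at)
  then show ?thesis by simp
qed

lemma cc_inverse:
  assumes "p \<in> pts" "r \<in> pts" "s \<in> cdom p" "s \<in> cdom r"
  shows "cc r p s (cc p r s u) = u"
  using cc_trans[of p r p s] cc_same assms by simp

lemma Cinf_on_cc:
  assumes "p \<in> pts" "r \<in> pts"
  shows "Cinf_on (ovl p r) (\<lambda>y. cc p r (chart_inv X p y) u)"
proof (rule Cinf_on_cong[OF open_ovl[OF assms]])
  show "Cinf_on (ovl p r) (\<lambda>y. frechet_derivative (tau p r) (at y) u)"
    by (rule Cinf_on_frechet_derivative[OF Cinf_tau[OF assms]])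
  show "frechet_derivative (tau p r) (at y) u = cc p r (chart_inv X p y) u" if "y \<in> ovl p r" for y
    using that assms chart_chart_inv unfolding coord_change_def by (auto simp: ovl_iff)
qed

subsection \<open>The topology\<close>

lemma istopology_mfd: "istopology (\<lambda>U. U \<subseteq> pts \<and> (\<forall>p\<in>pts. open (chart X p ` (U \<inter> cdom p))))"
proof (unfold istopology_def, intro conjI allI impI)
  fix U V assume U: "U \<subseteq> pts \<and> (\<forall>p\<in>pts. open (chart X p ` (U \<inter> cdom p)))"
    and V: "V \<subseteq> pts \<and> (\<forall>p\<in>pts. open (chart X p ` (V \<inter> cdom p)))"
  show "U \<inter> V \<subseteq> pts" using U by blast
  show "\<forall>p\<in>pts. open (chart X p ` ((U \<inter> V) \<inter> cdom p))"
  proof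
    fix p assume p: "p \<in> pts"
    have "chart X p ` ((U \<inter> V) \<inter> cdom p) = chart X p ` (U \<inter> cdom p) \<inter> chart X p ` (V \<inter> cdom p)"
      using inj_on_image_Int[OF chart_inj[OF p], of "U \<inter> cdom p" "V \<inter> cdom p"]
      by (simp add: Int_ac)
    then show "open (chart X p ` ((U \<inter> V) \<inter> cdom p))" using U V p by (simp add: open_Int)
  qed
next
  fix K assume K: "\<forall>U\<in>K. U \<subseteq> pts \<and> (\<forall>p\<in>pts. open (chart X p ` (U \<inter> cdom p)))"
  show "\<Union> K \<subseteq> pts" using K by blast
  show "\<forall>p\<in>pts. open (chart X p ` (\<Union> K \<inter> cdom p))"
  proof
    fix p assume p: "p \<in> pts"
    have "chart X p ` (\<Union> K \<inter> cdom p) = (\<Union>U\<in>K. chart X p ` (U \<inter> cdom p))" by blast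
    then show "open (chart X p ` (\<Union> K \<inter> cdom p))" using K p by auto
  qed
qed

lemma openin_mfd: "openin (mfd_topology X) U \<longleftrightarrow> U \<subseteq> pts \<and> (\<forall>p\<in>pts. open (chart X p ` (U \<inter> cdom p)))"
  unfolding mfd_topology_def topology_inverse'[OF istopology_mfd] ..

lemma openin_pts: "openin (mfd_topology X) pts"
  unfolding openin_mfd using dom_subset open_cimg by (auto simp: Int_absorb1)

lemma topspace_mfd: "topspace (mfd_topology X) = pts"
  using openin_topspace[of "mfd_topology X"] openin_subset[OF openin_pts] unfolding openin_mfd by blast

lemma openin_chart_preimage:
  assumes "p \<in> pts" "open W"
  shows "openin (mfd_topology X) {s \<in> cdom p. chart X p s \<in> W}"
  unfolding openin_mfd
proof (intro conjI ballI)
  show "{s \<in> cdom p. chart X p s \<in> W} \<subseteq> pts" using dom_subset[OF assms(1)] by blast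
  fix r assume r: "r \<in> pts"
  have "chart X r ` ({s \<in> cdom p. chart X p s \<in> W} \<inter> cdom r) = ovl r p \<inter> tau r p -` W"
    using r by (auto simp: chart_inv_chart)
  also have "open \<dots>"
    using continuous_open_preimage[OF Cinf_on_continuous_on[OF Cinf_tau[OF r assms(1)]] open_ovl[OF r assms(1)] assms(2)] .
  finally show "open (chart X r ` ({s \<in> cdom p. chart X p s \<in> W} \<inter> cdom r))" .
qed

lemma openin_dom: "p \<in> pts \<Longrightarrow> openin (mfd_topology X) (cdom p)"
  using openin_chart_preimage[of p UNIV] by simp

lemma countable_charts:
  assumes "second_countable (mfd_topology X)"
  obtains P where "countable P" "P \<subseteq> pts" "pts \<subseteq> (\<Union>p\<in>P. cdom p)"
proof -
  obtain \<B> where \<B>: "countable \<B>" "\<forall>U x. openin (mfd_topology X) U \<and> x \<in> U \<longrightarrow> (\<exists>V \<in> \<B>. x \<in> V \<and> V \<subseteq> U)"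
    using assms unfolding second_countable_def by blast
  define f where "f V = (SOME p. p \<in> pts \<and> V \<subseteq> cdom p)" for V
  define P where "P = f ` {V \<in> \<B>. \<exists>p\<in>pts. V \<subseteq> cdom p}"
  have f: "f V \<in> pts \<and> V \<subseteq> cdom (f V)" if "\<exists>p\<in>pts. V \<subseteq> cdom p" for V
    unfolding f_def by (rule someI_ex) (use that in blast)
  show thesis
  proof (rule that[of P])
    show "countable P" unfolding P_def using \<B>(1) by auto
    show "P \<subseteq> pts" unfolding P_def using f by auto
    show "pts \<subseteq> (\<Union>p\<in>P. cdom p)"
    proof
      fix s assume s: "s \<in> pts"
      then obtain V where "V \<in> \<B>" "s \<in> V" "V \<subseteq> cdom s" using \<B>(2) openin_dom center by meson
      then show "s \<in> (\<Union>p\<in>P. cdom p)" unfolding P_def using f s by blast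
    qed
  qed
qed

text \<open>The preimages of a countable base of the model space under countably many charts that cover the
  manifold form a base.\<close>

lemma second_countable_mfd:
  assumes "countable P" "P \<subseteq> pts" "pts \<subseteq> (\<Union>p\<in>P. cdom p)"
  shows "second_countable (mfd_topology X)"
proof -
  obtain \<C> :: "'e set set" where \<C>: "countable \<C>" "\<And>V. V \<in> \<C> \<Longrightarrow> open V" "\<And>S. open S \<Longrightarrow> \<exists>U\<subseteq>\<C>. S = \<Union> U"
    by (metis univ_second_countable)
  let ?D = "\<lambda>p V. {s \<in> cdom p. chart X p s \<in> V}"
  let ?B = "(\<lambda>(p, V). ?D p V) ` (P \<times> \<C>)"
  show ?thesis unfolding second_countable_def
  proof (intro exI[of _ ?B] conjI ballI allI impI)
    show "countable ?B" using assms(1) \<C>(1) by auto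
    show "openin (mfd_topology X) V" if "V \<in> ?B" for V
      using that assms(2) \<C>(2) openin_chart_preimage by auto
    fix U s assume U: "openin (mfd_topology X) U \<and> s \<in> U"
    then have "s \<in> pts" using openin_mfd by blast
    then obtain p where p: "p \<in> P" "s \<in> cdom p" using assms(3) by blast
    have op: "open (chart X p ` (U \<inter> cdom p))" using U p assms(2) unfolding openin_mfd by blast
    obtain V where V: "V \<in> \<C>" "chart X p s \<in> V" "V \<subseteq> chart X p ` (U \<inter> cdom p)"
    proof -
      obtain W where "W \<subseteq> \<C>" "chart X p ` (U \<inter> cdom p) = \<Union> W" using \<C>(3)[OF op] by blast
      moreover have "chart X p s \<in> chart X p ` (U \<inter> cdom p)" using U p by blast
      ultimately show thesis using that by blast
    qed
    have "?D p V \<subseteq> U"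
    proof
      fix z assume z: "z \<in> ?D p V"
      then obtain z' where "z' \<in> U \<inter> cdom p" "chart X p z = chart X p z'" using V(3) by blast
      then show "z \<in> U" using chart_inj[of p] z p(1) assms(2) by (metis (no_types, lifting) IntD1 IntD2 inj_onD mem_Collect_eq subsetD)
    qed
    then show "\<exists>V\<in>?B. s \<in> V \<and> V \<subseteq> U" using p V by blast
  qed
qed

end

section \<open>The tangent bundle\<close>

context atlas begin

abbreviation "TB \<equiv> tangent_bundle X"

lemma TB_points [simp]: "points TB = pts \<times> UNIV"
  and TB_dom [simp]: "chart_dom TB p = cdom (fst p) \<times> UNIV"
  and TB_chart: "chart TB p z = (chart X (fst p) (fst z), cc (fst z) (fst p) (fst z) (snd z))"
  by (simp_all add: tangent_bundle_def case_prod_beta)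

lemma TB_img: 
  assumes "p \<in> pts" "U \<subseteq> cdom p"
  shows "chart TB (p, w) ` (U \<times> UNIV) = chart X p ` U \<times> UNIV"
proof
  show "chart TB (p, w) ` (U \<times> UNIV) \<subseteq> chart X p ` U \<times> UNIV" by (auto simp: TB_chart)
  show "chart X p ` U \<times> UNIV \<subseteq> chart TB (p, w) ` (U \<times> UNIV)"
  proof clarify
    fix s u assume s: "s \<in> U"
    then have "s \<in> cdom p" "s \<in> pts" using assms dom_pts by blast+
    then have "chart TB (p, w) (s, cc p s s u) = (chart X p s, u)"
      using cc_inverse[of p s s u] center assms by (simp add: TB_chart)
    then show "(chart X p s, u) \<in> chart TB (p, w) ` (U \<times> UNIV)" using s by (metis SigmaI UNIV_I imageI)
  qed
qed

lemma TB_inj: "p \<in> pts \<Longrightarrow> inj_on (chart TB (p, w)) (cdom p \<times> UNIV)"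
proof (rule inj_onI, clarify)
  fix s u s' u' assume p: "p \<in> pts" and s: "s \<in> cdom p" "s' \<in> cdom p"
    and eq: "chart TB (p, w) (s, u) = chart TB (p, w) (s', u')"
  have ss: "s = s'" using eq s chart_inj[OF p] by (auto simp: TB_chart dest: inj_onD)
  then have "cc s p s u = cc s p s u'" using eq by (simp add: TB_chart)
  then have "u = u'" using cc_inverse[of s p s] s p center dom_pts by metis
  then show "s = s' \<and> u = u'" using ss by simp
qed

lemma TB_chart_inv:
  assumes "p \<in> pts" "y \<in> cimg p"
  shows "chart_inv TB (p, w) (y, u) = (chart_inv X p y, cc p (chart_inv X p y) (chart_inv X p y) u)"
proof -
  let ?s = "chart_inv X p y"
  have s: "?s \<in> cdom p" "?s \<in> pts" using assms chart_inv_dom dom_pts by auto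
  have "chart TB (p, w) (?s, cc p ?s ?s u) = (y, u)"
    using cc_inverse[of p ?s ?s u] s center assms by (simp add: TB_chart chart_chart_inv)
  then show ?thesis unfolding chart_inv_def[of TB]
    using inv_into_f_f[OF TB_inj[OF assms(1), of w], of "(?s, cc p ?s ?s u)"] s by simp
qed

text \<open>The transition maps of the tangent bundle are the tangent maps of those of the base.\<close>

lemma TB_tau:
  assumes "p \<in> pts" "r \<in> pts" "y \<in> ovl p r"
  shows "(chart TB (r, w') \<circ> chart_inv TB (p, w)) (y, u) = (tau p r y, cc p r (chart_inv X p y) u)"
proof -
  let ?s = "chart_inv X p y"
  have s: "y \<in> cimg p" "?s \<in> cdom p" "?s \<in> pts" "?s \<in> cdom r"
    using assms chart_inv_dom dom_pts by (auto simp: ovl_iff)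
  then show ?thesis using assms center[of ?s] cc_trans[of p ?s r ?s u] by (simp add: TB_chart_inv TB_chart)
qed

lemma Cinf_on_cc2:
  assumes "p \<in> pts" "r \<in> pts"
  shows "Cinf_on (ovl p r \<times> UNIV) (\<lambda>z. cc p r (chart_inv X p (fst z)) (snd z))"
proof -
  have o: "open (ovl p r \<times> (UNIV::'e set))" using open_Times[OF open_ovl[OF assms] open_UNIV] .
  show ?thesis
  proof (rule Cinf_on_cong[OF o])
    have "Cinf_on (ovl p r \<times> UNIV) (\<lambda>z::'e\<times>'e. cc p r (chart_inv X p (fst z)) i)" for i
      by (rule Cinf_on_compose[OF o open_ovl[OF assms] _ Cinf_on_fst Cinf_on_cc[OF assms]]) auto
    then show "Cinf_on (ovl p r \<times> UNIV) (\<lambda>z. \<Sum>i\<in>Basis. (snd z \<bullet> i) *\<^sub>R cc p r (chart_inv X p (fst z)) i)"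
      by (intro Cinf_on_sum[OF o] Cinf_on_bilinear[OF o bounded_bilinear_scaleR]
        Cinf_on_linear[OF o bounded_linear_inner_left] Cinf_on_snd)
    show "(\<Sum>i\<in>Basis. (snd z \<bullet> i) *\<^sub>R cc p r (chart_inv X p (fst z)) i) = cc p r (chart_inv X p (fst z)) (snd z)"
      if "z \<in> ovl p r \<times> UNIV" for z
      using that assms chart_inv_dom
      by (intro linear_basis_expansion[symmetric] linear_cc) (auto simp: ovl_iff mem_Times_iff)
  qed
qed

lemma atlas_TB: "atlas TB"
proof
  fix p assume "p \<in> points TB"
  then show "p \<in> chart_dom TB p \<and> chart_dom TB p \<subseteq> points TB \<and>
        inj_on (chart TB p) (chart_dom TB p) \<and> open (chart TB p ` chart_dom TB p)"
    using TB_inj[of "fst p" "snd p"] TB_img[of "fst p" "cdom (fst p)" "snd p"] dom_subset[of "fst p"] center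
    by (auto simp: mem_Times_iff intro!: open_Times open_cimg)
next
  fix p r assume pr: "p \<in> points TB" "r \<in> points TB"
  then have fp: "fst p \<in> pts" "fst r \<in> pts" by auto
  have im: "chart TB p ` (chart_dom TB p \<inter> chart_dom TB r) = ovl (fst p) (fst r) \<times> UNIV"
    using TB_img[OF fp(1), of "cdom (fst p) \<inter> cdom (fst r)" "snd p"] by (simp add: Sigma_Int_distrib1)
  have o: "open (ovl (fst p) (fst r) \<times> (UNIV::'e set))" using open_Times[OF open_ovl[OF fp] open_UNIV] .
  have "Cinf_on (ovl (fst p) (fst r) \<times> UNIV) (chart TB r \<circ> chart_inv TB p)"
  proof (rule Cinf_on_cong[OF o])
    show "Cinf_on (ovl (fst p) (fst r) \<times> UNIV)
      (\<lambda>z. (tau (fst p) (fst r) (fst z), cc (fst p) (fst r) (chart_inv X (fst p) (fst z)) (snd z)))"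
      by (intro Cinf_on_Pair[OF o] Cinf_on_cc2[OF fp] Cinf_on_compose[OF o open_ovl[OF fp] _ Cinf_on_fst Cinf_tau[OF fp]]) auto
    show "(tau (fst p) (fst r) (fst z), cc (fst p) (fst r) (chart_inv X (fst p) (fst z)) (snd z))
      = (chart TB r \<circ> chart_inv TB p) z" if "z \<in> ovl (fst p) (fst r) \<times> UNIV" for z
      using TB_tau[OF fp, of "fst z" "snd r" "snd p" "snd z"] that by (auto simp: mem_Times_iff)
  qed
  then show "open (chart TB p ` (chart_dom TB p \<inter> chart_dom TB r)) \<and>
        Cinf_on (chart TB p ` (chart_dom TB p \<inter> chart_dom TB r)) (chart TB r \<circ> chart_inv TB p)"
    unfolding im using o by blast
qed

text \<open>Points over distinct base points are separated by preimages of open sets of the base. Points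
  over the same base point lie in a common chart, where their vector components are separated.\<close>

lemma smooth_manifold_TB:
  assumes "Hausdorff_space (mfd_topology X)" "second_countable (mfd_topology X)"
  shows "smooth_manifold TB"
proof -
  interpret T: atlas TB by (rule atlas_TB)
  have oi: "openin (mfd_topology TB) (U \<times> UNIV)" if U: "openin (mfd_topology X) U" for U
    unfolding T.openin_mfd
  proof (intro conjI ballI)
    show "U \<times> UNIV \<subseteq> points TB" using U by (auto simp: openin_mfd)
    fix p assume "p \<in> points TB"
    then have p: "fst p \<in> pts" by auto
    have "chart TB p ` (U \<times> UNIV \<inter> chart_dom TB p) = chart X (fst p) ` (U \<inter> cdom (fst p)) \<times> UNIV"
      using TB_img[OF p, of "U \<inter> cdom (fst p)" "snd p"] by (simp add: Sigma_Int_distrib1)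
    then show "open (chart TB p ` (U \<times> UNIV \<inter> chart_dom TB p))"
      using U p by (simp add: openin_mfd open_Times)
  qed
  have "Hausdorff_space (mfd_topology TB)"
    unfolding Hausdorff_space_def
  proof (intro allI impI, elim conjE)
    fix z z' assume z: "z \<in> topspace (mfd_topology TB)" "z' \<in> topspace (mfd_topology TB)" "z \<noteq> z'"
    then have pz: "fst z \<in> pts" "fst z' \<in> pts" unfolding T.topspace_mfd by auto
    show "\<exists>U V. openin (mfd_topology TB) U \<and> openin (mfd_topology TB) V \<and> z \<in> U \<and> z' \<in> V \<and> disjnt U V"
    proof (cases "fst z = fst z'")
      case False
      then obtain U V where UV: "openin (mfd_topology X) U" "openin (mfd_topology X) V" "fst z \<in> U" "fst z' \<in> V" "disjnt U V"
        using assms(1) pz unfolding Hausdorff_space_def topspace_mfd by blast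
      then show ?thesis
        using oi by (intro exI[of _ "U \<times> UNIV"] exI[of _ "V \<times> UNIV"]) (auto simp: disjnt_def mem_Times_iff)
    next
      case True
      then have "snd z \<noteq> snd z'" using z(3) by (simp add: prod_eq_iff)
      then obtain O1 O2 where O12: "open O1" "open O2" "snd z \<in> O1" "snd z' \<in> O2" "O1 \<inter> O2 = {}"
        using hausdorff[of "snd z" "snd z'"] by blast
      let ?U = "\<lambda>W. {s \<in> chart_dom TB z. chart TB z s \<in> UNIV \<times> W}"
      have c: "chart TB z z = (chart X (fst z) (fst z), snd z)" "chart TB z z' = (chart X (fst z) (fst z), snd z')"
        using True pz center cc_same by (simp_all add: TB_chart)
      show ?thesis
      proof (intro exI conjI)
        show "openin (mfd_topology TB) (?U O1)" "openin (mfd_topology TB) (?U O2)"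
          using z O12 by (intro T.openin_chart_preimage open_Times; simp add: T.topspace_mfd)+
        show "z \<in> ?U O1" "z' \<in> ?U O2" using O12 c True pz center by (auto simp: mem_Times_iff)
        show "disjnt (?U O1) (?U O2)" using O12(5) by (auto simp: disjnt_def)
      qed
    qed
  qed
  moreover have "second_countable (mfd_topology TB)"
  proof -
    obtain P where P: "countable P" "P \<subseteq> pts" "pts \<subseteq> (\<Union>p\<in>P. cdom p)" using countable_charts[OF assms(2)] .
    show ?thesis
      by (rule T.second_countable_mfd[of "(\<lambda>p. (p, 0)) ` P"]) (use P in auto)
  qed
  ultimately show ?thesis unfolding smooth_manifold_iff using atlas_TB by blast
qed

lemma mfd_deriv_fst:
  assumes "p \<in> pts"
  shows "mfd_deriv TB X fst (p, w) \<Delta> = fst \<Delta>"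
proof -
  have "(fst has_derivative fst) (at (chart TB (p, w) (p, w)))"
    by (rule bounded_linear_imp_has_derivative[OF bounded_linear_fst])
  then have "(chart X p \<circ> fst \<circ> chart_inv TB (p, w) has_derivative fst) (at (chart TB (p, w) (p, w)))"
  proof (rule has_derivative_transform_within_open)
    show "open (cimg p \<times> (UNIV :: 'e set))" by (intro open_Times open_cimg assms open_UNIV)
    show "chart TB (p, w) (p, w) \<in> cimg p \<times> UNIV" using center[OF assms] by (simp add: TB_chart)
    show "fst y = (chart X p \<circ> fst \<circ> chart_inv TB (p, w)) y" if "y \<in> cimg p \<times> UNIV" for y
      using that assms TB_chart_inv[OF assms, of "fst y" w "snd y"] chart_chart_inv by auto
  qed
  then show ?thesis unfolding mfd_deriv_def by (metis fst_conv frechet_derivative_at)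
qed

lemma fst_cc_TB:
  assumes "p \<in> pts" "r \<in> pts" "s \<in> cdom p" "s \<in> cdom r"
  shows "fst (coord_change TB (p, w) (r, w') (s, u) \<Delta>) = cc p r s (fst \<Delta>)"
proof -
  interpret T: atlas TB by (rule atlas_TB)
  let ?z = "chart TB (p, w) (s, u)"
  have "((\<lambda>z. fst ((chart TB (r, w') \<circ> chart_inv TB (p, w)) z)) has_derivative
     (\<lambda>\<Delta>. fst (coord_change TB (p, w) (r, w') (s, u) \<Delta>))) (at ?z)"
    using T.tau_has_derivative[of "(p, w)" "(r, w')" "(s, u)"] assms
    by (intro has_derivative_fst) (simp add: o_def)
  moreover have "((\<lambda>z. fst ((chart TB (r, w') \<circ> chart_inv TB (p, w)) z)) has_derivative (\<lambda>\<Delta>. cc p r s (fst \<Delta>))) (at ?z)"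
  proof (rule has_derivative_transform_within_open)
    have "(tau p r has_derivative cc p r s) (at (fst ?z))"
      using tau_has_derivative assms by (simp add: TB_chart)
    then show "((\<lambda>z. tau p r (fst z)) has_derivative (\<lambda>\<Delta>. cc p r s (fst \<Delta>))) (at ?z)"
      by (rule has_derivative_compose[OF has_derivative_fst[OF has_derivative_ident], rotated, unfolded]) 
    show "open (ovl p r \<times> (UNIV :: 'e set))" by (intro open_Times open_ovl assms open_UNIV)
    show "?z \<in> ovl p r \<times> UNIV" using assms by (auto simp: TB_chart)
    show "tau p r (fst z) = fst ((chart TB (r, w') \<circ> chart_inv TB (p, w)) z)" if "z \<in> ovl p r \<times> UNIV" for z
      using TB_tau[OF assms(1,2), of "fst z" w' w "snd z"] that by auto
  qed
  ultimately show ?thesis using has_derivative_unique by (metis (mono_tags))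
qed

end

section \<open>The connection map in a chart\<close>

context atlas begin

text \<open>Tangent vectors at \<open>s\<close> are expressed in the chart indexed by \<open>s\<close>, so components with respect to
  the chart at \<open>b\<close> have to be transformed.\<close>

definition coord_field :: "'p \<Rightarrow> ('e \<Rightarrow> 'e) \<Rightarrow> 'p \<Rightarrow> 'e" where
  "coord_field b Y s = cc b s s (Y (chart X b s))"

lemma local_rep_coord_field:
  assumes "b \<in> pts" "r \<in> pts" "y \<in> ovl r b"
  shows "local_rep X r (coord_field b Y) y = cc b r (chart_inv X b (tau r b y)) (Y (tau r b y))"
proof -
  let ?s = "chart_inv X r y"
  have s: "?s \<in> cdom r" "?s \<in> cdom b" "?s \<in> pts"
    using assms chart_inv_dom dom_pts by (auto simp: ovl_iff)
  then show ?thesis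
    using assms cc_trans[of b ?s r ?s] center by (simp add: local_rep_def coord_field_def chart_inv_chart Let_def)
qed

lemma local_rep_coord_field_self:
  assumes "b \<in> pts" "y \<in> cimg b"
  shows "local_rep X b (coord_field b Y) y = Y y"
  using local_rep_coord_field[OF assms(1,1), of y Y] assms cc_same chart_inv_dom
  by (simp add: chart_chart_inv)

lemma tau_ovl: "p \<in> pts \<Longrightarrow> r \<in> pts \<Longrightarrow> tau p r ` ovl p r \<subseteq> ovl r p"
  by (auto simp: chart_inv_chart)

lemma vector_field_coord_field:
  assumes "b \<in> pts" "Cinf_on (cimg b) Y"
  shows "vector_field_on X (cdom b) (coord_field b Y)"
  unfolding vector_field_on_def
proof
  fix r assume r: "r \<in> pts"
  have eq: "chart X r ` (cdom b \<inter> cdom r) = ovl r b" by (simp add: Int_commute)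
  note o = open_ovl[OF r assms(1)]
  have tau: "Cinf_on (ovl r b) (tau r b)" by (rule Cinf_tau[OF r assms(1)])
  have sub: "ovl b r \<subseteq> cimg b" by auto
  have Y: "Cinf_on (ovl r b) (\<lambda>y. Y (tau r b y))"
    using tau_ovl[OF r assms(1)] sub by (intro Cinf_on_compose[OF o open_cimg[OF assms(1)] _ tau assms(2)]) blast
  have oo: "open (ovl b r \<times> (UNIV::'e set))" by (rule open_Times[OF open_ovl[OF assms(1) r] open_UNIV])
  have "Cinf_on (ovl r b) (\<lambda>y. (\<lambda>z. cc b r (chart_inv X b (fst z)) (snd z)) (tau r b y, Y (tau r b y)))"
    using tau_ovl[OF r assms(1)]
    by (intro Cinf_on_compose[OF o oo _ _ Cinf_on_cc2[OF assms(1) r]] Cinf_on_Pair[OF o tau Y]) blast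
  then show "Cinf_on (chart X r ` (cdom b \<inter> cdom r)) (local_rep X r (coord_field b Y))"
    unfolding eq by (rule Cinf_on_cong[OF o, rotated]) (simp add: local_rep_coord_field[OF assms(1) r])
qed

lemma smooth_fun_coord:
  assumes "b \<in> pts" "Cinf_on (cimg b) f"
  shows "smooth_fun_on X (cdom b) (\<lambda>s. f (chart X b s))"
  unfolding smooth_fun_on_def
proof
  fix r assume r: "r \<in> pts"
  have eq: "chart X r ` (cdom b \<inter> cdom r) = ovl r b" by (simp add: Int_commute)
  note o = open_ovl[OF r assms(1)]
  have sub: "ovl b r \<subseteq> cimg b" by auto
  have "Cinf_on (ovl r b) (\<lambda>y. f (tau r b y))"
    using tau_ovl[OF r assms(1)] sub
    by (intro Cinf_on_compose[OF o open_cimg[OF assms(1)] _ Cinf_tau[OF r assms(1)] assms(2)]) blast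
  then show "Cinf_on (chart X r ` (cdom b \<inter> cdom r)) ((\<lambda>s. f (chart X b s)) \<circ> chart_inv X r)"
    unfolding eq by (simp add: o_def)
qed

lemma mfd_deriv_coord_field:
  assumes "b \<in> pts" "(Y has_derivative Y') (at (chart X b b))"
  shows "mfd_deriv X TB (\<lambda>s. (s, coord_field b Y s)) b \<delta> = (\<delta>, Y' \<delta>)"
proof -
  have "((\<lambda>y. (y, Y y)) has_derivative (\<lambda>\<delta>. (\<delta>, Y' \<delta>))) (at (chart X b b))"
    by (intro has_derivative_Pair has_derivative_ident assms(2))
  then have "(chart TB (b, coord_field b Y b) \<circ> (\<lambda>s. (s, coord_field b Y s)) \<circ> chart_inv X b
     has_derivative (\<lambda>\<delta>. (\<delta>, Y' \<delta>))) (at (chart X b b))"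
  proof (rule has_derivative_transform_within_open)
    show "open (cimg b)" by (rule open_cimg[OF assms(1)])
    show "chart X b b \<in> cimg b" using center[OF assms(1)] by blast
    show "(y, Y y) = (chart TB (b, coord_field b Y b) \<circ> (\<lambda>s. (s, coord_field b Y s)) \<circ> chart_inv X b) y"
      if "y \<in> cimg b" for y
      using local_rep_coord_field_self[OF assms(1) that, of Y] chart_chart_inv[OF that]
      by (simp add: TB_chart local_rep_def Let_def)
  qed
  then show ?thesis unfolding mfd_deriv_def by (metis frechet_derivative_at)
qed

lemma coord_field_center: "b \<in> pts \<Longrightarrow> coord_field b Y b = Y (chart X b b)"
  using cc_same center by (simp add: coord_field_def)

end

locale riemannian_base = atlas X for X :: "('p, 'e::euclidean_space) manifold" +
  fixes \<gamma> :: "'p \<Rightarrow> 'e \<Rightarrow> 'e \<Rightarrow> real" and nab :: "('p \<Rightarrow> 'e) \<Rightarrow> 'p \<Rightarrow> 'e \<Rightarrow> 'e"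
    and C :: "'p \<times> 'e \<Rightarrow> 'e \<times> 'e \<Rightarrow> 'e"
  assumes riem: "riemannian_metric X \<gamma>" and lc: "levi_civita X \<gamma> nab" and cm: "connection_map X nab C"
begin

abbreviation "cf b w \<equiv> coord_field b (\<lambda>y. w)"

text \<open>The conditions on the connection for the domain of a chart, where coordinate fields exist.\<close>

lemma levi_civita_dom:
  assumes "b \<in> pts" "vector_field_on X (cdom b) Y" "vector_field_on X (cdom b) Z" "smooth_fun_on X (cdom b) f"
  shows "\<And>p. p \<in> cdom b \<Longrightarrow> linear (nab Y p)"
    "\<And>p \<delta>. p \<in> cdom b \<Longrightarrow> nab (\<lambda>s. Y s + Z s) p \<delta> = nab Y p \<delta> + nab Z p \<delta>"
    "\<And>p \<delta>. p \<in> cdom b \<Longrightarrow> nab (\<lambda>s. f s *\<^sub>R Y s) p \<delta> = fun_deriv X f p \<delta> *\<^sub>R Y p + f p *\<^sub>R nab Y p \<delta>"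
    "\<And>p. p \<in> cdom b \<Longrightarrow> nab Z p (Y p) - nab Y p (Z p) = lie_bracket X Y Z p"
    "\<And>p \<delta>. p \<in> cdom b \<Longrightarrow> fun_deriv X (\<lambda>s. \<gamma> s (Y s) (Z s)) p \<delta> =
                       \<gamma> p (nab Y p \<delta>) (Z p) + \<gamma> p (Y p) (nab Z p \<delta>)"
proof -
  note l = lc[unfolded levi_civita_def, rule_format, OF openin_dom[OF assms(1)] assms(2-4)]
  show "\<And>p. p \<in> cdom b \<Longrightarrow> linear (nab Y p)" using l by blast
  show "\<And>p \<delta>. p \<in> cdom b \<Longrightarrow> nab (\<lambda>s. Y s + Z s) p \<delta> = nab Y p \<delta> + nab Z p \<delta>" using l by blast
  show "\<And>p \<delta>. p \<in> cdom b \<Longrightarrow> nab (\<lambda>s. f s *\<^sub>R Y s) p \<delta> = fun_deriv X f p \<delta> *\<^sub>R Y p + f p *\<^sub>R nab Y p \<delta>" using l by blast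
  show "\<And>p. p \<in> cdom b \<Longrightarrow> nab Z p (Y p) - nab Y p (Z p) = lie_bracket X Y Z p" using l by blast
  show "\<And>p \<delta>. p \<in> cdom b \<Longrightarrow> fun_deriv X (\<lambda>s. \<gamma> s (Y s) (Z s)) p \<delta> =
                       \<gamma> p (nab Y p \<delta>) (Z p) + \<gamma> p (Y p) (nab Z p \<delta>)" using l by blast
qed

lemma vf_cf: "b \<in> pts \<Longrightarrow> vector_field_on X (cdom b) (cf b w)"
  by (rule vector_field_coord_field) auto

lemma sf_const: "b \<in> pts \<Longrightarrow> smooth_fun_on X (cdom b) (\<lambda>s. 0)"
  by (rule smooth_fun_coord) auto

lemma C_field:
  assumes "b \<in> pts" "vector_field_on X (cdom b) Z"
  shows "C (b, Z b) (mfd_deriv X TB (\<lambda>s. (s, Z s)) b \<delta>) = nab Z b \<delta>"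
  using cm openin_dom[OF assms(1)] assms center[OF assms(1)] unfolding connection_map_def by blast

lemma linear_C: "b \<in> pts \<Longrightarrow> linear (C (b, w))"
  using cm unfolding connection_map_def by simp

lemma C_horizontal:
  assumes "b \<in> pts"
  shows "C (b, w) (\<alpha>, 0) = nab (cf b w) b \<alpha>"
proof -
  have "mfd_deriv X TB (\<lambda>s. (s, cf b w s)) b \<alpha> = (\<alpha>, 0)"
    by (rule mfd_deriv_coord_field[OF assms]) (rule has_derivative_const)
  then show ?thesis using C_field[OF assms vf_cf[OF assms], of w \<alpha>] by (simp add: coord_field_center[OF assms])
qed

text \<open>The section with components \<open>w + ((y - o) \<bullet> e) c\<close>, where \<open>o\<close> are the coordinates of \<open>b\<close>, has
  the same value at \<open>b\<close> as the constant one but its derivative along \<open>e\<close> is \<open>c\<close>. By the Leibniz rule the covariant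
  derivatives differ by \<open>c\<close> as well.\<close>

lemma C_vertical:
  assumes b: "b \<in> pts"
  shows "C (b, w) (0, c) = c"
proof -
  obtain e :: 'e where e: "e \<in> Basis" using nonempty_Basis by blast
  let ?o = "chart X b b"
  define f where "f y = (y - ?o) \<bullet> e" for y
  have Cf: "Cinf_on (cimg b) f" unfolding f_def
    by (intro Cinf_on_linear[OF open_cimg[OF b] bounded_linear_inner_left] Cinf_on_diff open_cimg b Cinf_on_ident Cinf_on_const)
  define Y where "Y y = w + f y *\<^sub>R c" for y
  have CY: "Cinf_on (cimg b) Y" unfolding Y_def
    by (intro Cinf_on_add[OF open_cimg[OF b]] Cinf_on_const Cinf_on_bilinear[OF open_cimg[OF b] bounded_bilinear_scaleR] Cf)
  have vf1: "vector_field_on X (cdom b) (coord_field b (\<lambda>y. f y *\<^sub>R c))"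
    by (intro vector_field_coord_field[OF b] Cinf_on_const Cinf_on_bilinear[OF open_cimg[OF b] bounded_bilinear_scaleR] Cf)
  have sf: "smooth_fun_on X (cdom b) (\<lambda>s. f (chart X b s))" by (rule smooth_fun_coord[OF b Cf])
  let ?Z = "\<lambda>s. cf b w s + f (chart X b s) *\<^sub>R cf b c s"
  have lin: "linear (cc b s s)" if "s \<in> cdom b" for s
    using linear_cc[OF b] that dom_pts[OF b that] center by blast
  have Zeq: "coord_field b Y s = ?Z s" if "s \<in> cdom b" for s
    using lin[OF that] unfolding coord_field_def Y_def by (simp add: linear_add linear_scale)
  have vfs: "vector_field_on X (cdom b) (\<lambda>s. f (chart X b s) *\<^sub>R cf b c s)"
    unfolding vector_field_on_def
  proof
    fix r assume r: "r \<in> pts"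
    have o: "open (chart X r ` (cdom b \<inter> cdom r))" using open_ovl[OF r b] by (simp add: Int_commute)
    have eq: "local_rep X r (coord_field b (\<lambda>y. f y *\<^sub>R c)) y = local_rep X r (\<lambda>s. f (chart X b s) *\<^sub>R cf b c s) y"
      if "y \<in> chart X r ` (cdom b \<inter> cdom r)" for y
      using that lin r unfolding local_rep_def coord_field_def by (auto simp: chart_inv_chart linear_scale Let_def)
    have "Cinf_on (chart X r ` (cdom b \<inter> cdom r)) (local_rep X r (coord_field b (\<lambda>y. f y *\<^sub>R c)))"
      using vf1 r unfolding vector_field_on_def by blast
    then show "Cinf_on (chart X r ` (cdom b \<inter> cdom r)) (local_rep X r (\<lambda>s. f (chart X b s) *\<^sub>R cf b c s))"
      by (rule Cinf_on_cong[OF o, rotated]) (rule eq)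
  qed
  have fd: "fun_deriv X (\<lambda>s. f (chart X b s)) b \<delta> = \<delta> \<bullet> e" for \<delta>
  proof -
    have "(f has_derivative (\<lambda>\<delta>. \<delta> \<bullet> e)) (at ?o)"
      unfolding f_def by (auto intro!: derivative_eq_intros)
    then have "((\<lambda>s. f (chart X b s)) \<circ> chart_inv X b has_derivative (\<lambda>\<delta>. \<delta> \<bullet> e)) (at ?o)"
    proof (rule has_derivative_transform_within_open)
      show "open (cimg b)" by (rule open_cimg[OF b])
      show "chart X b b \<in> cimg b" using center[OF b] by blast
    qed (simp add: chart_chart_inv)
    then show ?thesis unfolding fun_deriv_def by (metis frechet_derivative_at)
  qed
  have f0: "f ?o = 0" unfolding f_def by simp
  have 1: "nab ?Z b \<delta> = nab (cf b w) b \<delta> + (\<delta> \<bullet> e) *\<^sub>R c" for \<delta>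
    using levi_civita_dom(2)[OF b vf_cf[OF b] vfs sf center[OF b], of w]
      levi_civita_dom(3)[OF b vf_cf[OF b] vf_cf[OF b] sf center[OF b], of c] fd f0
    by (simp add: coord_field_center[OF b])
  have dY: "(Y has_derivative (\<lambda>\<delta>. (\<delta> \<bullet> e) *\<^sub>R c)) (at ?o)"
    unfolding Y_def f_def by (auto intro!: derivative_eq_intros)
  have "nab (coord_field b Y) b = nab ?Z b"
  proof -
    have vY: "vector_field_on X (cdom b) (coord_field b Y)" by (rule vector_field_coord_field[OF b CY])
    have vZ: "vector_field_on X (cdom b) ?Z"
      unfolding vector_field_on_def
    proof
      fix r assume r: "r \<in> pts"
      have o: "open (chart X r ` (cdom b \<inter> cdom r))" using open_ovl[OF r b] by (simp add: Int_commute)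
      have eq: "local_rep X r (coord_field b Y) y = local_rep X r ?Z y"
        if "y \<in> chart X r ` (cdom b \<inter> cdom r)" for y
        using that Zeq r unfolding local_rep_def by (auto simp: chart_inv_chart Let_def)
      have "Cinf_on (chart X r ` (cdom b \<inter> cdom r)) (local_rep X r (coord_field b Y))"
        using vY r unfolding vector_field_on_def by blast
      then show "Cinf_on (chart X r ` (cdom b \<inter> cdom r)) (local_rep X r ?Z)"
        by (rule Cinf_on_cong[OF o, rotated]) (rule eq)
    qed
    show ?thesis
      using lc[unfolded levi_civita_def, rule_format, OF openin_dom[OF b] vY vZ sf] Zeq center[OF b] by blast
  qed
  then have "C (b, w) (e, (e \<bullet> e) *\<^sub>R c) = nab ?Z b e"
    using C_field[OF b vector_field_coord_field[OF b CY], of e] mfd_deriv_coord_field[OF b dY, of e] f0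
    by (simp add: coord_field_center[OF b] Y_def)
  then have "C (b, w) (e, c) = C (b, w) (e, 0) + c"
    using 1[of e] e by (simp add: C_horizontal[OF b] inner_Basis)
  moreover have "C (b, w) (e, c) = C (b, w) (e, 0) + C (b, w) (0, c)"
    using linear_add[OF linear_C[OF b], of w "(e, 0)" "(0, c)"] by simp
  ultimately show ?thesis by simp
qed

lemma C_split: "b \<in> pts \<Longrightarrow> C (b, w) (\<alpha>, c) = c + C (b, w) (\<alpha>, 0)"
  using linear_add[OF linear_C, of b w "(\<alpha>, 0)" "(0, c)"] C_vertical[of b w c] by (simp add: add.commute)

text \<open>Coordinate fields commute, so this is the vanishing of the torsion.\<close>

lemma C_symmetric:
  assumes b: "b \<in> pts"
  shows "C (b, w) (\<alpha>, 0) = C (b, \<alpha>) (w, 0)"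
proof -
  have lr: "frechet_derivative (local_rep X b (cf b u)) (at (chart X b b)) = (\<lambda>\<delta>. 0)" for u
  proof -
    have "((\<lambda>y. u) has_derivative (\<lambda>\<delta>. 0)) (at (chart X b b))" by (rule has_derivative_const)
    then have "(local_rep X b (cf b u) has_derivative (\<lambda>\<delta>. 0)) (at (chart X b b))"
    proof (rule has_derivative_transform_within_open)
      show "open (cimg b)" by (rule open_cimg[OF b])
      show "chart X b b \<in> cimg b" using center[OF b] by blast
    qed (simp add: local_rep_coord_field_self[OF b])
    then show ?thesis by (metis frechet_derivative_at)
  qed
  show ?thesis
    using levi_civita_dom(4)[OF b vf_cf[OF b, of \<alpha>] vf_cf[OF b, of w] sf_const[OF b] center[OF b]]
    by (simp add: C_horizontal[OF b] lie_bracket_def lr coord_field_center[OF b])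
qed

definition chart_metric :: "'p \<Rightarrow> 'e \<Rightarrow> 'e \<Rightarrow> 'e \<Rightarrow> real" where
  "chart_metric b y u w = (let s = chart_inv X b y in \<gamma> s (cc b s s u) (cc b s s w))"

lemma Cinf_chart_metric: "b \<in> pts \<Longrightarrow> Cinf_on (cimg b) (\<lambda>y. chart_metric b y u w)"
  using riem unfolding riemannian_metric_def chart_metric_def by blast

lemma chart_metric_derivative:
  assumes b: "b \<in> pts"
  shows "((\<lambda>y. chart_metric b y u w) has_derivative
     (\<lambda>\<alpha>. \<gamma> b (C (b, u) (\<alpha>, 0)) w + \<gamma> b u (C (b, w) (\<alpha>, 0)))) (at (chart X b b))"
proof -
  have eq: "chart_metric b y u w = ((\<lambda>s. \<gamma> s (cf b u s) (cf b w s)) \<circ> chart_inv X b) y" for y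
    by (simp add: chart_metric_def coord_field_def Let_def)
  have "chart X b b \<in> cimg b" using center[OF b] by blast
  then have "((\<lambda>y. chart_metric b y u w) has_derivative
      frechet_derivative (\<lambda>y. chart_metric b y u w) (at (chart X b b))) (at (chart X b b))"
    by (rule Cinf_on_has_derivative[OF Cinf_chart_metric[OF b]])
  moreover have "frechet_derivative (\<lambda>y. chart_metric b y u w) (at (chart X b b))
      = (\<lambda>\<alpha>. \<gamma> b (C (b, u) (\<alpha>, 0)) w + \<gamma> b u (C (b, w) (\<alpha>, 0)))"
    using levi_civita_dom(5)[OF b vf_cf[OF b, of u] vf_cf[OF b, of w] sf_const[OF b] center[OF b]]
    unfolding fun_deriv_def eq[abs_def]
    by (simp add: C_horizontal[OF b] coord_field_center[OF b] fun_eq_iff o_def)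
  ultimately show ?thesis by simp
qed

lemma inner_product_metric: "p \<in> pts \<Longrightarrow> inner_product (\<gamma> p)"
  using riem unfolding riemannian_metric_def by blast

lemma bilinear_chart_metric:
  assumes b: "b \<in> pts" and y: "y \<in> cimg b"
  shows "linear (\<lambda>u. chart_metric b y u w)" "linear (\<lambda>w. chart_metric b y u w)"
proof -
  let ?s = "chart_inv X b y"
  have s: "?s \<in> cdom b" using chart_inv_dom[OF y] .
  have sp: "?s \<in> pts" using dom_pts[OF b s] .
  have "bilinear (\<gamma> ?s)" using inner_product_metric[OF sp] unfolding inner_product_def by blast
  moreover have "linear (cc b ?s ?s)" using linear_cc[OF b sp s center[OF sp]] .
  ultimately show "linear (\<lambda>u. chart_metric b y u w)" "linear (\<lambda>w. chart_metric b y u w)"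
    unfolding chart_metric_def Let_def bilinear_def
    by (auto intro: linear_compose[unfolded o_def])
qed

text \<open>The Gram operator of the metric in the chart. An operator-valued function enters the
  bilinear product rule, unlike a family of bilinear forms.\<close>

definition metric_op :: "'p \<Rightarrow> 'e \<Rightarrow> 'e \<Rightarrow>\<^sub>L 'e" where
  "metric_op b y = Blinfun (\<lambda>w. \<Sum>i\<in>Basis. chart_metric b y i w *\<^sub>R i)"

lemma linear_metric_op:
  assumes "b \<in> pts" "y \<in> cimg b"
  shows "linear (\<lambda>w. \<Sum>i\<in>Basis. chart_metric b y i w *\<^sub>R i)"
proof (rule linear_compose_sum, rule ballI)
  fix i :: 'e assume "i \<in> Basis"
  show "linear (\<lambda>w. chart_metric b y i w *\<^sub>R i)"
    using bilinear_chart_metric(2)[OF assms, of i] by (simp add: linear_iff scaleR_add_left)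
qed

lemma inner_metric_op:
  assumes "b \<in> pts" "y \<in> cimg b"
  shows "u \<bullet> metric_op b y w = chart_metric b y u w"
proof -
  have "u \<bullet> metric_op b y w = (\<Sum>i\<in>Basis. (u \<bullet> i) *\<^sub>R chart_metric b y i w)"
    using linear_metric_op[OF assms]
    by (simp add: metric_op_def bounded_linear_Blinfun_apply linear_conv_bounded_linear inner_sum_right mult.commute)
  also have "\<dots> = chart_metric b y u w"
    by (rule linear_basis_expansion[OF bilinear_chart_metric(1)[OF assms], symmetric])
  finally show ?thesis .
qed

lemma Cinf_metric_op:
  assumes b: "b \<in> pts"
  shows "Cinf_on (cimg b) (metric_op b)"
  unfolding metric_op_def
  by (rule Cinf_on_Blinfun[OF open_cimg[OF b] linear_metric_op[OF b]], assumption)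
    (intro Cinf_on_sum[OF open_cimg[OF b]] Cinf_on_linear[OF open_cimg[OF b] bounded_linear_scaleR_left]
      Cinf_chart_metric[OF b])

lemma metric_op_derivative:
  assumes b: "b \<in> pts"
  shows "u \<bullet> bderiv (metric_op b) (chart X b b) \<alpha> w = \<gamma> b (C (b, u) (\<alpha>, 0)) w + \<gamma> b u (C (b, w) (\<alpha>, 0))"
proof -
  have ctr: "chart X b b \<in> cimg b" using center[OF b] by blast
  have d1: "(metric_op b has_derivative bderiv (metric_op b) (chart X b b)) (at (chart X b b))"
    by (rule has_derivative_bderiv[OF Cinf_metric_op[OF b] ctr])
  have "((\<lambda>y. u \<bullet> metric_op b y w) has_derivative (\<lambda>\<alpha>. u \<bullet> bderiv (metric_op b) (chart X b b) \<alpha> w)) (at (chart X b b))"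
    by (intro has_derivative_inner_right bounded_linear.has_derivative[OF blinfun.bounded_linear_left] d1)
  then have "((\<lambda>y. chart_metric b y u w) has_derivative (\<lambda>\<alpha>. u \<bullet> bderiv (metric_op b) (chart X b b) \<alpha> w)) (at (chart X b b))"
    by (rule has_derivative_transform_within_open[OF _ open_cimg[OF b] ctr]) (simp add: inner_metric_op[OF b])
  from fun_cong[OF has_derivative_unique[OF this chart_metric_derivative[OF b]], of \<alpha>] show ?thesis .
qed

lemma chart_metric_center: "b \<in> pts \<Longrightarrow> chart_metric b (chart X b b) u w = \<gamma> b u w"
  using center cc_same by (simp add: chart_metric_def chart_inv_chart)

end

section \<open>Maps from embedded manifolds in coordinates\<close>

context atlas begin

lemma smooth_to_local:
  assumes "smooth_to N X f" "x \<in> N" "r \<in> pts" "f x \<in> cdom r"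
  obtains U F where "open U" "x \<in> U" "Cinf_on U F" "\<forall>y\<in>U \<inter> N. f y \<in> cdom r \<and> F y = chart X r (f y)"
proof -
  let ?b = "f x"
  have b: "?b \<in> pts" using assms(1,2) unfolding smooth_to_def by blast
  obtain U0 where U0: "open U0" "x \<in> U0" "f ` (U0 \<inter> N) \<subseteq> cdom ?b" "smooth_on (U0 \<inter> N) (chart X ?b \<circ> f)"
    using assms(1,2) unfolding smooth_to_def by blast
  have "x \<in> U0 \<inter> N" using U0(2) assms(2) by blast
  obtain V G where V: "open V" "x \<in> V" "Cinf_on V G" "\<forall>y\<in>V \<inter> (U0 \<inter> N). G y = (chart X ?b \<circ> f) y"
    using smooth_on_extE[OF U0(4) \<open>x \<in> U0 \<inter> N\<close>] .
  let ?O = "ovl ?b r"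
  have oO: "open ?O" by (rule open_ovl[OF b assms(3)])
  let ?U = "U0 \<inter> (V \<inter> G -` ?O)"
  have oVG: "open (V \<inter> G -` ?O)"
    by (rule continuous_open_preimage[OF Cinf_on_continuous_on[OF V(3)] V(1) oO])
  have Gx: "G x = chart X ?b ?b" using V(2,4) U0(2) assms(2) by simp
  show thesis
  proof (rule that[of ?U "\<lambda>y. tau ?b r (G y)"])
    show oU: "open ?U" using U0(1) oVG by blast
    show "x \<in> ?U" using U0(2) V(2) Gx center[OF b] assms(4) by auto
    show "Cinf_on ?U (\<lambda>y. tau ?b r (G y))"
      by (rule Cinf_on_compose[OF oU oO _ Cinf_on_subset[OF V(3)] Cinf_tau[OF b assms(3)]]) auto
    show "\<forall>y\<in>?U \<inter> N. f y \<in> cdom r \<and> tau ?b r (G y) = chart X r (f y)"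
    proof
      fix y assume y: "y \<in> ?U \<inter> N"
      then have Gy: "G y = chart X ?b (f y)" "G y \<in> ?O" "f y \<in> cdom ?b" using V(4) U0(3) by auto
      then have "chart_inv X ?b (G y) = f y" using chart_inv_chart[OF b] by simp
      then show "f y \<in> cdom r \<and> tau ?b r (G y) = chart X r (f y)"
        using Gy(2) ovl_iff[OF b, of "G y" r] by simp
    qed
  qed
qed

text \<open>The function \<open>emb_deriv\<close> uses the chart indexed by the image point, whereas \<open>F\<close> uses the fixed chart at
  \<open>r\<close>; the two differ by a transition map.\<close>

lemma emb_deriv_has_derivative:
  assumes "r \<in> pts" "f x \<in> pts" "f x \<in> cdom r" "x \<in> N"
    "open U" "x \<in> U" "Cinf_on U F" "\<forall>y\<in>U \<inter> N. f y \<in> cdom r \<and> F y = chart X r (f y)"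
  shows "((chart X (f x) \<circ> f) has_derivative (\<lambda>u. cc r (f x) (f x) (bderiv F x u))) (at x within N)"
proof -
  have Fx: "F x = chart X r (f x)" using assms by blast
  have "(F has_derivative bderiv F x) (at x within U \<inter> N)"
    using has_derivative_bderiv[OF assms(7,6)] has_derivative_at_withinI by blast
  moreover have "(tau r (f x) has_derivative cc r (f x) (f x)) (at (F x) within F ` (U \<inter> N))"
    unfolding Fx using tau_has_derivative[OF assms(1,2,3) center[OF assms(2)]] has_derivative_at_withinI by blast
  ultimately have "(tau r (f x) \<circ> F has_derivative cc r (f x) (f x) \<circ> bderiv F x) (at x within U \<inter> N)"
    by (rule diff_chain_within)
  then have "((chart X (f x) \<circ> f) has_derivative cc r (f x) (f x) \<circ> bderiv F x) (at x within U \<inter> N)"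
  proof (rule has_derivative_transform[rotated 2])
    show "x \<in> U \<inter> N" using assms(4,6) by blast
    show "(chart X (f x) \<circ> f) y = (tau r (f x) \<circ> F) y" if "y \<in> U \<inter> N" for y
      using bspec[OF assms(8) that] by (simp add: chart_inv_chart[OF assms(1)])
  qed
  moreover have "at x within U \<inter> N = at x within N"
    by (rule at_within_nhd[OF assms(6,5)]) auto
  ultimately show ?thesis by (simp add: o_def)
qed

lemma emb_deriv_coord:
  assumes "r \<in> pts" "f x \<in> pts" "f x \<in> cdom r" "u \<in> tangent_space N x"
    "open U" "x \<in> U" "Cinf_on U F" "\<forall>y\<in>U \<inter> N. f y \<in> cdom r \<and> F y = chart X r (f y)"
  shows "bderiv F x u = cc (f x) r (f x) (emb_deriv N X f x u)"
proof -
  have "emb_deriv N X f x u = cc r (f x) (f x) (bderiv F x u)"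
    unfolding emb_deriv_def
    by (rule dirD_eqI[OF emb_deriv_has_derivative[OF assms(1-3) tangent_space_mem[OF assms(4)] assms(5-8)] assms(4)])
  then show ?thesis using cc_inverse[OF assms(1,2,3) center[OF assms(2)]] by simp
qed

lemma linear_emb_deriv:
  assumes "smooth_to N X f" "x \<in> N"
  shows "linear (emb_deriv N X f x)"
proof -
  have b: "f x \<in> pts" using assms unfolding smooth_to_def by blast
  obtain U F where U: "open U" "x \<in> U" "Cinf_on U F" "\<forall>y\<in>U \<inter> N. f y \<in> cdom (f x) \<and> F y = chart X (f x) (f y)"
    using smooth_to_local[OF assms b center[OF b]] .
  have "((chart X (f x) \<circ> f) has_derivative dirD N (chart X (f x) \<circ> f) x) (at x within N)"
    using emb_deriv_has_derivative[where U=U and F=F and N=N, OF b b center[OF b] assms(2) U]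
    unfolding dirD_def[abs_def] using frechet_derivative_works differentiable_def by blast
  then show ?thesis unfolding emb_deriv_def by (rule has_derivative_linear)
qed

end

section \<open>Submersed ambient structures\<close>

locale submersed =
  fixes A :: "('a::euclidean_space, 'p, 'e::euclidean_space) ambient"
  assumes sa: "submersed_ambient A"
begin

abbreviation "M \<equiv> tot A"
abbreviation "q \<equiv> sub A"
abbreviation "g \<equiv> met A"
abbreviation "H \<equiv> H_pr A"
abbreviation "P \<equiv> Pi_pr A"
abbreviation "V \<equiv> V_pr A"
abbreviation "ed \<equiv> emb_deriv (tot A) (base A) (sub A)"

lemma rs: "riemannian_submersion M g (base A) (base_metric A) q"
  and smooth_P: "smooth_on M P" and smooth_H: "smooth_on M H" and smooth_V: "smooth_on M V"
  using sa unfolding submersed_ambient_def by blast+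

lemma emb: "embedded_submanifold M" and metr: "metric_operator M g"
  and mfd: "smooth_manifold (base A)" and riemB: "riemannian_metric (base A) (base_metric A)"
  and smq: "smooth_to M (base A) q" and qM: "q ` M = points (base A)"
  and surj: "x \<in> M \<Longrightarrow> ed x ` tangent_space M x = UNIV"
  and isom: "x \<in> M \<Longrightarrow> \<xi> \<in> HM_fib A x \<Longrightarrow> \<eta> \<in> HM_fib A x \<Longrightarrow> base_metric A (q x) (ed x \<xi>) (ed x \<eta>) = \<xi> \<bullet> g x \<eta>"
  using rs unfolding riemannian_submersion_def riemannian_embedded_def HM_fib_def by auto

lemma atlas_base: "atlas (base A)" using mfd smooth_manifold_iff by blast

sublocale atlas "base A" by (rule atlas_base)

lemma q_pts: "x \<in> M \<Longrightarrow> q x \<in> pts" using qM by blast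

lemma pd: "x \<in> M \<Longrightarrow> pos_def_op (g x)"
  using metr unfolding metric_operator_def pos_def_op_def by blast

lemma smooth_g: "smooth_on M g" using metr unfolding metric_operator_def by blast

lemma sub_T: "x \<in> M \<Longrightarrow> subspace (TM A x)"
  unfolding TM_def by (rule subspace_tangent_space[OF emb])

lemma lin_ed: "x \<in> M \<Longrightarrow> linear (ed x)" by (rule linear_emb_deriv[OF smq])

lemma VM_iff: "u \<in> VM A x \<longleftrightarrow> u \<in> TM A x \<and> ed x u = 0"
  by (simp add: VM_def vertical_space_def TM_def)

lemma H_fib_iff: "u \<in> HM_fib A x \<longleftrightarrow> u \<in> TM A x \<and> (\<forall>e\<in>VM A x. u \<bullet> g x e = 0)"
  by (simp add: HM_fib_def horizontal_space_def TM_def VM_def)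

lemma sub_V: "x \<in> M \<Longrightarrow> subspace (VM A x)"
  using sub_T[of x] lin_ed[of x] unfolding subspace_def
  by (auto simp: VM_iff linear_0 linear_add linear_scale)

lemma sub_H: "x \<in> M \<Longrightarrow> subspace (HM_fib A x)"
  using sub_T[of x] unfolding subspace_def by (auto simp: H_fib_iff inner_add_left)

lemma H_T: "u \<in> HM_fib A x \<Longrightarrow> u \<in> TM A x" by (simp add: H_fib_iff)
lemma V_T: "u \<in> VM A x \<Longrightarrow> u \<in> TM A x" by (simp add: VM_iff)
lemma T_M: "u \<in> TM A x \<Longrightarrow> x \<in> M" unfolding TM_def by (rule tangent_space_mem)

lemma H_mem: "x \<in> M \<Longrightarrow> H x z \<in> HM_fib A x"
  and H_orth: "x \<in> M \<Longrightarrow> w \<in> HM_fib A x \<Longrightarrow> (z - H x z) \<bullet> g x w = 0"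
  and H_fix: "x \<in> M \<Longrightarrow> w \<in> HM_fib A x \<Longrightarrow> H x w = w"
  and H_sa: "x \<in> M \<Longrightarrow> u \<bullet> g x (H x w) = H x u \<bullet> g x w"
  unfolding H_pr_def
  by (auto intro: oproj_mem oproj_orth oproj_fix oproj_selfadjoint pd sub_H)

lemma V_mem: "x \<in> M \<Longrightarrow> V x z \<in> VM A x"
  and V_orth: "x \<in> M \<Longrightarrow> w \<in> VM A x \<Longrightarrow> (z - V x z) \<bullet> g x w = 0"
  and V_fix: "x \<in> M \<Longrightarrow> w \<in> VM A x \<Longrightarrow> V x w = w"
  unfolding V_pr_def
  by (auto intro: oproj_mem oproj_orth oproj_fix pd sub_V)

lemma P_mem: "x \<in> M \<Longrightarrow> P x z \<in> TM A x"
  and P_fix: "x \<in> M \<Longrightarrow> w \<in> TM A x \<Longrightarrow> P x w = w"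
  unfolding Pi_pr_def by (auto intro: oproj_mem oproj_fix pd sub_T)

lemma H_iff: "x \<in> M \<Longrightarrow> H x u = u \<longleftrightarrow> u \<in> HM_fib A x"
  using H_mem H_fix by metis

lemma HV0: "x \<in> M \<Longrightarrow> e \<in> VM A x \<Longrightarrow> H x e = 0"
  unfolding H_pr_def using pos_def_op_sym[OF pd]
  by (intro oproj_zero pd sub_H) (auto simp: H_fib_iff)

lemma VH0: "x \<in> M \<Longrightarrow> u \<in> HM_fib A x \<Longrightarrow> V x u = 0"
  unfolding V_pr_def by (intro oproj_zero pd sub_V) (auto simp: H_fib_iff)

lemma P_decomp: assumes x: "x \<in> M" shows "P x = H x + V x"
proof -
  have "is_oproj (g x) (TM A x) (H x + V x)"
    unfolding is_oproj_def
  proof (intro conjI allI ballI)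
    fix z
    show "(H x + V x) z \<in> TM A x"
      using H_T[OF H_mem[OF x]] V_T[OF V_mem[OF x]] sub_T[OF x] by (simp add: blinfun.add_left subspace_add)
    fix w assume w: "w \<in> TM A x"
    have vw: "V x w \<in> VM A x" by (rule V_mem[OF x])
    have hw: "w - V x w \<in> HM_fib A x"
      unfolding H_fib_iff using w vw V_T sub_T[OF x] V_orth[OF x] by (auto intro: subspace_diff)
    have 1: "(z - H x z) \<bullet> g x (w - V x w) = 0" by (rule H_orth[OF x hw])
    have 2: "V x z \<bullet> g x (w - V x w) = 0"
      using hw V_mem[OF x, of z] pos_def_op_sym[OF pd[OF x]] unfolding H_fib_iff by metis
    have 3: "(z - V x z) \<bullet> g x (V x w) = 0" by (rule V_orth[OF x vw])
    have 4: "H x z \<bullet> g x (V x w) = 0" using H_mem[OF x, of z] vw unfolding H_fib_iff by blast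
    have "g x w = g x (w - V x w) + g x (V x w)" by (simp add: blinfun.diff_right)
    then show "(z - (H x + V x) z) \<bullet> g x w = 0"
      using 1 2 3 4 by (simp add: blinfun.add_left inner_diff_left inner_add_right inner_add_left)
  qed
  then show ?thesis unfolding Pi_pr_def by (intro oproj_eqI pd sub_T x)
qed

lemma T_decomp: "u \<in> TM A x \<Longrightarrow> u = H x u + V x u"
  using P_fix[OF T_M, of u x u] P_decomp[OF T_M, of u x] by (simp add: blinfun.add_left)

lemma T_H0: "u \<in> TM A x \<Longrightarrow> H x u = 0 \<Longrightarrow> u \<in> VM A x"
  using T_decomp[of u x] V_mem[OF T_M, of u x u] by simp

lemma PV: "x \<in> M \<Longrightarrow> V x = P x - H x" using P_decomp by simp

lemma HP: "x \<in> M \<Longrightarrow> H x (P x z) = H x z"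
  using P_decomp[of x] HV0[OF _ V_mem] H_fix[OF _ H_mem]
  by (simp add: blinfun.add_left blinfun.add_right)

lemma lin_dH: "x \<in> M \<Longrightarrow> linear (DH A x)" and lin_dP: "x \<in> M \<Longrightarrow> linear (DPi A x)"
  by (auto intro: dirD_linear_fun smooth_H smooth_P)

text \<open>Identities between the projections are differentiated along tangent vectors by the product rule.\<close>

lemma dirD_product_identity:
  fixes K K' K'' :: "'a \<Rightarrow> 'a \<Rightarrow>\<^sub>L 'a"
  assumes "smooth_on M K" "smooth_on M K'" "\<And>y z. y \<in> M \<Longrightarrow> K y (K' y z) = K'' y z" "\<xi> \<in> TM A x"
  shows "dirD M K'' x \<xi> u = K x (dirD M K' x \<xi> u) + dirD M K x \<xi> (K' x u)"
proof -
  note t = assms(4)[unfolded TM_def]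
  have eq: "dirD M K'' x = dirD M (\<lambda>y. K y o\<^sub>L K' y) x"
    by (rule dirD_cong[OF _ T_M[OF assms(4)]]) (auto intro!: blinfun_eqI simp: assms(3))
  from arg_cong[OF dirD_blinfun_compose[OF assms(1,2) t, folded eq], of "\<lambda>D. blinfun_apply D u"] show ?thesis
    unfolding blinfun.add_left blinfun_apply_blinfun_compose .
qed

lemma dHH: "\<xi> \<in> TM A x \<Longrightarrow> DH A x \<xi> u = H x (DH A x \<xi> u) + DH A x \<xi> (H x u)"
  by (rule dirD_product_identity[OF smooth_H smooth_H H_fix[OF _ H_mem]])

lemma dPP: "\<xi> \<in> TM A x \<Longrightarrow> DPi A x \<xi> u = P x (DPi A x \<xi> u) + DPi A x \<xi> (P x u)"
  by (rule dirD_product_identity[OF smooth_P smooth_P P_fix[OF _ P_mem]])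

lemma dPH: "\<xi> \<in> TM A x \<Longrightarrow> DH A x \<xi> u = P x (DH A x \<xi> u) + DPi A x \<xi> (H x u)"
  by (rule dirD_product_identity[OF smooth_P smooth_H P_fix[OF _ H_T[OF H_mem]]])

lemma dV: "\<xi> \<in> TM A x \<Longrightarrow> dirD M V x \<xi> = DPi A x \<xi> - DH A x \<xi>"
proof -
  assume xi: "\<xi> \<in> TM A x"
  note x = T_M[OF xi] and t = xi[unfolded TM_def]
  have eq: "dirD M V x = dirD M (\<lambda>y. P y - H y) x"
    by (rule dirD_cong[OF _ x]) (simp add: PV)
  then show ?thesis using dirD_diff[OF smooth_P smooth_H t] eq by simp
qed

lemma H_dH: "\<xi> \<in> TM A x \<Longrightarrow> u \<in> HM_fib A x \<Longrightarrow> H x (DH A x \<xi> u) = 0"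
  using dHH[of \<xi> x u] H_fix[OF T_M, of \<xi> x u] by simp

lemma dH_vert: "\<xi> \<in> TM A x \<Longrightarrow> e \<in> VM A x \<Longrightarrow> DH A x \<xi> e \<in> HM_fib A x"
  using dHH[of \<xi> x e] HV0[OF T_M, of \<xi> x e] H_iff[OF T_M, of \<xi> x "DH A x \<xi> e"] by (simp add: blinfun.zero_right)

lemma P_dP: "\<xi> \<in> TM A x \<Longrightarrow> u \<in> TM A x \<Longrightarrow> P x (DPi A x \<xi> u) = 0"
  using dPP[of \<xi> x u] P_fix[OF T_M, of \<xi> x u] by simp

lemma H_dP: "\<xi> \<in> TM A x \<Longrightarrow> u \<in> TM A x \<Longrightarrow> H x (DPi A x \<xi> u) = 0"
  using P_dP[of \<xi> x u] HP[OF T_M, of \<xi> x "DPi A x \<xi> u"] by (simp add: blinfun.zero_right)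

lemma HM_iff: "(x, v) \<in> HM A \<longleftrightarrow> x \<in> M \<and> v \<in> HM_fib A x"
  unfolding HM_def using H_iff by auto

lemma dH_dP_T: "\<xi> \<in> TM A x \<Longrightarrow> u \<in> HM_fib A x \<Longrightarrow> DH A x \<xi> u - DPi A x \<xi> u \<in> TM A x"
  using dPH[of \<xi> x u] H_fix[OF T_M, of \<xi> x u] P_mem[OF T_M, of \<xi> x "DH A x \<xi> u"] by (metis add_diff_cancel_right')

end

locale submersed_christoffel = submersed A for A :: "('a::euclidean_space, 'p, 'e::euclidean_space) ambient" +
  fixes \<Gamma> :: "'a \<Rightarrow> 'a \<Rightarrow>\<^sub>L 'a \<Rightarrow>\<^sub>L 'a"
  assumes chr: "christoffel_function (tot A) (met A) \<Gamma>"
begin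

lemma smooth_Gamma: "smooth_on M \<Gamma>" using chr unfolding christoffel_function_def by blast

text \<open>The fields \<open>y \<mapsto> \<Pi>\<^sub>y a\<close> have any given tangent vector as value at a given point, and their
  derivatives are those of the projection. They turn the conditions on the covariant derivative of
  vector fields into pointwise identities.\<close>

lemma field_P: "emb_vector_field M (\<lambda>y. P y a)"
  unfolding emb_vector_field_def using P_mem unfolding TM_def
  by (auto intro!: smooth_on_blinfun_apply smooth_P smooth_on_const)

lemma dfield: "\<xi> \<in> TM A x \<Longrightarrow> dirD M (\<lambda>y. P y a) x \<xi> = DPi A x \<xi> a"
  unfolding TM_def by (rule dirD_blinfun_apply_const[OF smooth_P])

lemma christoffel_facts:
  assumes "x \<in> M"
  defines "nabla \<equiv> \<lambda>a b. DPi A x (P x a) b + \<Gamma> x (P x a) (P x b)"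
  shows "nabla a b \<in> TM A x"
    "nabla a b - nabla b a = DPi A x (P x a) b - DPi A x (P x b) a"
    "dirD M (\<lambda>y. P y b \<bullet> g y (P y c)) x (P x a) = nabla a b \<bullet> g x (P x c) + P x b \<bullet> g x (nabla a c)"
proof -
  let ?n = "\<lambda>X Y x. dirD M Y x (X x) + \<Gamma> x (X x) (Y x)"
  note c = chr[unfolded christoffel_function_def Let_def, THEN conjunct2, rule_format, OF field_P[of a] field_P[of b] field_P[of c]]
  have n: "?n (\<lambda>y. P y a) (\<lambda>y. P y b) x = nabla a b" for a b
    unfolding nabla_def using dfield[OF P_mem[OF assms(1)]] by simp
  show "nabla a b \<in> TM A x"
    using c[THEN conjunct1, unfolded emb_vector_field_def, THEN conjunct2, rule_format, OF assms(1)]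
    unfolding n TM_def .
  show "nabla a b - nabla b a = DPi A x (P x a) b - DPi A x (P x b) a"
    using c[THEN conjunct2, THEN conjunct1, rule_format, OF assms(1)] dfield[OF P_mem[OF assms(1)]]
    by (simp add: nabla_def)
  show "dirD M (\<lambda>y. P y b \<bullet> g y (P y c)) x (P x a) = nabla a b \<bullet> g x (P x c) + P x b \<bullet> g x (nabla a c)"
    using c[THEN conjunct2, THEN conjunct2, rule_format, OF assms(1)] dfield[OF P_mem[OF assms(1)]]
    by (simp add: nabla_def)
qed

lemma Gamma_sym:
  assumes "\<xi> \<in> TM A x" "\<eta> \<in> TM A x"
  shows "\<Gamma> x \<xi> \<eta> = \<Gamma> x \<eta> \<xi>"
  using christoffel_facts(2)[OF T_M[OF assms(1)], of \<xi> \<eta>] P_fix[OF T_M[OF assms(1)]] assms by simp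

lemma nabla_T:
  assumes "\<xi> \<in> TM A x" "\<eta> \<in> TM A x"
  shows "DPi A x \<xi> \<eta> + \<Gamma> x \<xi> \<eta> \<in> TM A x"
  using christoffel_facts(1)[OF T_M[OF assms(1)], of \<xi> \<eta>] P_fix[OF T_M[OF assms(1)]] assms by simp

text \<open>This is the symmetry of the second fundamental form. The difference of both sides is tangent because covariant
  derivatives are tangent and \<open>\<Gamma>\<close> is symmetric, and \<open>P\<close> annihilates it.\<close>

lemma dP_sym:
  assumes "\<xi> \<in> TM A x" "\<eta> \<in> TM A x"
  shows "DPi A x \<xi> \<eta> = DPi A x \<eta> \<xi>"
proof -
  note x = T_M[OF assms(1)]
  let ?d = "DPi A x \<xi> \<eta> - DPi A x \<eta> \<xi>"
  have "(DPi A x \<xi> \<eta> + \<Gamma> x \<xi> \<eta>) - (DPi A x \<eta> \<xi> + \<Gamma> x \<eta> \<xi>) \<in> TM A x"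
    by (intro subspace_diff[OF sub_T[OF x]] nabla_T assms)
  then have "?d \<in> TM A x" using Gamma_sym[OF assms] by simp
  then have "?d = P x ?d" using P_fix[OF x] by simp
  also have "\<dots> = 0" using P_dP assms by (simp add: blinfun.diff_right)
  finally show ?thesis by simp
qed

lemma metric_compat:
  assumes "\<xi> \<in> TM A x" "\<eta> \<in> TM A x" "\<zeta> \<in> TM A x"
  shows "\<eta> \<bullet> dirD M g x \<xi> \<zeta> = \<Gamma> x \<xi> \<eta> \<bullet> g x \<zeta> + \<eta> \<bullet> g x (\<Gamma> x \<xi> \<zeta>)"
proof -
  note x = T_M[OF assms(1)] and t = assms(1)[unfolded TM_def]
  have sm: "smooth_on M (\<lambda>y. P y a)" for a
    by (intro smooth_on_blinfun_apply smooth_P smooth_on_const)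
  have "dirD M (\<lambda>y. P y \<eta> \<bullet> g y (P y \<zeta>)) x \<xi> =
     P x \<eta> \<bullet> (g x (DPi A x \<xi> \<zeta>) + dirD M g x \<xi> (P x \<zeta>)) + DPi A x \<xi> \<eta> \<bullet> g x (P x \<zeta>)"
    using dirD_inner[OF sm[of \<eta>] smooth_on_blinfun_apply[OF smooth_g sm[of \<zeta>]] t]
      dirD_blinfun_apply[OF smooth_g sm[of \<zeta>] t] dfield[OF assms(1)] by simp
  then show ?thesis
    using christoffel_facts(3)[OF x, of \<eta> \<zeta> \<xi>] P_fix[OF x] assms
    by (simp add: inner_add_left inner_add_right blinfun.add_right)
qed

end

section \<open>The geometry of the submersion in a chart of the base\<close>

locale chart_at = submersed A for A :: "('a::euclidean_space, 'p, 'e::euclidean_space) ambient" +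
  fixes x :: 'a and b :: 'p and U :: "'a set" and F :: "'a \<Rightarrow> 'e"
  assumes x: "x \<in> tot A" and b: "b \<in> points (base A)" and openU: "open U" and xU: "x \<in> U"
    and CF: "Cinf_on U F"
    and UF: "\<forall>y\<in>U \<inter> tot A. sub A y \<in> chart_dom (base A) b \<and> F y = chart (base A) b (sub A y)"
begin

abbreviation "DF \<equiv> bderiv F"
abbreviation "D2 \<equiv> bderiv (bderiv F) x"

lemma CDF: "Cinf_on U DF" by (rule Cinf_on_bderiv[OF openU CF])

lemma xUM: "x \<in> U \<inter> M" using x xU by blast

lemma q_dom: "y \<in> U \<inter> M \<Longrightarrow> q y \<in> cdom b" and F_eq: "y \<in> U \<inter> M \<Longrightarrow> F y = chart (base A) b (q y)"
  using UF by blast+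

lemma F_img: "y \<in> U \<inter> M \<Longrightarrow> F y \<in> cimg b" using q_dom F_eq by auto

lemma inv_F: "y \<in> U \<inter> M \<Longrightarrow> chart_inv (base A) b (F y) = q y"
  using q_dom F_eq chart_inv_chart[OF b] by simp

lemma DF_ed:
  assumes "y \<in> U \<inter> M" "u \<in> TM A y"
  shows "DF y u = cc (q y) b (q y) (ed y u)"
  using assms q_dom[OF assms(1)] q_pts[of y] unfolding TM_def
  by (intro emb_deriv_coord[where U=U] b openU CF UF) auto

lemma cc_DF:
  assumes "y \<in> U \<inter> M" "u \<in> TM A y"
  shows "cc b (q y) (q y) (DF y u) = ed y u"
  using DF_ed[OF assms] cc_inverse[OF q_pts b center[OF q_pts] q_dom[OF assms(1)]] assms(1) by simp

lemma lin_cc_b': "y \<in> U \<inter> M \<Longrightarrow> linear (cc (q y) b (q y))"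
  using linear_cc[OF q_pts b center[OF q_pts] q_dom] by blast

lemma DF_vert: "y \<in> U \<inter> M \<Longrightarrow> e \<in> VM A y \<Longrightarrow> DF y e = 0"
  using DF_ed[of y e] lin_cc_b'[of y] by (simp add: VM_iff linear_0)

lemma DF_H: "y \<in> U \<inter> M \<Longrightarrow> u \<in> TM A y \<Longrightarrow> DF y (H y u) = DF y u"
  using arg_cong[OF T_decomp[of u y], of "blinfun_apply (DF y)"] DF_vert[OF _ V_mem, of y u]
  by (simp add: blinfun.add_right)

lemma tsU: "\<xi> \<in> TM A x \<Longrightarrow> \<xi> \<in> tangent_space (U \<inter> M) x"
  unfolding TM_def using tangent_space_localize[OF openU xU] by simp

lemma D2_sym: "D2 \<xi> u = D2 u \<xi>"
proof -
  have "D2 \<xi> u = frechet_derivative (\<lambda>y. frechet_derivative F (at y) u) (at x) \<xi>" for \<xi> u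
  proof -
    have "(DF has_derivative D2) (at x)" by (rule has_derivative_bderiv[OF CDF xU])
    then have "((\<lambda>y. DF y u) has_derivative (\<lambda>\<xi>. D2 \<xi> u)) (at x)"
      by (rule bounded_linear.has_derivative[OF blinfun.bounded_linear_left])
    then have "((\<lambda>y. frechet_derivative F (at y) u) has_derivative (\<lambda>\<xi>. D2 \<xi> u)) (at x)"
      by (rule has_derivative_transform_within_open[OF _ openU xU]) (simp add: bderiv_apply[OF CF])
    from fun_cong[OF frechet_derivative_at[OF this], of \<xi>] show ?thesis .
  qed
  then show ?thesis using second_derivative_swap[OF openU CF xU] by simp
qed

lemma smooth_DF: "smooth_on (U \<inter> M) DF"
  by (rule Cinf_on_imp_smooth_on[OF openU CDF]) blast

lemma smooth_restrict: "smooth_on M f \<Longrightarrow> smooth_on (U \<inter> M) f"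
  by (rule smooth_on_subset) auto

lemma dDF:
  assumes "smooth_on M K" "\<xi> \<in> TM A x"
  shows "dirD (U \<inter> M) (\<lambda>y. DF y (K y)) x \<xi> = DF x (dirD M K x \<xi>) + D2 \<xi> (K x)"
proof -
  have "dirD (U \<inter> M) DF x \<xi> = D2 \<xi>"
    by (rule dirD_ext[OF openU xU CDF _ tsU[OF assms(2)]]) simp
  then show ?thesis
    using dirD_blinfun_apply[OF smooth_DF smooth_restrict[OF assms(1)] tsU[OF assms(2)]]
    by (simp add: dirD_localize[OF openU xU])
qed

lemma smooth_field: "smooth_on M K \<Longrightarrow> smooth_on M (\<lambda>y. blinfun_apply (K y) w)"
  by (rule smooth_on_blinfun_apply[OF _ smooth_on_const])

text \<open>The function \<open>y \<mapsto> DF y (V y e)\<close> vanishes on the manifold, and so does its derivative.\<close>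

lemma D2_vert:
  assumes "\<xi> \<in> TM A x" "e \<in> VM A x"
  shows "D2 \<xi> e = DF x (DH A x \<xi> e - DPi A x \<xi> e)"
proof -
  have "dirD (U \<inter> M) (\<lambda>y. DF y (V y e)) x = dirD (U \<inter> M) (\<lambda>y. 0) x"
    by (rule dirD_cong[OF _ xUM]) (simp add: DF_vert V_mem)
  then have "DF x (dirD M (\<lambda>y. V y e) x \<xi>) + D2 \<xi> (V x e) = 0"
    using dDF[OF smooth_field[OF smooth_V] assms(1), of e] dirD_const[OF tsU[OF assms(1)], of "0::'e"] by simp
  moreover have "dirD M (\<lambda>y. V y e) x \<xi> = DPi A x \<xi> e - DH A x \<xi> e"
    using dirD_blinfun_apply_const[OF smooth_V assms(1)[unfolded TM_def], of e] dV[OF assms(1)]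
    by (simp add: blinfun.diff_left)
  ultimately have "D2 \<xi> e = - DF x (DPi A x \<xi> e - DH A x \<xi> e)" using V_fix[OF x assms(2)]
    by (simp add: eq_neg_iff_add_eq_0 add.commute)
  then show ?thesis by (simp add: blinfun.diff_right)
qed

text \<open>For horizontal \<open>u\<close> this is the derivative of \<open>y \<mapsto> DF y (H y u)\<close> along \<open>\<xi>\<close>. The summands depend on the
  choice of the extension \<open>F\<close> to a neighbourhood in the ambient space, the sum does not.\<close>

definition L :: "'a \<Rightarrow> 'a \<Rightarrow> 'e" where "L \<xi> u = D2 \<xi> u + DF x (DH A x \<xi> u)"

lemma dDFH:
  assumes "\<xi> \<in> TM A x" "u \<in> HM_fib A x"
  shows "dirD (U \<inter> M) (\<lambda>y. DF y (H y u)) x \<xi> = L \<xi> u"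
  using dDF[OF smooth_field[OF smooth_H] assms(1), of u]
    dirD_blinfun_apply_const[OF smooth_H assms(1)[unfolded TM_def], of u] H_fix[OF x assms(2)]
  by (simp add: L_def)

end

locale chart_christoffel = chart_at A x b U F + submersed_christoffel A \<Gamma>
  for A :: "('a::euclidean_space, 'p, 'e::euclidean_space) ambient" and x b U F \<Gamma>
begin

text \<open>The difference of the two values of \<open>DH\<close> is the bracket of the fields \<open>H y u\<close> and \<open>H y \<xi>\<close>. It is tangent by the
  symmetry of the second fundamental form, and its horizontal part vanishes, so \<open>DF\<close> annihilates it.\<close>

lemma L_sym:
  assumes "\<xi> \<in> HM_fib A x" "u \<in> HM_fib A x"
  shows "L \<xi> u = L u \<xi>"
proof -
  note T = H_T[OF assms(1)] H_T[OF assms(2)]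
  let ?d = "DH A x \<xi> u - DH A x u \<xi>"
  have "?d = (DH A x \<xi> u - DPi A x \<xi> u) - (DH A x u \<xi> - DPi A x u \<xi>)" using dP_sym[OF T] by simp
  then have T': "?d \<in> TM A x" using dH_dP_T[OF T(1) assms(2)] dH_dP_T[OF T(2) assms(1)] subspace_diff[OF sub_T[OF x]] by metis
  have "H x ?d = 0" using H_dH T assms by (simp add: blinfun.diff_right)
  then have "DF x ?d = 0" using T_H0[OF T'] DF_vert[OF xUM] by blast
  then show ?thesis using D2_sym by (simp add: L_def blinfun.diff_right)
qed

text \<open>The second derivative of \<open>F\<close> is symmetric, and \<open>D2_vert\<close> evaluates it with the vertical vector
  in the second place. The remaining terms combine to a vertical vector.\<close>

lemma L_vert:
  assumes "e \<in> VM A x" "v \<in> HM_fib A x"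
  shows "L e v = DF x (DH A x v e)"
proof -
  note T = V_T[OF assms(1)] H_T[OF assms(2)]
  let ?d = "DH A x e v - DPi A x e v"
  have "H x ?d = 0" using H_dH[OF T(1) assms(2)] H_dP[OF T] by (simp add: blinfun.diff_right)
  then have "DF x ?d = 0" using T_H0[OF dH_dP_T[OF T(1) assms(2)]] DF_vert[OF xUM] by blast
  moreover have "D2 e v = DF x (DH A x v e - DPi A x e v)"
    using D2_sym[of e v] D2_vert[OF T(2) assms(1)] dP_sym[OF T] by simp
  ultimately show ?thesis by (simp add: L_def blinfun.diff_right)
qed

end

locale chart_geometry = chart_christoffel A x b U F \<Gamma> + riemannian_base "base A" "base_metric A" nab C
  for A :: "('a::euclidean_space, 'p, 'e::euclidean_space) ambient" and x b U F \<Gamma> nab C +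
  assumes bq: "b = sub A x"
begin

lemma DFx: "u \<in> TM A x \<Longrightarrow> DF x u = ed x u"
  using DF_ed[OF xUM] cc_same[OF q_pts[OF x] center[OF q_pts[OF x]]] by (simp add: bq)

lemma isom_DF:
  assumes "\<xi> \<in> HM_fib A x" "\<eta> \<in> HM_fib A x"
  shows "base_metric A b (DF x \<xi>) (DF x \<eta>) = \<xi> \<bullet> g x \<eta>"
  using isom[OF x assms] DFx[OF H_T[OF assms(1)]] DFx[OF H_T[OF assms(2)]] by (simp add: bq)

abbreviation "gb \<equiv> base_metric A b"
abbreviation "GB \<alpha> w \<equiv> C (b, w) (\<alpha>, 0)"

lemma ipb: "inner_product gb" by (rule inner_product_metric[OF b])

lemma gb_lin: "linear (\<lambda>u. gb u w)" "linear (\<lambda>w. gb u w)"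
  using ipb unfolding inner_product_def bilinear_def by auto

lemma gb_sym: "gb u w = gb w u"
  using ipb unfolding inner_product_def by blast

lemma gb_zero: "gb u u = 0 \<Longrightarrow> u = 0"
  using ipb unfolding inner_product_def by (metis less_irrefl)

lemma metric_pullback:
  assumes y: "y \<in> U \<inter> M"
  shows "DF y (H y u) \<bullet> metric_op b (F y) (DF y (H y w)) = H y u \<bullet> g y (H y w)"
proof -
  have M: "y \<in> M" using y by blast
  have T: "H y u \<in> TM A y" "H y w \<in> TM A y" using H_T[OF H_mem[OF M]] by auto
  show ?thesis
    using inner_metric_op[OF b F_img[OF y]] isom[OF M H_mem[OF M] H_mem[OF M], of u w] cc_DF[OF y T(1)] cc_DF[OF y T(2)]
    by (simp add: chart_metric_def inv_F[OF y] Let_def)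
qed

lemma smooth_metric_op_F: "smooth_on (U \<inter> M) (\<lambda>y. metric_op b (F y))"
  and d_metric_op_F: "\<xi> \<in> TM A x \<Longrightarrow> dirD (U \<inter> M) (\<lambda>y. metric_op b (F y)) x \<xi> = bderiv (metric_op b) (F x) (DF x \<xi>)"
proof -
  have 1: "smooth_on (U \<inter> M) F" by (rule Cinf_on_imp_smooth_on[OF openU CF]) blast
  have 2: "smooth_on (cimg b) (metric_op b)"
    by (rule Cinf_on_imp_smooth_on[OF open_cimg[OF b] Cinf_metric_op[OF b]]) blast
  have 3: "F ` (U \<inter> M) \<subseteq> cimg b" using F_img by blast
  show "smooth_on (U \<inter> M) (\<lambda>y. metric_op b (F y))" by (rule smooth_on_compose[OF 1 2 3])
  assume \<xi>: "\<xi> \<in> TM A x"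
  have "dirD (U \<inter> M) F x \<xi> = DF x \<xi>" by (rule dirD_ext[OF openU xU CF _ tsU[OF \<xi>]]) simp
  then show "dirD (U \<inter> M) (\<lambda>y. metric_op b (F y)) x \<xi> = bderiv (metric_op b) (F x) (DF x \<xi>)"
    using dirD_compose[OF 1 2 3 tsU[OF \<xi>]] bderiv_apply[OF Cinf_metric_op[OF b] F_img[OF xUM]]
    by (simp add: dirD_open[OF open_cimg[OF b] F_img[OF xUM]])
qed

lemma Fx: "F x = chart (base A) b b" using F_eq[OF xUM] bq by simp

text \<open>Both sides of \<open>metric_pullback\<close> are differentiated along \<open>\<xi>\<close>. Derivatives of \<open>H\<close> do not contribute on the
  total space because they take horizontal vectors to the kernel of \<open>H\<close>.\<close>

lemma connection_metric_identity:
  assumes "\<xi> \<in> HM_fib A x" "u \<in> HM_fib A x" "w \<in> HM_fib A x"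
  shows "gb (L \<xi> u + GB (DF x \<xi>) (DF x u)) (DF x w) + gb (DF x u) (L \<xi> w + GB (DF x \<xi>) (DF x w))
    = \<Gamma> x \<xi> u \<bullet> g x w + u \<bullet> g x (\<Gamma> x \<xi> w)"
proof -
  note T = H_T[OF assms(1)] H_T[OF assms(2)] H_T[OF assms(3)]
  note t = tsU[OF T(1)]
  have smL: "smooth_on (U \<inter> M) (\<lambda>y. DF y (H y u))" for u
    by (rule smooth_on_blinfun_apply[OF smooth_DF smooth_restrict[OF smooth_field[OF smooth_H]]])
  have smH: "smooth_on M (\<lambda>y. H y u)" for u by (rule smooth_field[OF smooth_H])
  have m: "u \<bullet> metric_op b (F x) w = gb u w" for u w
    using inner_metric_op[OF b F_img[OF xUM]] chart_metric_center[OF b] Fx by simp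
  have "dirD (U \<inter> M) (\<lambda>y. DF y (H y u) \<bullet> metric_op b (F y) (DF y (H y w))) x \<xi> =
     DF x (H x u) \<bullet> (metric_op b (F x) (L \<xi> w) + bderiv (metric_op b) (F x) (DF x \<xi>) (DF x (H x w)))
      + L \<xi> u \<bullet> metric_op b (F x) (DF x (H x w))"
    using dirD_inner[OF smL[of u] smooth_on_blinfun_apply[OF smooth_metric_op_F smL[of w]] t]
      dirD_blinfun_apply[OF smooth_metric_op_F smL[of w] t]
    by (simp add: d_metric_op_F[OF T(1)] dDFH[OF T(1) assms(2)] dDFH[OF T(1) assms(3)])
  also have "\<dots> = gb (L \<xi> u + GB (DF x \<xi>) (DF x u)) (DF x w) + gb (DF x u) (L \<xi> w + GB (DF x \<xi>) (DF x w))"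
    using metric_op_derivative[OF b] H_fix[OF x assms(2)] H_fix[OF x assms(3)]
    by (simp add: m inner_add_right Fx[symmetric] linear_add[OF gb_lin(1)] linear_add[OF gb_lin(2)])
  finally have 1: "dirD (U \<inter> M) (\<lambda>y. DF y (H y u) \<bullet> metric_op b (F y) (DF y (H y w))) x \<xi> = \<dots>" .
  have e: "dirD (U \<inter> M) (\<lambda>y. DF y (H y u) \<bullet> metric_op b (F y) (DF y (H y w))) x = dirD (U \<inter> M) (\<lambda>y. H y u \<bullet> g y (H y w)) x"
    by (rule dirD_cong[OF metric_pullback xUM])
  have "dirD (U \<inter> M) (\<lambda>y. DF y (H y u) \<bullet> metric_op b (F y) (DF y (H y w))) x \<xi> = dirD M (\<lambda>y. H y u \<bullet> g y (H y w)) x \<xi>"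
    unfolding e by (rule fun_cong[OF dirD_localize[OF openU xU]])
  also have "\<dots> = H x u \<bullet> (g x (DH A x \<xi> w) + dirD M g x \<xi> (H x w)) + DH A x \<xi> u \<bullet> g x (H x w)"
    using dirD_inner[OF smH[of u] smooth_on_blinfun_apply[OF smooth_g smH[of w]] T(1)[unfolded TM_def]]
      dirD_blinfun_apply[OF smooth_g smH[of w] T(1)[unfolded TM_def]]
      dirD_blinfun_apply_const[OF smooth_H T(1)[unfolded TM_def]] by simp
  also have "\<dots> = u \<bullet> dirD M g x \<xi> w"
  proof -
    have "DH A x \<xi> u \<bullet> g x (H x w) = 0" using H_sa[OF x, of "DH A x \<xi> u" w] H_dH[OF T(1) assms(2)] by simp
    moreover have "H x u \<bullet> g x (DH A x \<xi> w) = 0"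
      using H_sa[OF x, of "DH A x \<xi> w" u] H_dH[OF T(1) assms(3)] pos_def_op_sym[OF pd[OF x]] by (metis inner_zero_left)
    ultimately show ?thesis using H_fix[OF x assms(2)] H_fix[OF x assms(3)] by (simp add: inner_add_right)
  qed
  also have "\<dots> = \<Gamma> x \<xi> u \<bullet> g x w + u \<bullet> g x (\<Gamma> x \<xi> w)" by (rule metric_compat[OF T])
  finally show ?thesis using 1 by simp
qed

lemma DF_H_onto: "\<exists>w\<in>HM_fib A x. DF x w = c"
proof -
  obtain u where u: "u \<in> TM A x" "ed x u = c" using surj[OF x] unfolding TM_def by (metis UNIV_I imageE)
  then show ?thesis using DF_H[OF xUM u(1)] DFx[OF u(1)] H_mem[OF x] by metis
qed

text \<open>The difference \<open>S\<close> of both sides is symmetric since both connections are torsion free. Since both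
  are metric, the trilinear form \<open>a\<close> is skew in its last two arguments. A trilinear form that
  is symmetric in the first two and skew in the last two arguments vanishes.\<close>

lemma connection_relation:
  assumes "\<xi> \<in> HM_fib A x" "u \<in> HM_fib A x"
  shows "L \<xi> u + GB (DF x \<xi>) (DF x u) = DF x (H x (\<Gamma> x \<xi> u))"
proof -
  define S where "S \<xi> u = L \<xi> u + GB (DF x \<xi>) (DF x u) - DF x (H x (\<Gamma> x \<xi> u))" for \<xi> u
  define a where "a \<xi> u w = gb (S \<xi> u) (DF x w)" for \<xi> u w
  have Ssym: "S \<xi> u = S u \<xi>" if "\<xi> \<in> HM_fib A x" "u \<in> HM_fib A x" for \<xi> u
    using L_sym[OF that] C_symmetric[OF b] Gamma_sym[OF H_T[OF that(1)] H_T[OF that(2)]] by (simp add: S_def)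
  have skew: "a \<xi> u w = - a \<xi> w u" if "\<xi> \<in> HM_fib A x" "u \<in> HM_fib A x" "w \<in> HM_fib A x" for \<xi> u w
  proof -
    have l: "gb (DF x (H x z)) (DF x w) = z \<bullet> g x w" if "w \<in> HM_fib A x" for z w
      using isom_DF[OF H_mem[OF x] that] H_sa[OF x, of z w] H_fix[OF x that] by simp
    have "gb (DF x u) (S \<xi> w) = gb (DF x u) (L \<xi> w + GB (DF x \<xi>) (DF x w)) - gb (DF x (H x (\<Gamma> x \<xi> w))) (DF x u)"
      unfolding S_def using gb_sym linear_diff[OF gb_lin(2)] by metis
    moreover have "gb (S \<xi> u) (DF x w) = gb (L \<xi> u + GB (DF x \<xi>) (DF x u)) (DF x w) - gb (DF x (H x (\<Gamma> x \<xi> u))) (DF x w)"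
      unfolding S_def using linear_diff[OF gb_lin(1)] by metis
    ultimately have "gb (S \<xi> u) (DF x w) + gb (DF x u) (S \<xi> w) = 0"
      using connection_metric_identity[OF that] l[OF that(2)] l[OF that(3)] pos_def_op_sym[OF pd[OF x], of u "\<Gamma> x \<xi> w"] by simp
    then show ?thesis unfolding a_def using gb_sym[of "DF x u"] by simp
  qed
  have "a \<xi> u w = 0" if "\<xi> \<in> HM_fib A x" "u \<in> HM_fib A x" "w \<in> HM_fib A x" for \<xi> u w
  proof -
    have s: "a \<xi> u w = a u \<xi> w" "a u w \<xi> = a w u \<xi>" "a w \<xi> u = a \<xi> w u" using Ssym that by (simp_all add: a_def)
    show ?thesis using s skew[OF that] skew[OF that(2,1,3)] skew[OF that(3,2,1)] skew[OF that(2,3,1)] by linarith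
  qed
  moreover obtain w where "w \<in> HM_fib A x" "DF x w = S \<xi> u" using DF_H_onto by blast
  ultimately have "gb (S \<xi> u) (S \<xi> u) = 0" using assms unfolding a_def by metis
  then show ?thesis using gb_zero unfolding S_def by force
qed

text \<open>The arguments of the connection map are the components of the differential of \<open>dq A\<close> on
  \<open>(\<Delta>m, \<Delta>t)\<close>. The horizontal part of \<open>\<Delta>m\<close> is treated by
  \<open>connection_relation\<close>; for the vertical part the Christoffel term vanishes and \<open>L_vert\<close> applies.\<close>

lemma connection_map_identity:
  assumes v: "v \<in> HM_fib A x" and m: "\<Delta>m \<in> TM A x" and t: "DH A x \<Delta>m v + H x \<Delta>t = \<Delta>t"
  shows "C (b, DF x v) (DF x \<Delta>m, D2 \<Delta>m v + DF x \<Delta>t)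
    = DF x (H x \<Delta>t + H x (\<Gamma> x (H x \<Delta>m) v) + DH A x v (V x \<Delta>m))"
proof -
  let ?h = "H x \<Delta>m" and ?e = "V x \<Delta>m"
  have hv: "?h \<in> HM_fib A x" "?e \<in> VM A x" using H_mem[OF x] V_mem[OF x] by auto
  have dec: "\<Delta>m = ?h + ?e" by (rule T_decomp[OF m])
  have "D2 \<Delta>m v = D2 ?h v + D2 ?e v"
    using arg_cong[OF dec, of "\<lambda>z. D2 z v"] unfolding blinfun.add_right blinfun.add_left .
  moreover have "DH A x \<Delta>m v = DH A x ?h v + DH A x ?e v"
    using arg_cong[OF dec, of "\<lambda>z. DH A x z v"] unfolding linear_add[OF lin_dH[OF x]] blinfun.add_left .
  moreover have "DF x \<Delta>t = DF x (DH A x \<Delta>m v) + DF x (H x \<Delta>t)" 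
    using arg_cong[OF t[symmetric], of "blinfun_apply (DF x)"] unfolding blinfun.add_right .
  ultimately have e1: "D2 \<Delta>m v + DF x \<Delta>t = L ?h v + L ?e v + DF x (H x \<Delta>t)"
    by (simp add: L_def blinfun.add_right)
  have e2: "DF x \<Delta>m = DF x ?h" using DF_H[OF xUM m] by simp
  have "C (b, DF x v) (DF x \<Delta>m, D2 \<Delta>m v + DF x \<Delta>t)
     = L ?h v + L ?e v + DF x (H x \<Delta>t) + GB (DF x ?h) (DF x v)"
    unfolding e1 e2 by (rule C_split[OF b])
  also have "\<dots> = DF x (H x \<Delta>t) + DF x (H x (\<Gamma> x ?h v)) + DF x (DH A x v ?e)"
    using connection_relation[OF hv(1) v] L_vert[OF hv(2) v] by (simp add: algebra_simps)
  finally show ?thesis by (simp add: blinfun.add_right)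
qed

end

section \<open>Block operators\<close>

lemma block_apply: "block a b c d z = (a (fst z) + b (snd z), c (fst z) + d (snd z))"
proof -
  have "bounded_linear (\<lambda>(u, w). (a u + b w, c u + d w))"
    unfolding case_prod_beta
    by (intro bounded_linear_Pair bounded_linear_add bounded_linear_compose[OF blinfun.bounded_linear_right]
        bounded_linear_fst bounded_linear_snd)
  then show ?thesis unfolding block_def by (simp add: bounded_linear_Blinfun_apply case_prod_beta)
qed

lemma smooth_on_block:
  assumes "smooth_on N a" "smooth_on N b" "smooth_on N c" "smooth_on N d"
  shows "smooth_on N (\<lambda>p. block (a p) (b p) (c p) (d p))"
  unfolding block_def
proof (rule smooth_on_Blinfun)
  show "linear (\<lambda>(u, w). (a p u + b p w, c p u + d p w))" for p
    by (auto simp: linear_iff blinfun.add_right blinfun.scaleR_right algebra_simps)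
  fix z :: "'b \<times> 'b"
  have "smooth_on N (\<lambda>p. (a p (fst z) + b p (snd z), c p (fst z) + d p (snd z)))"
    by (intro smooth_on_Pair smooth_on_add smooth_on_blinfun_apply smooth_on_const assms)
  then show "smooth_on N (\<lambda>p. case z of (u, w) \<Rightarrow> (a p u + b p w, c p u + d p w))"
    by (simp add: case_prod_beta)
qed

lemma linear_blinfun: "linear (blinfun_apply T)"
  by (rule bounded_linear.linear[OF blinfun.bounded_linear_right])

lemma op_adjoint_inner: "u \<bullet> op_adjoint T w = T u \<bullet> w"
proof -
  have "bounded_linear (adjoint (blinfun_apply T))"
    using adjoint_linear[OF linear_blinfun] linear_conv_bounded_linear by blast
  then show ?thesis
    unfolding op_adjoint_def by (simp add: bounded_linear_Blinfun_apply adjoint_works[OF linear_blinfun])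
qed

lemma smooth_on_op_adjoint:
  assumes "smooth_on N T"
  shows "smooth_on N (\<lambda>p. op_adjoint (T p))"
  unfolding op_adjoint_def
proof (rule smooth_on_Blinfun)
  show "linear (adjoint (blinfun_apply (T p)))" for p by (rule adjoint_linear[OF linear_blinfun])
  fix w
  have "adjoint (blinfun_apply (T p)) w = (\<Sum>i\<in>Basis. (T p i \<bullet> w) *\<^sub>R i)" for p
    by (subst euclidean_representation[symmetric])
      (simp add: inner_commute adjoint_works[OF linear_blinfun])
  moreover have "smooth_on N (\<lambda>p. \<Sum>i\<in>Basis. (T p i \<bullet> w) *\<^sub>R i)"
    by (intro smooth_on_sum smooth_on_scaleR smooth_on_inner smooth_on_blinfun_apply assms smooth_on_const)
  ultimately show "smooth_on N (\<lambda>p. adjoint (blinfun_apply (T p)) w)" by simp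
qed

lemma G_Q_inner:
  "\<Delta> \<bullet> G_Q A \<Gamma> B ghat p \<Delta>' = fst \<Delta> \<bullet> met A (fst p) (fst \<Delta>')
     + (snd \<Delta> + GammaQ A \<Gamma> B p (fst \<Delta>)) \<bullet> ghat p (snd \<Delta>' + GammaQ A \<Gamma> B p (fst \<Delta>'))"
  by (simp add: G_Q_def block_apply inner_prod_def op_adjoint_inner inner_add_left inner_add_right
      blinfun.add_right add.commute)

lemma smooth_on_G_Q:
  assumes "smooth_on N (\<lambda>p. met A (fst p))" "smooth_on N ghat" "smooth_on N (GammaQ A \<Gamma> B)"
  shows "smooth_on N (G_Q A \<Gamma> B ghat)"
  unfolding G_Q_def[abs_def]
  by (intro smooth_on_blinfun_compose smooth_on_block smooth_on_op_adjoint smooth_on_const assms)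

lemma pos_def_G_Q:
  assumes "pos_def_op (met A (fst p))" "pos_def_op (ghat p)"
  shows "pos_def_op (G_Q A \<Gamma> B ghat p)"
  unfolding pos_def_op_def
proof (intro conjI allI impI)
  fix u w
  show "u \<bullet> G_Q A \<Gamma> B ghat p w = G_Q A \<Gamma> B ghat p u \<bullet> w"
    unfolding inner_commute[of "G_Q A \<Gamma> B ghat p u"] G_Q_inner
    using pos_def_op_sym[OF assms(1)] pos_def_op_sym[OF assms(2)] by metis
next
  fix u :: "'a \<times> 'a" assume u: "u \<noteq> 0"
  have nn: "0 \<le> z \<bullet> T z" if "pos_def_op T" for T :: "'a \<Rightarrow>\<^sub>L 'a" and z
    using that unfolding pos_def_op_def by (cases "z = 0") (auto intro: less_imp_le)
  show "0 < u \<bullet> G_Q A \<Gamma> B ghat p u"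
  proof (cases "fst u = 0")
    case True
    then have "snd u \<noteq> 0" using u by (simp add: prod_eq_iff)
    then have "0 < snd u \<bullet> ghat p (snd u)" using assms(2) unfolding pos_def_op_def by blast
    then show ?thesis using True unfolding G_Q_inner by (simp add: blinfun.zero_right)
  next
    case False
    then have "0 < fst u \<bullet> met A (fst p) (fst u)" using assms(1) unfolding pos_def_op_def by blast
    then show ?thesis unfolding G_Q_inner using nn[OF assms(2)] by (simp add: add_pos_nonneg)
  qed
qed

section \<open>The horizontal bundle as an embedded manifold\<close>

lemma near_identity_invertible:
  fixes K :: "'b::euclidean_space \<Rightarrow>\<^sub>L 'b"
  assumes "norm (K - id_blinfun) < 1"
  shows "\<exists>R. R o\<^sub>L K = id_blinfun \<and> K o\<^sub>L R = id_blinfun"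
proof -
  have "inj K"
  proof (rule linear_injective_0[OF linear_blinfun, THEN iffD2], intro allI impI)
    fix y assume y: "K y = 0"
    show "y = 0"
    proof (rule ccontr)
      assume "y \<noteq> 0"
      have "norm y = norm ((K - id_blinfun) y)" using y by (simp add: blinfun.diff_left)
      also have "\<dots> \<le> norm (K - id_blinfun) * norm y" by (rule norm_blinfun)
      also have "\<dots> < 1 * norm y" using assms \<open>y \<noteq> 0\<close> by (intro mult_strict_right_mono) auto
      finally show False by simp
    qed
  qed
  then obtain L where L: "linear L" "\<forall>y. L (K y) = y" "\<forall>y. K (L y) = y"
    using linear_injective_isomorphism[OF linear_blinfun] by blast
  then have "Blinfun L o\<^sub>L K = id_blinfun \<and> K o\<^sub>L Blinfun L = id_blinfun"
    by (auto intro!: blinfun_eqI simp: bounded_linear_Blinfun_apply linear_conv_bounded_linear)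
  then show ?thesis by blast
qed

context submersed begin

lemma dim_HM_fib:
  assumes "x \<in> M"
  shows "dim (HM_fib A x) = DIM('e)"
proof -
  have "inj_on (ed x) (HM_fib A x)"
  proof (rule linear_inj_on_iff_eq_0[OF lin_ed[OF assms] sub_H[OF assms], THEN iffD2], intro ballI impI)
    fix u assume "u \<in> HM_fib A x" "ed x u = 0"
    then show "u = 0" using H_T HV0[OF assms, of u] H_fix[OF assms, of u] VM_iff by metis
  qed
  moreover have "ed x ` HM_fib A x = UNIV"
  proof (rule antisym[OF subset_UNIV], rule subsetI)
    fix c :: 'e
    obtain u where u: "u \<in> TM A x" "ed x u = c" using surj[OF assms] unfolding TM_def by (metis UNIV_I imageE)
    have "ed x u = ed x (H x u) + ed x (V x u)" using T_decomp[OF u(1)] linear_add[OF lin_ed[OF assms]] by metis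
    then have "ed x (H x u) = c" using u(2) V_mem[OF assms, of u] VM_iff by simp
    then show "c \<in> ed x ` HM_fib A x" using H_mem[OF assms] by blast
  qed
  ultimately show ?thesis
    using dim_image_eq[OF lin_ed[OF assms], of "HM_fib A x"] sub_H[OF assms]
    by (simp add: span_eq_iff[THEN iffD2])
qed

text \<open>A slice chart of the manifold at \<open>x\<close> is combined with the operators \<open>K y = H x H y + (1 - H x) (1 - H y)\<close>.
  They are close to the identity near \<open>x\<close>, hence invertible, and \<open>H x (K y w) = K y (H y w)\<close> shows that \<open>K y\<close>
  takes the horizontal space at \<open>y\<close> to the one at \<open>x\<close>.\<close>

lemma embedded_HM: "embedded_submanifold (HM A)"
proof -
  obtain k where k: "\<forall>x\<in>M. \<exists>U V (\<phi> :: 'a \<Rightarrow> 'a) \<psi> S.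
        open U \<and> x \<in> U \<and> open V \<and> homeomorphism U V \<phi> \<psi> \<and> Cinf_on U \<phi> \<and> Cinf_on V \<psi> \<and>
        subspace S \<and> dim S = k \<and> \<phi> ` (U \<inter> M) = V \<inter> S"
    using emb unfolding embedded_submanifold_def by (rule exE)
  show ?thesis
    unfolding embedded_submanifold_def
  proof (intro exI[of _ "k + DIM('e)"] ballI)
    fix p assume p: "p \<in> HM A"
    obtain x v where pe: "p = (x, v)" by force
    have x: "x \<in> M" using p HM_iff pe by blast
    from bspec[OF k x] obtain U V and \<phi> \<psi> :: "'a \<Rightarrow> 'a" and S where c: "open U" "x \<in> U" "open V"
      "homeomorphism U V \<phi> \<psi>" "Cinf_on U \<phi>" "Cinf_on V \<psi>" "subspace S" "dim S = k" "\<phi> ` (U \<inter> M) = V \<inter> S"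
      by (elim exE conjE) (rule that)
    have inv: "\<And>y. y \<in> U \<Longrightarrow> \<psi> (\<phi> y) = y" "\<And>z. z \<in> V \<Longrightarrow> \<phi> (\<psi> z) = z" "\<phi> ` U = V" "\<psi> ` V = U"
      using c(4) by (auto simp: homeomorphism_def)
    obtain U1 Hx where U1: "open U1" "x \<in> U1" "Cinf_on U1 Hx" "\<forall>y\<in>U1 \<inter> M. Hx y = H y"
      using smooth_on_extE[OF smooth_H x] .
    define K where "K y = (H x o\<^sub>L Hx y) + ((id_blinfun - H x) o\<^sub>L (id_blinfun - Hx y))" for y
    have CK: "Cinf_on U1 K" unfolding K_def
      by (intro Cinf_on_add[OF U1(1)] Cinf_on_blinfun_compose[OF U1(1)] Cinf_on_const Cinf_on_diff[OF U1(1)] U1(3))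
    have HH: "H y (H y w) = H y w" if "y \<in> M" for y w using H_fix[OF that H_mem[OF that]] .
    have Kx: "K x = id_blinfun"
      using U1(2,4) x by (intro blinfun_eqI)
        (simp add: K_def blinfun.add_left blinfun.diff_left blinfun.diff_right HH)
    define U2 where "U2 = U \<inter> (U1 \<inter> K -` ball id_blinfun 1)"
    have o2: "open U2" unfolding U2_def
      by (intro open_Int c(1) continuous_open_preimage[OF Cinf_on_continuous_on[OF CK] U1(1) open_ball])
    have x2: "x \<in> U2" unfolding U2_def using c(2) U1(2) Kx by simp
    have U2U: "U2 \<subseteq> U" "U2 \<subseteq> U1" unfolding U2_def by auto
    have "\<forall>y\<in>U2. \<exists>R. R o\<^sub>L K y = id_blinfun \<and> K y o\<^sub>L R = id_blinfun"
      by (intro ballI near_identity_invertible) (auto simp: U2_def dist_norm norm_minus_commute)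
    then obtain R where R: "\<forall>y\<in>U2. R y o\<^sub>L K y = id_blinfun \<and> K y o\<^sub>L R y = id_blinfun"
      by (rule bchoice[THEN exE])
    have RK: "R y (K y w) = w" "K y (R y w) = w" if "y \<in> U2" for y w
      using bspec[OF R that] by (metis blinfun_apply_blinfun_compose blinfun_apply_id_blinfun)+
    have CR: "Cinf_on U2 R"
      by (rule Cinf_on_operator_inverse[OF o2 Cinf_on_subset[OF CK U2U(2)]]) (use R in blast)+
    define V2 where "V2 = V \<inter> \<psi> -` U2"
    have oV2: "open V2" unfolding V2_def
      by (rule continuous_open_preimage[OF Cinf_on_continuous_on[OF c(6)] c(3) o2])
    have V2: "\<phi> ` U2 = V2" "\<psi> ` V2 = U2" "V2 \<subseteq> V"
    proof -
      show "\<phi> ` U2 = V2" unfolding V2_def using U2U inv by (auto intro!: image_eqI)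
      then show "\<psi> ` V2 = U2" using U2U inv(1) by (metis (no_types, lifting) image_image image_cong image_ident subsetD)
      show "V2 \<subseteq> V" unfolding V2_def by blast
    qed
    have ow: "open (U2 \<times> (UNIV::'a set))" "open (V2 \<times> (UNIV::'a set))" using o2 oV2 by (auto intro: open_Times)
    define \<Phi> where "\<Phi> z = (\<phi> (fst z), K (fst z) (snd z))" for z
    define \<Psi> where "\<Psi> z = (\<psi> (fst z), R (\<psi> (fst z)) (snd z))" for z
    have C\<Phi>: "Cinf_on (U2 \<times> UNIV) \<Phi>" unfolding \<Phi>_def
    proof (intro Cinf_on_Pair[OF ow(1)] Cinf_on_blinfun_apply[OF ow(1)] Cinf_on_snd)
      show "Cinf_on (U2 \<times> (UNIV::'a set)) (\<lambda>z. \<phi> (fst z))"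
        by (rule Cinf_on_compose[OF ow(1) c(1) _ Cinf_on_fst c(5)]) (use U2U in auto)
      show "Cinf_on (U2 \<times> (UNIV::'a set)) (\<lambda>z. K (fst z))"
        by (rule Cinf_on_compose[OF ow(1) U1(1) _ Cinf_on_fst CK]) (use U2U in auto)
    qed
    have C\<psi>: "Cinf_on (V2 \<times> (UNIV::'a set)) (\<lambda>z. \<psi> (fst z))"
      by (rule Cinf_on_compose[OF ow(2) c(3) _ Cinf_on_fst c(6)]) (use V2 in auto)
    have C\<Psi>: "Cinf_on (V2 \<times> UNIV) \<Psi>" unfolding \<Psi>_def
    proof (intro Cinf_on_Pair[OF ow(2)] Cinf_on_blinfun_apply[OF ow(2)] Cinf_on_snd C\<psi>)
      show "Cinf_on (V2 \<times> (UNIV::'a set)) (\<lambda>z. R (\<psi> (fst z)))"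
        by (rule Cinf_on_compose[OF ow(2) o2 _ C\<psi> CR]) (use V2 in auto)
    qed
    have \<Psi>\<Phi>: "\<Psi> (\<Phi> z) = z" if "z \<in> U2 \<times> UNIV" for z
      using that inv(1)[of "fst z"] RK(1)[of "fst z"] U2U by (auto simp: \<Phi>_def \<Psi>_def)
    have \<Phi>\<Psi>: "\<Phi> (\<Psi> z) = z" if "z \<in> V2 \<times> UNIV" for z
    proof -
      have "fst z \<in> V" "\<psi> (fst z) \<in> U2" using that V2 by auto
      then show ?thesis using inv(2)[of "fst z"] RK(2)[of "\<psi> (fst z)"] by (simp add: \<Phi>_def \<Psi>_def)
    qed
    have im: "\<Phi> ` (U2 \<times> UNIV) = V2 \<times> UNIV" "\<Psi> ` (V2 \<times> UNIV) = U2 \<times> UNIV"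
    proof -
      have a: "\<Phi> ` (U2 \<times> UNIV) \<subseteq> V2 \<times> UNIV" using V2 by (auto simp: \<Phi>_def)
      have b: "\<Psi> ` (V2 \<times> UNIV) \<subseteq> U2 \<times> UNIV" using V2 by (auto simp: \<Psi>_def)
      show "\<Phi> ` (U2 \<times> UNIV) = V2 \<times> UNIV"
      proof (rule antisym[OF a], rule subsetI)
        fix z assume z: "z \<in> V2 \<times> (UNIV::'a set)"
        then have "\<Psi> z \<in> U2 \<times> UNIV" using b by blast
        then show "z \<in> \<Phi> ` (U2 \<times> UNIV)" using \<Phi>\<Psi>[OF z] by (metis imageI)
      qed
      show "\<Psi> ` (V2 \<times> UNIV) = U2 \<times> UNIV"
      proof (rule antisym[OF b], rule subsetI)
        fix z assume z: "z \<in> U2 \<times> (UNIV::'a set)"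
        then have "\<Phi> z \<in> V2 \<times> UNIV" using a by blast
        then show "z \<in> \<Psi> ` (V2 \<times> UNIV)" using \<Psi>\<Phi>[OF z] by (metis imageI)
      qed
    qed
    have hom: "homeomorphism (U2 \<times> UNIV) (V2 \<times> UNIV) \<Phi> \<Psi>"
      unfolding homeomorphism_def using im \<Psi>\<Phi> \<Phi>\<Psi> Cinf_on_continuous_on[OF C\<Phi>] Cinf_on_continuous_on[OF C\<Psi>] by blast
    let ?S = "S \<times> HM_fib A x"
    have slice: "\<Phi> ` ((U2 \<times> UNIV) \<inter> HM A) = (V2 \<times> UNIV) \<inter> ?S"
    proof
      show "\<Phi> ` ((U2 \<times> UNIV) \<inter> HM A) \<subseteq> (V2 \<times> UNIV) \<inter> ?S"
      proof (rule image_subsetI)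
        fix p assume "p \<in> (U2 \<times> UNIV) \<inter> HM A"
        then obtain y w where pyw: "p = (y, w)" and y: "y \<in> U2" "(y, w) \<in> HM A" by auto
        then have yM: "y \<in> M" "H y w = w" using HM_iff H_fix by auto
        have "Hx y = H y" using U1(4) U2U y yM by blast
        then have "K y w = H x w" by (simp add: K_def blinfun.add_left blinfun.diff_left yM(2) blinfun.zero_right)
        then show "\<Phi> p \<in> (V2 \<times> UNIV) \<inter> ?S"
          unfolding pyw using y yM V2(1) c(9) U2U H_mem[OF x] by (auto simp: \<Phi>_def)
      qed
      show "(V2 \<times> UNIV) \<inter> ?S \<subseteq> \<Phi> ` ((U2 \<times> UNIV) \<inter> HM A)"
      proof (rule subsetI)
        fix p assume "p \<in> (V2 \<times> UNIV) \<inter> ?S"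
        then obtain z h where pzh: "p = (z, h)" and z: "z \<in> V2" "z \<in> S" "h \<in> HM_fib A x" by auto
        define y where "y = \<psi> z"
        have y: "y \<in> U2" using z V2 unfolding y_def by blast
        have "z \<in> \<phi> ` (U \<inter> M)" using c(9) z V2 by blast
        then have yM: "y \<in> M" unfolding y_def using inv(1) by auto
        have Hy: "Hx y = H y" using U1(4) U2U y yM by blast
        define w where "w = R y h"
        have Kw: "K y w = h" unfolding w_def by (rule RK(2)[OF y])
        have "h = H x (K y w)" using Kw H_fix[OF x z(3)] by simp
        also have "\<dots> = H x (H y w)"
          by (simp add: K_def Hy blinfun.add_left blinfun.add_right blinfun.diff_left blinfun.diff_right HH[OF x])
        also have "\<dots> = K y (H y w)"
          by (simp add: K_def Hy blinfun.add_left blinfun.diff_left HH[OF yM] blinfun.zero_right)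
        finally have "R y h = R y (K y (H y w))" by simp
        then have "H y w = w" using RK(1)[OF y] unfolding w_def by simp
        then have "(y, w) \<in> HM A" using yM HM_iff H_iff by blast
        moreover have "\<Phi> (y, w) = (z, h)" using Kw inv(2) z V2 by (auto simp: \<Phi>_def y_def)
        ultimately show "p \<in> \<Phi> ` ((U2 \<times> UNIV) \<inter> HM A)"
          unfolding pzh using y by (metis IntI SigmaI UNIV_I imageI)
      qed
    qed
    have "subspace ?S" by (rule subspace_Times[OF c(7) sub_H[OF x]])
    moreover have "dim ?S = k + DIM('e)" using dim_Times[OF c(7) sub_H[OF x]] c(8) dim_HM_fib[OF x] by simp
    moreover have "p \<in> U2 \<times> UNIV" using x2 pe by simp
    ultimately show "\<exists>U V (\<phi> :: 'a \<times> 'a \<Rightarrow> 'a \<times> 'a) \<psi> S. open U \<and> p \<in> U \<and> open V \<and> homeomorphism U V \<phi> \<psi> \<and>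
        Cinf_on U \<phi> \<and> Cinf_on V \<psi> \<and> subspace S \<and> dim S = k + DIM('e) \<and> \<phi> ` (U \<inter> HM A) = V \<inter> S"
      using ow hom C\<Phi> C\<Psi> slice by (intro exI conjI)
  qed
qed

lemma fst_HM: "fst ` HM A \<subseteq> M" by (auto simp: HM_iff)

lemma smooth_fst_comp: "smooth_on M f \<Longrightarrow> smooth_on (HM A) (\<lambda>p. f (fst p))"
  by (rule smooth_on_compose[OF smooth_on_fst _ fst_HM])

lemma dirD_fst_comp:
  assumes "smooth_on M f" "u \<in> THM A p"
  shows "dirD (HM A) (\<lambda>p. f (fst p)) p u = dirD M f (fst p) (fst u)"
proof -
  have u: "u \<in> tangent_space (HM A) p" using assms(2) by (simp add: THM_def)
  have "dirD (HM A) fst p u = fst u"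
    by (rule dirD_eqI[OF bounded_linear_imp_has_derivative[OF bounded_linear_fst] u])
  then show ?thesis using dirD_compose[OF smooth_on_fst assms(1) fst_HM u] by simp
qed

text \<open>The equation \<open>H y w = w\<close> that defines the bundle is differentiated. Conversely, if \<open>k\<close> is a curve with velocity \<open>a\<close>, then
  \<open>t \<mapsto> (k t, H (k t) (v + t c))\<close> is a curve in the bundle with velocity \<open>(a, c)\<close>.\<close>

lemma THM_iff:
  assumes p: "(x, v) \<in> HM A"
  shows "(a, c) \<in> THM A (x, v) \<longleftrightarrow> a \<in> TM A x \<and> DH A x a v + H x c = c"
proof
  assume t: "(a, c) \<in> THM A (x, v)"
  then have t': "(a, c) \<in> tangent_space (HM A) (x, v)" by (simp add: THM_def)
  have fsta: "dirD (HM A) fst (x, v) (a, c) = a"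
    using dirD_eqI[OF bounded_linear_imp_has_derivative[OF bounded_linear_fst] t'] by simp
  have sndc: "dirD (HM A) snd (x, v) (a, c) = c"
    using dirD_eqI[OF bounded_linear_imp_has_derivative[OF bounded_linear_snd] t'] by simp
  have "a \<in> TM A x"
    using tangent_space_image[OF smooth_on_fst fst_HM t'] fsta by (simp add: TM_def)
  moreover have "dirD (HM A) (\<lambda>p. H (fst p) (snd p)) (x, v) = dirD (HM A) snd (x, v)"
    by (rule dirD_cong[OF _ p]) (auto simp: HM_def)
  then have "H x c + DH A x a v = c"
    using dirD_blinfun_apply[OF smooth_fst_comp[OF smooth_H] smooth_on_snd t'] dirD_fst_comp[OF smooth_H t] sndc by simp
  ultimately show "a \<in> TM A x \<and> DH A x a v + H x c = c" by (simp add: add.commute)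
next
  assume "a \<in> TM A x \<and> DH A x a v + H x c = c"
  then have a: "a \<in> TM A x" and eq: "DH A x a v + H x c = c" by auto
  have x: "x \<in> M" and v: "H x v = v" using p by (auto simp: HM_def)
  obtain k e where k: "0 < e" "Cinf_on {-e<..<e} k" "\<forall>t\<in>{-e<..<e}. k t \<in> M" "k (0::real) = x"
    "(k has_vector_derivative a) (at 0)" using a[unfolded TM_def] by (rule tangent_spaceE)
  let ?I = "{-e<..<e}"
  have oI: "open ?I" by simp
  define h where "h t = (k t, H (k t) (v + t *\<^sub>R c))" for t
  have "smooth_on ?I (\<lambda>t. H (k t))"
    by (rule smooth_on_compose[OF Cinf_on_imp_smooth_on[OF oI k(2)] smooth_H]) (use k(3) in auto)
  then have CHk: "Cinf_on ?I (\<lambda>t. H (k t))" by (rule smooth_on_imp_Cinf_on[OF oI])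
  have "Cinf_on ?I (\<lambda>t. v + t *\<^sub>R c)"
    by (intro Cinf_on_add[OF oI] Cinf_on_const Cinf_on_bounded_linear[OF bounded_linear_scaleR_left])
  then have Ch: "Cinf_on ?I h" unfolding h_def
    by (intro Cinf_on_Pair[OF oI] k(2) Cinf_on_blinfun_apply[OF oI] CHk)
  have "((\<lambda>t. H (k t)) has_vector_derivative DH A x a) (at 0)"
    by (rule has_derivative_along_curve[OF smooth_on_has_derivative[OF smooth_H x] k(1,3,4,5)])
  moreover have "((\<lambda>t::real. v + t *\<^sub>R c) has_vector_derivative c) (at 0)"
    by (auto intro!: derivative_eq_intros)
  ultimately have "((\<lambda>t. H (k t) (v + t *\<^sub>R c)) has_vector_derivative H (k 0) c + DH A x a (v + 0 *\<^sub>R c)) (at 0)"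
    by (rule bounded_bilinear.has_vector_derivative[OF bounded_bilinear_blinfun_apply])
  then have "((\<lambda>t. H (k t) (v + t *\<^sub>R c)) has_vector_derivative c) (at 0)"
    using eq k(4) by (simp add: add.commute)
  then have "(h has_vector_derivative (a, c)) (at 0)"
    unfolding h_def by (rule has_vector_derivative_Pair[OF k(5)])
  moreover have "h t \<in> HM A" if "t \<in> ?I" for t
    using k(3) that H_mem by (auto simp: h_def HM_iff)
  moreover have "h 0 = (x, v)" using k(4) v by (simp add: h_def)
  ultimately show "(a, c) \<in> THM A (x, v)" unfolding THM_def by (intro tangent_spaceI[OF k(1) Ch])
qed

text \<open>On tangent vectors \<open>dirD\<close> is the derivative of a smooth local extension, which is smooth itself.\<close>

lemma smooth_on_dirD:
  assumes "smooth_on M K" "smooth_on M Y" "\<And>y. y \<in> M \<Longrightarrow> Y y \<in> TM A y"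
  shows "smooth_on M (\<lambda>y. dirD M K y (Y y))"
proof (rule smooth_on_local)
  fix x assume x: "x \<in> M"
  obtain U Kx where U: "open U" "x \<in> U" "Cinf_on U Kx" "\<forall>y\<in>U \<inter> M. Kx y = K y"
    using smooth_on_extE[OF assms(1) x] .
  have "smooth_on (U \<inter> M) (\<lambda>y. bderiv Kx y (Y y))"
    by (rule smooth_on_blinfun_apply[OF Cinf_on_imp_smooth_on[OF U(1) Cinf_on_bderiv[OF U(1,3)]] smooth_on_subset[OF assms(2)]]) auto
  then have "smooth_on (U \<inter> M) (\<lambda>y. dirD M K y (Y y))"
  proof (rule smooth_on_cong)
    fix y assume y: "y \<in> U \<inter> M"
    show "bderiv Kx y (Y y) = dirD M K y (Y y)"
      using y U(4) assms(3)[of y] unfolding TM_def by (intro dirD_ext[OF U(1) _ U(3), symmetric]) auto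
  qed
  then show "\<exists>U. open U \<and> x \<in> U \<and> smooth_on (U \<inter> M) (\<lambda>y. dirD M K y (Y y))" using U(1,2) by blast
qed

end

context submersed_christoffel begin

lemma linear_GammaQ_fun:
  assumes "p \<in> HM A"
  shows "linear (GammaQ_fun A \<Gamma> B p)"
proof -
  have x: "fst p \<in> M" using assms fst_HM by blast
  show ?thesis
    using linear_add[OF lin_dH[OF x]] linear_scale[OF lin_dH[OF x]] linear_add[OF lin_dP[OF x]] linear_scale[OF lin_dP[OF x]]
    by (simp add: linear_iff GammaQ_fun_def Gamma_H_def case_prod_beta blinfun.add_left blinfun.add_right
       blinfun.scaleR_left blinfun.scaleR_right algebra_simps)
qed

lemma bounded_linear_GammaQ_fun: "p \<in> HM A \<Longrightarrow> bounded_linear (GammaQ_fun A \<Gamma> B p)"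
  using linear_GammaQ_fun linear_conv_bounded_linear by blast

lemma GammaQ_apply: "p \<in> HM A \<Longrightarrow> blinfun_apply (GammaQ A \<Gamma> B p) = GammaQ_fun A \<Gamma> B p"
  unfolding GammaQ_def by (rule bounded_linear_Blinfun_apply[OF bounded_linear_GammaQ_fun])

lemma smooth_GammaQ:
  assumes "smooth_on M B"
  shows "smooth_on (HM A) (GammaQ A \<Gamma> B)"
  unfolding GammaQ_def[abs_def]
proof (rule smooth_on_Blinfun)
  show "linear (GammaQ_fun A \<Gamma> B p)" if "p \<in> HM A" for p by (rule linear_GammaQ_fun[OF that])
  fix w
  have Hw: "smooth_on M (\<lambda>y. H y w)" by (rule smooth_on_blinfun_apply[OF smooth_H smooth_on_const])
  have 1: "smooth_on (HM A) (\<lambda>p. DH A (fst p) (H (fst p) w))"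
    by (rule smooth_fst_comp[OF smooth_on_dirD[OF smooth_H Hw H_T[OF H_mem]]])
  have 2: "smooth_on (HM A) (\<lambda>p. DPi A (fst p) (H (fst p) w))"
    by (rule smooth_fst_comp[OF smooth_on_dirD[OF smooth_P Hw H_T[OF H_mem]]])
  have "smooth_on (HM A) (\<lambda>p. - DH A (fst p) (H (fst p) w) (snd p)
       + H (fst p) (DPi A (fst p) (H (fst p) w) (snd p) + \<Gamma> (fst p) (H (fst p) w) (snd p))
       - B (fst p) w (snd p))"
    by (intro smooth_on_diff smooth_on_add smooth_on_minus smooth_on_blinfun_apply 1 2 smooth_on_snd smooth_on_const
       smooth_fst_comp[OF smooth_H] smooth_fst_comp[OF smooth_Gamma] smooth_fst_comp[OF assms])
  then show "smooth_on (HM A) (\<lambda>p. GammaQ_fun A \<Gamma> B p w)"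
    by (simp add: GammaQ_fun_def Gamma_H_def case_prod_beta)
qed

text \<open>The terms with derivatives of \<open>H\<close> in \<open>\<Gamma>Q \<Delta>m\<close> cancel the non-horizontal part \<open>DH \<Delta>m v\<close> of \<open>\<Delta>t\<close>.\<close>

lemma shifted_vector:
  assumes "B_extension A B" "(x, v) \<in> HM A" "\<Delta>m \<in> TM A x" "DH A x \<Delta>m v + H x \<Delta>t = \<Delta>t"
  shows "\<Delta>t + GammaQ A \<Gamma> B (x, v) \<Delta>m = H x \<Delta>t + H x (\<Gamma> x (H x \<Delta>m) v) + DH A x v (V x \<Delta>m)"
    "\<Delta>t + GammaQ A \<Gamma> B (x, v) \<Delta>m \<in> HM_fib A x"
proof -
  have x: "x \<in> M" and v: "v \<in> HM_fib A x" using assms(2) by (auto simp: HM_iff)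
  have hT: "H x \<Delta>m \<in> TM A x" using H_T[OF H_mem[OF x]] .
  have "DH A x \<Delta>m v = DH A x (H x \<Delta>m) v + DH A x (V x \<Delta>m) v"
    using arg_cong[OF T_decomp[OF assms(3)], of "\<lambda>z. DH A x z v"]
    unfolding linear_add[OF lin_dH[OF x]] blinfun.add_left .
  moreover have "DH A x (V x \<Delta>m) v = B x \<Delta>m v + DH A x v (V x \<Delta>m)"
    using assms(1,3) x v unfolding B_extension_def by simp
  moreover have "H x (DPi A x (H x \<Delta>m) v) = 0" by (rule H_dP[OF hT H_T[OF v]])
  ultimately show e: "\<Delta>t + GammaQ A \<Gamma> B (x, v) \<Delta>m = H x \<Delta>t + H x (\<Gamma> x (H x \<Delta>m) v) + DH A x v (V x \<Delta>m)"
    using assms(4) by (simp add: GammaQ_apply[OF assms(2)] GammaQ_fun_def Gamma_H_def blinfun.add_right algebra_simps)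
  show "\<Delta>t + GammaQ A \<Gamma> B (x, v) \<Delta>m \<in> HM_fib A x"
    unfolding e by (intro subspace_add[OF sub_H[OF x]] H_mem[OF x] dH_vert[OF H_T[OF v] V_mem[OF x]])
qed

end

section \<open>The differential of the differential, and local sections\<close>

context chart_at begin

lemma dq_apply: "dq A (y, u) = (q y, ed y u)" by (simp add: dq_def tangent_map_def)

lemma chart_TB_dq:
  assumes "(y, u) \<in> HM A" "y \<in> U"
  shows "chart TB (b, w) (dq A (y, u)) = (F y, DF y u)"
  using assms F_eq[of y] DF_ed[of y u] by (simp add: dq_apply TB_chart HM_iff H_T)

definition FT :: "'a \<times> 'a \<Rightarrow> 'e \<times> 'e" where "FT z = (F (fst z), DF (fst z) (snd z))"

lemma open_UT: "open (U \<times> (UNIV :: 'a set))" by (rule open_Times[OF openU open_UNIV])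

lemma Cinf_FT: "Cinf_on (U \<times> UNIV) FT"
proof -
  have "Cinf_on (U \<times> (UNIV::'a set)) (\<lambda>z. F (fst z))"
    by (rule Cinf_on_compose[OF open_UT openU _ Cinf_on_fst CF]) auto
  moreover have "Cinf_on (U \<times> (UNIV::'a set)) (\<lambda>z. DF (fst z))"
    by (rule Cinf_on_compose[OF open_UT openU _ Cinf_on_fst CDF]) auto
  ultimately show ?thesis unfolding FT_def
    by (intro Cinf_on_Pair[OF open_UT] Cinf_on_blinfun_apply[OF open_UT] Cinf_on_snd)
qed

lemma FT_derivative: "bderiv FT (x, v) \<Delta> = (DF x (fst \<Delta>), D2 (fst \<Delta>) v + DF x (snd \<Delta>))"
proof -
  have F: "(F has_derivative DF x) (at (fst (x, v)))" using has_derivative_bderiv[OF CF xU] by simp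
  have 1: "((\<lambda>z. F (fst z)) has_derivative (\<lambda>\<Delta>. DF x (fst \<Delta>))) (at (x, v))"
    by (rule has_derivative_compose[where g=F and f=fst, OF has_derivative_fst[OF has_derivative_ident] F])
  have D: "(DF has_derivative D2) (at (fst (x, v)))" using has_derivative_bderiv[OF CDF xU] by simp
  have 2: "((\<lambda>z. DF (fst z)) has_derivative (\<lambda>\<Delta>. D2 (fst \<Delta>))) (at (x, v))"
    by (rule has_derivative_compose[where g=DF and f=fst, OF has_derivative_fst[OF has_derivative_ident] D])
  have 3: "((\<lambda>z. DF (fst z) (snd z)) has_derivative (\<lambda>\<Delta>. DF (fst (x, v)) (snd \<Delta>) + D2 (fst \<Delta>) (snd (x, v)))) (at (x, v))"
    by (rule bounded_bilinear.FDERIV[OF bounded_bilinear_blinfun_apply 2 has_derivative_snd[OF has_derivative_ident]])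
  have "(FT has_derivative (\<lambda>\<Delta>. (DF x (fst \<Delta>), DF (fst (x, v)) (snd \<Delta>) + D2 (fst \<Delta>) (snd (x, v))))) (at (x, v))"
    unfolding FT_def[abs_def] by (rule has_derivative_Pair[OF 1 3])
  from bderiv_eqI[OF this] show ?thesis by (simp add: add.commute)
qed

lemma emb_deriv_dq:
  assumes "b = q x" "\<Delta> \<in> THM A (x, v)"
  shows "emb_deriv (HM A) TB (dq A) (x, v) \<Delta> = (DF x (fst \<Delta>), D2 (fst \<Delta>) v + DF x (snd \<Delta>))"
proof -
  have "dirD (HM A) (chart TB (dq A (x, v)) \<circ> dq A) (x, v) \<Delta> = bderiv FT (x, v) \<Delta>"
  proof (rule dirD_ext[OF open_UT _ Cinf_FT])
    show "(x, v) \<in> U \<times> UNIV" using xU by simp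
    show "\<Delta> \<in> tangent_space (HM A) (x, v)" using assms(2) by (simp add: THM_def)
    fix z assume "z \<in> (U \<times> UNIV) \<inter> HM A"
    then show "FT z = (chart TB (dq A (x, v)) \<circ> dq A) z"
      using chart_TB_dq[of "fst z" "snd z" "ed x v"] assms(1) by (auto simp: FT_def dq_apply)
  qed
  then show ?thesis unfolding emb_deriv_def using FT_derivative by simp
qed

lemma DF_onto: "\<exists>u\<in>TM A x. DF x u = c"
proof -
  obtain u where u: "u \<in> TM A x" "ed x u = cc b (q x) (q x) c" using surj[OF x] unfolding TM_def by (metis UNIV_I imageE)
  then show ?thesis using DF_ed[OF xUM u(1)] cc_inverse[OF b q_pts[OF x] q_dom[OF xUM] center[OF q_pts[OF x]]] by auto
qed

text \<open>In a slice chart the submersion is restricted to the affine subspace \<open>\<phi> x + range l\<close>, where \<open>l\<close> is a linear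
  right inverse of its derivative. There the inverse function theorem applies, and the local inverse
  gives the section.\<close>

lemma local_section:
  obtains W \<sigma> where "open W" "F x \<in> W" "Cinf_on W \<sigma>" "\<forall>y\<in>W. \<sigma> y \<in> U \<inter> M \<and> F (\<sigma> y) = y"
proof -
  obtain U0 V and \<phi> \<psi> :: "'a \<Rightarrow> 'a" and S where c: "open U0" "x \<in> U0" "open V" "homeomorphism U0 V \<phi> \<psi>" "Cinf_on U0 \<phi>" "Cinf_on V \<psi>"
    "subspace S" "\<phi> ` (U0 \<inter> M) = V \<inter> S" using embedded_submanifold_chartE[OF emb x] .
  have inv: "\<And>y. y \<in> U0 \<Longrightarrow> \<psi> (\<phi> y) = y" "\<phi> x \<in> V" "\<phi> x \<in> S"
    using c(2,4,8) x by (auto simp: homeomorphism_def)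
  have T: "TM A x = bderiv \<psi> (\<phi> x) ` S" unfolding TM_def by (rule tangent_space_eq_chart[OF c x])
  have "\<forall>i\<in>Basis. \<exists>s\<in>S. DF x (bderiv \<psi> (\<phi> x) s) = (i::'e)" using DF_onto unfolding T by blast
  then obtain s where s: "\<forall>i\<in>Basis. s i \<in> S \<and> DF x (bderiv \<psi> (\<phi> x) (s i)) = (i::'e)" by metis
  define l where "l w = (\<Sum>i\<in>Basis. (w \<bullet> i) *\<^sub>R s i)" for w :: 'e
  have lS: "l w \<in> S" for w unfolding l_def using s c(7) by (intro subspace_sum) (auto intro: subspace_scale)
  have bl: "bounded_linear l" unfolding l_def
    by (intro bounded_linear_sum bounded_linear_compose[OF bounded_linear_scaleR_left] bounded_linear_inner_left)
  have Dl: "DF x (bderiv \<psi> (\<phi> x) (l w)) = w" for w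
    using s by (simp add: l_def blinfun.sum_right blinfun.scaleR_right euclidean_representation)
  define \<eta> where "\<eta> w = \<phi> x + l w" for w
  have C\<eta>: "Cinf_on UNIV \<eta>" unfolding \<eta>_def
    by (intro Cinf_on_add[OF open_UNIV] Cinf_on_const Cinf_on_bounded_linear[OF bl])
  have oV': "open (V \<inter> \<psi> -` U)" by (rule continuous_open_preimage[OF Cinf_on_continuous_on[OF c(6)] c(3) openU])
  define D where "D = UNIV \<inter> \<eta> -` (V \<inter> \<psi> -` U)"
  have oD: "open D" unfolding D_def
    by (rule continuous_open_preimage[OF Cinf_on_continuous_on[OF C\<eta>] open_UNIV oV'])
  have l0: "l 0 = 0" by (simp add: l_def)
  have \<eta>0: "\<eta> 0 = \<phi> x" by (simp add: \<eta>_def l0)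
  have D0: "0 \<in> D" using inv c(2) xU by (simp add: D_def \<eta>0)
  have C\<psi>\<eta>: "Cinf_on D (\<lambda>w. \<psi> (\<eta> w))"
    by (rule Cinf_on_compose[OF oD c(3) _ Cinf_on_subset[OF C\<eta>] c(6)]) (auto simp: D_def)
  define f where "f w = F (\<psi> (\<eta> w))" for w
  have Cf: "Cinf_on D f" unfolding f_def
    by (rule Cinf_on_compose[OF oD openU _ C\<psi>\<eta> CF]) (auto simp: D_def)
  have "bderiv f 0 w = w" for w
  proof -
    have "(\<eta> has_derivative l) (at 0)"
      unfolding \<eta>_def using has_derivative_add[OF has_derivative_const bounded_linear_imp_has_derivative[OF bl]] by simp
    moreover have "(\<psi> has_derivative bderiv \<psi> (\<phi> x)) (at (\<eta> 0))"
      unfolding \<eta>0 by (rule has_derivative_bderiv[OF c(6) inv(2)])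
    ultimately have "(\<psi> \<circ> \<eta> has_derivative bderiv \<psi> (\<phi> x) \<circ> l) (at 0)" by (rule diff_chain_at)
    moreover have "(F has_derivative DF x) (at ((\<psi> \<circ> \<eta>) 0))"
      using has_derivative_bderiv[OF CF xU] inv(1)[OF c(2)] by (simp add: \<eta>0)
    ultimately have "(F \<circ> (\<psi> \<circ> \<eta>) has_derivative DF x \<circ> (bderiv \<psi> (\<phi> x) \<circ> l)) (at 0)" by (rule diff_chain_at)
    moreover have "F \<circ> (\<psi> \<circ> \<eta>) = f" by (simp add: fun_eq_iff f_def)
    ultimately have "(f has_derivative DF x \<circ> (bderiv \<psi> (\<phi> x) \<circ> l)) (at 0)" by simp
    from bderiv_eqI[OF this] show ?thesis using Dl by simp
  qed
  then have "inj (blinfun_apply (bderiv f 0))" by (simp add: inj_on_def)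
  then obtain U' W k where k: "open U'" "U' \<subseteq> D" "0 \<in> U'" "open W" "f 0 \<in> W" "homeomorphism U' W f k" "Cinf_on W k"
    by (rule smooth_inverse_function[OF oD Cf D0])
  have kW: "k y \<in> D" "f (k y) = y" if "y \<in> W" for y
    using k(2,6) that by (auto simp: homeomorphism_def)
  show thesis
  proof (rule that[of W "\<lambda>y. \<psi> (\<eta> (k y))"])
    show "open W" by (rule k(4))
    show "F x \<in> W" using k(5) inv(1)[OF c(2)] by (simp add: f_def \<eta>0)
    show "Cinf_on W (\<lambda>y. \<psi> (\<eta> (k y)))"
      by (rule Cinf_on_compose[OF k(4) oD _ k(7) C\<psi>\<eta>]) (use kW in auto)
    show "\<forall>y\<in>W. \<psi> (\<eta> (k y)) \<in> U \<inter> M \<and> F (\<psi> (\<eta> (k y))) = y"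
    proof
      fix y assume y: "y \<in> W"
      have e: "\<eta> (k y) \<in> V" "\<psi> (\<eta> (k y)) \<in> U" using kW(1)[OF y] by (auto simp: D_def)
      have "\<eta> (k y) \<in> S" unfolding \<eta>_def by (intro subspace_add[OF c(7)] inv(3) lS)
      then have "\<eta> (k y) \<in> \<phi> ` (U0 \<inter> M)" using e(1) c(8) by blast
      then have "\<psi> (\<eta> (k y)) \<in> M" using inv(1) by auto
      then show "\<psi> (\<eta> (k y)) \<in> U \<inter> M \<and> F (\<psi> (\<eta> (k y))) = y" using e(2) kW(2)[OF y] by (simp add: f_def)
    qed
  qed
qed

end

context submersed begin

lemma chart_at_exists:
  assumes "x \<in> M" "b \<in> pts" "q x \<in> cdom b"
  obtains U F where "chart_at A x b U F"
proof -
  obtain U F where U: "open U" "x \<in> U" "Cinf_on U F" "\<forall>y\<in>U \<inter> M. q y \<in> cdom b \<and> F y = chart (base A) b (q y)"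
    using smooth_to_local[OF smq assms] .
  show thesis by (rule that[of U F]) (use assms U in unfold_locales)
qed

lemma smooth_to_dq: "smooth_to (HM A) TB (dq A)"
  unfolding smooth_to_def
proof
  fix p assume p: "p \<in> HM A"
  obtain x v where pe: "p = (x, v)" by force
  have x: "x \<in> M" using p pe HM_iff by simp
  obtain U F where "chart_at A x (q x) U F" using chart_at_exists[OF x q_pts[OF x] center[OF q_pts[OF x]]] .
  then interpret c: chart_at A x "q x" U F .
  have dqp: "dq A p = (q x, ed x v)" using pe c.dq_apply by simp
  have "smooth_on ((U \<times> UNIV) \<inter> HM A) (chart TB (dq A p) \<circ> dq A)"
  proof (rule smooth_on_cong)
    show "smooth_on ((U \<times> UNIV) \<inter> HM A) c.FT" by (rule Cinf_on_imp_smooth_on[OF c.open_UT c.Cinf_FT]) blast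
    fix z assume "z \<in> (U \<times> UNIV) \<inter> HM A"
    then show "c.FT z = (chart TB (dq A p) \<circ> dq A) z"
      using c.chart_TB_dq[of "fst z" "snd z" "ed x v"] dqp by (auto simp: c.FT_def)
  qed
  moreover have "dq A ` ((U \<times> UNIV) \<inter> HM A) \<subseteq> chart_dom TB (dq A p)"
    using c.q_dom dqp by (auto simp: c.dq_apply HM_iff)
  ultimately show "dq A p \<in> points TB \<and> (\<exists>U. open U \<and> p \<in> U \<and> dq A ` (U \<inter> HM A) \<subseteq> chart_dom TB (dq A p) \<and>
             smooth_on (U \<inter> HM A) (chart TB (dq A p) \<circ> dq A))"
    using c.open_UT c.xU pe dqp q_pts[OF x] by (intro conjI exI[of _ "U \<times> UNIV"]) auto
qed

subsection \<open>Horizontal lifts\<close>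

lemma ed_H:
  assumes "u \<in> TM A x"
  shows "ed x (H x u) = ed x u"
proof -
  note x = T_M[OF assms]
  have "ed x u = ed x (H x u) + ed x (V x u)"
    using arg_cong[OF T_decomp[OF assms], of "ed x"] unfolding linear_add[OF lin_ed[OF x]] .
  then show ?thesis using V_mem[OF x, of u] VM_iff by simp
qed

lemma ed_inj_H:
  assumes "u \<in> HM_fib A x" "w \<in> HM_fib A x" "ed x u = ed x w"
  shows "u = w"
proof -
  have x: "x \<in> M" using T_M[OF H_T[OF assms(1)]] .
  have d: "u - w \<in> HM_fib A x" using subspace_diff[OF sub_H[OF x]] assms by blast
  have "ed x (u - w) = 0" using linear_diff[OF lin_ed[OF x]] assms(3) by simp
  then have "u - w \<in> VM A x" using H_T[OF d] VM_iff by blast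
  then show ?thesis using HV0[OF x] H_fix[OF x d] by simp
qed

lemma hlift_eq: "u \<in> HM_fib A x \<Longrightarrow> ed x u = c \<Longrightarrow> hlift A x c = u"
  unfolding hlift_def using ed_inj_H by (intro the_equality) auto

lemma hlift_props:
  assumes "x \<in> M"
  shows "hlift A x c \<in> HM_fib A x" "ed x (hlift A x c) = c"
proof -
  obtain u where u: "u \<in> TM A x" "ed x u = c" using surj[OF assms] unfolding TM_def by (metis UNIV_I imageE)
  then have "hlift A x c = H x u" using ed_H H_mem[OF assms] by (intro hlift_eq) auto
  then show "hlift A x c \<in> HM_fib A x" "ed x (hlift A x c) = c" using H_mem[OF assms] ed_H u by auto
qed

lemma linear_hlift: "x \<in> M \<Longrightarrow> linear (hlift A x)"
proof (rule linearI)
  assume x: "x \<in> M"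
  note h = hlift_props[OF x] and s = sub_H[OF x] and l = lin_ed[OF x]
  show "hlift A x (c + d) = hlift A x c + hlift A x d" for c d
    using h by (intro hlift_eq subspace_add[OF s]) (auto simp: linear_add[OF l])
  show "hlift A x (r *\<^sub>R c) = r *\<^sub>R hlift A x c" for r c
    using h by (intro hlift_eq subspace_scale[OF s]) (auto simp: linear_scale[OF l])
qed

lemma dq_onto:
  assumes "r \<in> points TB"
  obtains x v where "(x, v) \<in> HM A" "dq A (x, v) = r"
proof -
  obtain s c where r: "r = (s, c)" "s \<in> pts" using assms by (cases r) auto
  have "s \<in> q ` M" using r(2) unfolding qM .
  then obtain x where x: "x \<in> M" "q x = s" by blast
  show thesis
    by (rule that[of x "hlift A x c"]) (use hlift_props[OF x(1), of c] x r in \<open>auto simp: HM_iff dq_def tangent_map_def\<close>)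
qed

end

context chart_at begin

text \<open>The vector \<open>bderiv \<sigma> y c\<close> is tangent and lifts \<open>c\<close>, since \<open>F \<circ> \<sigma>\<close> is the identity. Its horizontal part is
  the horizontal lift.\<close>

lemma lift_along_section:
  assumes "open W" "Cinf_on W \<sigma>" "\<forall>y\<in>W. \<sigma> y \<in> U \<inter> M \<and> F (\<sigma> y) = y" "y \<in> W"
  shows "hlift A (\<sigma> y) (cc b (q (\<sigma> y)) (q (\<sigma> y)) c) = H (\<sigma> y) (bderiv \<sigma> y c)"
proof -
  have sy: "\<sigma> y \<in> U \<inter> M" using assms(3,4) by blast
  have "dirD W \<sigma> y c \<in> tangent_space M (\<sigma> y)"
    using assms tangent_space_open[OF assms(1,4)]
    by (intro tangent_space_image[OF Cinf_on_imp_smooth_on[OF assms(1,2)]]) auto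
  then have T: "bderiv \<sigma> y c \<in> TM A (\<sigma> y)"
    unfolding TM_def dirD_open[OF assms(1,4)] bderiv_apply[OF assms(2,4)] .
  have "(F \<circ> \<sigma> has_derivative DF (\<sigma> y) \<circ> bderiv \<sigma> y) (at y)"
    by (rule diff_chain_at[OF has_derivative_bderiv[OF assms(2,4)] has_derivative_bderiv[OF CF]]) (use sy in blast)
  moreover have "(F \<circ> \<sigma> has_derivative (\<lambda>c. c)) (at y)"
    by (rule has_derivative_transform_within_open[OF has_derivative_ident assms(1,4)]) (use assms(3) in simp)
  ultimately have "DF (\<sigma> y) \<circ> bderiv \<sigma> y = (\<lambda>c. c)" by (rule has_derivative_unique)
  then have "DF (\<sigma> y) (bderiv \<sigma> y c) = c" by (metis comp_apply)
  then have "ed (\<sigma> y) (bderiv \<sigma> y c) = cc b (q (\<sigma> y)) (q (\<sigma> y)) c" using cc_DF[OF sy T] by simp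
  then show ?thesis using ed_H[OF T] sy by (intro hlift_eq H_mem) auto
qed

end

section \<open>The natural metric on the tangent bundle of the base\<close>

locale submersed_ghat = submersed A for A :: "('a::euclidean_space, 'p, 'e::euclidean_space) ambient" +
  fixes ghat :: "'a \<times> 'a \<Rightarrow> 'a \<Rightarrow>\<^sub>L 'a"
  assumes mghat: "metric_operator (HM A) ghat" and binv: "base_invariant A ghat"
begin

lemma smooth_ghat: "smooth_on (HM A) ghat" and pd_ghat: "p \<in> HM A \<Longrightarrow> pos_def_op (ghat p)"
  using mghat unfolding metric_operator_def pos_def_op_def by blast+

lemma ghat_base_eq:
  assumes "p \<in> HM A"
  shows "ghat_base A ghat (dq A p) = lifted_form A ghat p"
proof -
  have "(SOME p'. p' \<in> HM A \<and> dq A p' = dq A p) \<in> HM A \<and> dq A (SOME p'. p' \<in> HM A \<and> dq A p' = dq A p) = dq A p"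
    by (rule someI[of _ p]) (use assms in simp)
  then show ?thesis unfolding ghat_base_def using binv assms unfolding base_invariant_def by blast
qed

lemma inner_product_lifted:
  assumes "(x, v) \<in> HM A"
  shows "inner_product (lifted_form A ghat (x, v))"
proof -
  have x: "x \<in> M" using assms HM_iff by blast
  note l = linear_hlift[OF x] and g = pd_ghat[OF assms]
  show ?thesis unfolding inner_product_def
  proof (intro conjI allI impI)
    show "bilinear (lifted_form A ghat (x, v))"
      unfolding bilinear_def lifted_form_def
      by (auto simp: linear_iff linear_add[OF l] linear_scale[OF l] inner_add_left inner_add_right
          blinfun.add_right blinfun.scaleR_right)
    show "lifted_form A ghat (x, v) u w = lifted_form A ghat (x, v) w u" for u w
      unfolding lifted_form_def by (rule pos_def_op_sym[OF g])
    fix u :: 'e assume "u \<noteq> 0"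
    then have "hlift A x u \<noteq> 0" using hlift_props(2)[OF x, of u] linear_0[OF lin_ed[OF x]] by metis
    then have "0 < hlift A x u \<bullet> ghat (x, v) (hlift A x u)" using g unfolding pos_def_op_def by blast
    then show "0 < lifted_form A ghat (x, v) u u" unfolding lifted_form_def fst_conv .
  qed
qed

lemma inner_product_ghat_base:
  assumes "r \<in> points TB"
  shows "inner_product (ghat_base A ghat r)"
proof -
  obtain x v where "(x, v) \<in> HM A" "dq A (x, v) = r" using dq_onto[OF assms] .
  then show ?thesis using ghat_base_eq inner_product_lifted by metis
qed

lemma ghat_base_lift:
  assumes "(x, v) \<in> HM A" "\<xi> \<in> HM_fib A x" "\<eta> \<in> HM_fib A x"
  shows "ghat_base A ghat (dq A (x, v)) (ed x \<xi>) (ed x \<eta>) = \<xi> \<bullet> ghat (x, v) \<eta>"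
  using ghat_base_eq[OF assms(1)] hlift_eq[OF assms(2) refl] hlift_eq[OF assms(3) refl] by (simp add: lifted_form_def)

text \<open>By invariance the form may be computed at any point of the fibre. Along a
  local section all ingredients, including the horizontal lifts, are smooth.\<close>

lemma Cinf_ghat_base:
  assumes b: "b \<in> pts" and a: "Cinf_on (cimg b \<times> UNIV) a" "Cinf_on (cimg b \<times> UNIV) a'"
  shows "Cinf_on (cimg b \<times> UNIV) (\<lambda>z. let s = chart_inv (base A) b (fst z) in
     ghat_base A ghat (s, cc b s s (snd z)) (cc b s s (a z)) (cc b s s (a' z)))"
proof (rule Cinf_on_local)
  fix z0 :: "'e \<times> 'e" assume z0: "z0 \<in> cimg b \<times> UNIV"
  have y0: "fst z0 \<in> cimg b" using z0 by auto
  define s0 where "s0 = chart_inv (base A) b (fst z0)"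
  have s0: "s0 \<in> cdom b" "s0 \<in> pts" unfolding s0_def using chart_inv_dom[OF y0] dom_pts[OF b] by auto
  have "s0 \<in> q ` M" using s0(2) unfolding qM .
  then obtain x where x: "x \<in> M" "q x = s0" by blast
  have qx: "q x \<in> cdom b" using s0 x by simp
  obtain U F where "chart_at A x b U F" using chart_at_exists[OF x(1) b qx] .
  then interpret c: chart_at A x b U F .
  obtain W \<sigma> where W: "open W" "F x \<in> W" "Cinf_on W \<sigma>" "\<forall>y\<in>W. \<sigma> y \<in> U \<inter> M \<and> F (\<sigma> y) = y" using c.local_section .
  have Fx: "F x = fst z0" using c.F_eq[OF c.xUM] x chart_chart_inv[OF y0] by (simp add: s0_def)
  have Wi: "y \<in> cimg b" "chart_inv (base A) b y = q (\<sigma> y)" if "y \<in> W" for y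
    using c.F_img[of "\<sigma> y"] c.inv_F[of "\<sigma> y"] W(4) that by auto
  have oW: "open (W \<times> (UNIV::'e set))" by (rule open_Times[OF W(1) open_UNIV])
  have fW: "fst ` (W \<times> (UNIV::'e set)) \<subseteq> W" by auto
  have WM: "\<sigma> ` W \<subseteq> M" using W(4) by blast
  have sm\<sigma>: "smooth_on W \<sigma>" by (rule Cinf_on_imp_smooth_on[OF W(1,3)]) blast
  define h where "h y w = H (\<sigma> y) (bderiv \<sigma> y w)" for y w
  have smh: "smooth_on (W \<times> UNIV) (\<lambda>z. h (fst z) (k z))" if "smooth_on (W \<times> UNIV) k" for k :: "'e \<times> 'e \<Rightarrow> 'e"
    unfolding h_def
  proof (intro smooth_on_blinfun_apply that)
    show "smooth_on (W \<times> (UNIV::'e set)) (\<lambda>z. H (\<sigma> (fst z)))"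
      by (rule smooth_on_compose[OF smooth_on_fst smooth_on_compose[OF sm\<sigma> smooth_H WM] fW])
    show "smooth_on (W \<times> (UNIV::'e set)) (\<lambda>z. bderiv \<sigma> (fst z))"
      by (rule smooth_on_compose[OF smooth_on_fst Cinf_on_imp_smooth_on[OF W(1) Cinf_on_bderiv[OF W(1,3)] subset_refl] fW])
  qed
  have sub: "W \<times> UNIV \<subseteq> cimg b \<times> UNIV" using Wi by auto
  have oi: "open (cimg b \<times> (UNIV::'e set))" by (rule open_Times[OF open_cimg[OF b] open_UNIV])
  have sma: "smooth_on (W \<times> UNIV) a" "smooth_on (W \<times> UNIV) a'"
    using Cinf_on_imp_smooth_on[OF oi _ sub] a by auto
  define P where "P z = (\<sigma> (fst z), h (fst z) (snd z))" for z
  have smP: "smooth_on (W \<times> UNIV) P" unfolding P_def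
    by (intro smooth_on_Pair smh smooth_on_snd smooth_on_compose[OF smooth_on_fst sm\<sigma> fW])
  have PHM: "P ` (W \<times> UNIV) \<subseteq> HM A" using WM H_mem by (auto simp: P_def HM_iff h_def)
  define f where "f z = h (fst z) (a z) \<bullet> ghat (P z) (h (fst z) (a' z))" for z
  have "smooth_on (W \<times> UNIV) f" unfolding f_def
    by (intro smooth_on_inner smooth_on_blinfun_apply smh sma smooth_on_compose[OF smP smooth_ghat PHM])
  then have Cf: "Cinf_on (W \<times> UNIV) f" by (rule smooth_on_imp_Cinf_on[OF oW])
  have eq: "(let s = chart_inv (base A) b (fst z) in ghat_base A ghat (s, cc b s s (snd z)) (cc b s s (a z)) (cc b s s (a' z))) = f z"
    if z: "z \<in> W \<times> UNIV" for z
  proof -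
    let ?y = "fst z"
    have y: "?y \<in> W" using z by auto
    have sM: "\<sigma> ?y \<in> M" using WM y by blast
    let ?s = "q (\<sigma> ?y)"
    have lift: "hlift A (\<sigma> ?y) (cc b ?s ?s w) = h ?y w" for w
      unfolding h_def by (rule c.lift_along_section[OF W(1,3,4) y])
    have "dq A (P z) = (?s, cc b ?s ?s (snd z))"
      using hlift_props(2)[OF sM, of "cc b ?s ?s (snd z)"] lift by (simp add: P_def c.dq_apply)
    moreover have "P z \<in> HM A" using PHM z by blast
    ultimately show ?thesis
      using ghat_base_eq[of "P z"] Wi(2)[OF y] lift by (simp add: f_def lifted_form_def P_def Let_def)
  qed
  show "\<exists>U g. open U \<and> z0 \<in> U \<and> Cinf_on U g \<and> (\<forall>z\<in>U. (let s = chart_inv (base A) b (fst z) in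
     ghat_base A ghat (s, cc b s s (snd z)) (cc b s s (a z)) (cc b s s (a' z))) = g z)"
    using oW W(2) Fx Cf eq by (intro exI[of _ "W \<times> UNIV"] exI[of _ f]) (auto simp: mem_Times_iff)
qed

end

section \<open>The horizontal bundle over the tangent bundle of the base\<close>

locale submersed_connection = submersed_christoffel A \<Gamma> + riemannian_base "base A" "base_metric A" nab C
  for A :: "('a::euclidean_space, 'p, 'e::euclidean_space) ambient" and \<Gamma> nab C +
  fixes B :: "'a \<Rightarrow> 'a \<Rightarrow>\<^sub>L 'a \<Rightarrow>\<^sub>L 'a"
  assumes Bext: "B_extension A B"
begin

abbreviation "GQ \<equiv> GammaQ A \<Gamma> B"
abbreviation "ddq \<equiv> emb_deriv (HM A) TB (dq A)"

lemma smooth_B: "smooth_on M B" using Bext unfolding B_extension_def by blast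

lemma B_apply:
  assumes "x \<in> M" "\<phi> \<in> TM A x" "v \<in> HM_fib A x"
  shows "B x \<phi> v = DH A x (V x \<phi>) v - DH A x v (V x \<phi>)"
  using Bext assms unfolding B_extension_def by blast

lemma dq_pair: "dq A (x, v) = (q x, ed x v)" by (simp add: dq_def tangent_map_def)

lemma chart_geometry_exists:
  assumes "x \<in> M"
  obtains U F where "chart_geometry A x (q x) U F \<Gamma> nab C"
proof -
  obtain U F where "chart_at A x (q x) U F"
    using chart_at_exists[OF assms q_pts[OF assms] center[OF q_pts[OF assms]]] .
  then interpret c: chart_at A x "q x" U F .
  show thesis by (rule that[of U F]) (unfold_locales, rule refl)
qed

text \<open>These identities determine the differential of \<open>dq A\<close> from the horizontal vector
  \<open>snd \<Delta> + GQ (x, v) (fst \<Delta>)\<close>, free of charts. All statements about \<open>G_Q\<close> follow from them.\<close>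

lemma ddq_identities:
  assumes p: "(x, v) \<in> HM A" and t: "\<Delta> \<in> THM A (x, v)"
  shows "fst (ddq (x, v) \<Delta>) = ed x (fst \<Delta>)"
    "C (dq A (x, v)) (ddq (x, v) \<Delta>) = ed x (snd \<Delta> + GQ (x, v) (fst \<Delta>))"
    "snd \<Delta> + GQ (x, v) (fst \<Delta>) \<in> HM_fib A x"
proof -
  have x: "x \<in> M" and v: "v \<in> HM_fib A x" using p HM_iff by auto
  obtain U F where "chart_geometry A x (q x) U F \<Gamma> nab C" using chart_geometry_exists[OF x] .
  then interpret c: chart_geometry A x "q x" U F \<Gamma> nab C .
  have t': "fst \<Delta> \<in> TM A x" "DH A x (fst \<Delta>) v + H x (snd \<Delta>) = snd \<Delta>"
    using THM_iff[OF p, of "fst \<Delta>" "snd \<Delta>"] t by auto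
  note s = shifted_vector[OF Bext p t']
  note e = c.emb_deriv_dq[OF refl t]
  show "fst (ddq (x, v) \<Delta>) = ed x (fst \<Delta>)" unfolding e using c.DFx[OF t'(1)] by simp
  show h: "snd \<Delta> + GQ (x, v) (fst \<Delta>) \<in> HM_fib A x" by (rule s(2))
  have "C (q x, bderiv F x v) (bderiv F x (fst \<Delta>), bderiv (bderiv F) x (fst \<Delta>) v + bderiv F x (snd \<Delta>))
      = bderiv F x (snd \<Delta> + GQ (x, v) (fst \<Delta>))"
    unfolding s(1) by (rule c.connection_map_identity[OF v t'])
  then show "C (dq A (x, v)) (ddq (x, v) \<Delta>) = ed x (snd \<Delta> + GQ (x, v) (fst \<Delta>))"
    unfolding e dq_pair using c.DFx[OF H_T[OF v]] c.DFx[OF H_T[OF h]] by simp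
qed

text \<open>For horizontal \<open>\<xi>\<close> the non-horizontal part of \<open>\<Gamma>Q \<xi>\<close> is \<open>- DH \<xi> v\<close>, so tangency of \<open>(\<xi>, c)\<close> becomes
  horizontality of the shifted vector.\<close>

lemma THM_horizontal_iff:
  assumes p: "(x, v) \<in> HM A" and \<xi>: "\<xi> \<in> HM_fib A x"
  shows "(\<xi>, c) \<in> THM A (x, v) \<longleftrightarrow> c + GQ (x, v) \<xi> \<in> HM_fib A x"
proof
  assume "(\<xi>, c) \<in> THM A (x, v)"
  from ddq_identities(3)[OF p this] show "c + GQ (x, v) \<xi> \<in> HM_fib A x" by simp
next
  assume h: "c + GQ (x, v) \<xi> \<in> HM_fib A x"
  have x: "x \<in> M" and v: "v \<in> HM_fib A x" using p HM_iff by auto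
  note T = H_T[OF \<xi>]
  define k where "k = H x (DPi A x \<xi> v + \<Gamma> x \<xi> v)"
  have "B x \<xi> v = 0" using B_apply[OF x T v] VH0[OF x \<xi>] linear_0[OF lin_dH[OF x]] by (simp add: blinfun.zero_right)
  then have g: "GQ (x, v) \<xi> = - DH A x \<xi> v + k"
    using H_fix[OF x \<xi>] by (simp add: GammaQ_apply[OF p] GammaQ_fun_def Gamma_H_def k_def)
  have kH: "k \<in> HM_fib A x" unfolding k_def by (rule H_mem[OF x])
  have e: "c - DH A x \<xi> v = (c + GQ (x, v) \<xi>) - k" using g by simp
  have d: "c - DH A x \<xi> v \<in> HM_fib A x" unfolding e by (rule subspace_diff[OF sub_H[OF x] h kH])
  have "H x c = H x (c - DH A x \<xi> v)" using H_dH[OF T v] by (simp add: blinfun.diff_right)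
  then have "DH A x \<xi> v + H x c = c" using H_fix[OF x d] by simp
  then show "(\<xi>, c) \<in> THM A (x, v)" using THM_iff[OF p] T by blast
qed

lemma QHM_iff:
  assumes p: "(x, v) \<in> HM A"
  shows "w \<in> QHM A (x, v) \<longleftrightarrow> fst w \<in> HM_fib A x \<and> snd w + GQ (x, v) (fst w) \<in> HM_fib A x"
proof -
  have x: "x \<in> M" using p HM_iff by auto
  show ?thesis
    unfolding QHM_def using THM_horizontal_iff[OF p, of "fst w" "snd w"] H_iff[OF x, of "fst w"] by auto
qed

lemma ddq_zero_iff:
  assumes p: "(x, v) \<in> HM A" and t: "\<Delta> \<in> THM A (x, v)"
  shows "ddq (x, v) \<Delta> = 0 \<longleftrightarrow> fst \<Delta> \<in> VM A x \<and> snd \<Delta> + GQ (x, v) (fst \<Delta>) = 0"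
proof -
  have x: "x \<in> M" and v: "v \<in> HM_fib A x" using p HM_iff by auto
  have a: "fst \<Delta> \<in> TM A x" using THM_iff[OF p, of "fst \<Delta>" "snd \<Delta>"] t by simp
  note i = ddq_identities[OF p t]
  note linC = linear_C[OF q_pts[OF x], of "ed x v"]
  show ?thesis
  proof
    assume z: "ddq (x, v) \<Delta> = 0"
    have "ed x (snd \<Delta> + GQ (x, v) (fst \<Delta>)) = ed x 0"
      using i(2) z linear_0[OF linC] linear_0[OF lin_ed[OF x]] by (simp add: dq_pair)
    then have "snd \<Delta> + GQ (x, v) (fst \<Delta>) = 0"
      using ed_inj_H[OF i(3), of 0] subspace_0[OF sub_H[OF x]] by simp
    then show "fst \<Delta> \<in> VM A x \<and> snd \<Delta> + GQ (x, v) (fst \<Delta>) = 0"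
      using a i(1) z by (simp add: VM_iff)
  next
    assume z: "fst \<Delta> \<in> VM A x \<and> snd \<Delta> + GQ (x, v) (fst \<Delta>) = 0"
    have f: "fst (ddq (x, v) \<Delta>) = 0" using i(1) z VM_iff by simp
    have "C (q x, ed x v) (0, snd (ddq (x, v) \<Delta>)) = 0"
      using i(2) z f linear_0[OF lin_ed[OF x]] by (metis dq_pair prod.collapse)
    then have "snd (ddq (x, v) \<Delta>) = 0" using C_vertical[OF q_pts[OF x]] by simp
    then show "ddq (x, v) \<Delta> = 0" using f by (simp add: prod_eq_iff)
  qed
qed

text \<open>For vertical \<open>e\<close> the shifted vector is \<open>H c + DH v e\<close>. It vanishes exactly if \<open>c = DH e v + H c\<close> is \<open>B_vert A x v e\<close>.\<close>

lemma vertical_space_HM: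
  assumes p: "(x, v) \<in> HM A"
  shows "vertical_space (HM A) TB (dq A) (x, v) = VHM A (x, v)"
proof -
  have x: "x \<in> M" and v: "v \<in> HM_fib A x" using p HM_iff by auto
  note vT = H_T[OF v]
  have sh: "c + GQ (x, v) e = H x c + DH A x v e" if e: "e \<in> VM A x" and t: "(e, c) \<in> THM A (x, v)" for e c
  proof -
    have t': "e \<in> TM A x" "DH A x e v + H x c = c" using THM_iff[OF p] t by auto
    show ?thesis using shifted_vector(1)[OF Bext p t'] HV0[OF x e] V_fix[OF x e]
      by (simp add: blinfun.zero_right blinfun.zero_left)
  qed
  show ?thesis
  proof
    show "vertical_space (HM A) TB (dq A) (x, v) \<subseteq> VHM A (x, v)"
    proof
      fix \<Delta> assume "\<Delta> \<in> vertical_space (HM A) TB (dq A) (x, v)"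
      then have t: "\<Delta> \<in> THM A (x, v)" and z: "ddq (x, v) \<Delta> = 0" by (simp_all add: vertical_space_def THM_def)
      have e: "fst \<Delta> \<in> VM A x" "snd \<Delta> + GQ (x, v) (fst \<Delta>) = 0" using ddq_zero_iff[OF p t] z by auto
      have "H x (snd \<Delta>) + DH A x v (fst \<Delta>) = 0" using sh[of "fst \<Delta>" "snd \<Delta>"] e t by simp
      then have h: "H x (snd \<Delta>) = - DH A x v (fst \<Delta>)" by (simp add: eq_neg_iff_add_eq_0)
      have "DH A x (fst \<Delta>) v + H x (snd \<Delta>) = snd \<Delta>" using THM_iff[OF p, of "fst \<Delta>" "snd \<Delta>"] t by simp
      then have "snd \<Delta> = B_vert A x v (fst \<Delta>)" unfolding B_vert_def h by simp
      then show "\<Delta> \<in> VHM A (x, v)" unfolding VHM_def using e(1) by (cases \<Delta>) auto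
    qed
    show "VHM A (x, v) \<subseteq> vertical_space (HM A) TB (dq A) (x, v)"
    proof
      fix \<Delta> assume "\<Delta> \<in> VHM A (x, v)"
      then obtain e where e: "\<Delta> = (e, B_vert A x v e)" "e \<in> VM A x" by (auto simp: VHM_def)
      note eT = V_T[OF e(2)]
      have h: "H x (B_vert A x v e) = - DH A x v e"
        using H_dH[OF eT v] H_fix[OF x dH_vert[OF vT e(2)]] by (simp add: B_vert_def blinfun.diff_right)
      then have "DH A x e v + H x (B_vert A x v e) = B_vert A x v e" by (simp add: B_vert_def)
      then have t: "\<Delta> \<in> THM A (x, v)" unfolding e(1) using THM_iff[OF p] eT by blast
      have "snd \<Delta> + GQ (x, v) (fst \<Delta>) = 0" using sh[OF e(2), of "B_vert A x v e"] t h by (simp add: e(1))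
      then have "ddq (x, v) \<Delta> = 0" using ddq_zero_iff[OF p t] e by simp
      then show "\<Delta> \<in> vertical_space (HM A) TB (dq A) (x, v)" using t by (simp add: vertical_space_def THM_def)
    qed
  qed
qed

text \<open>A preimage of \<open>d\<close> is obtained from the horizontal lifts of \<open>fst d\<close> and of the covariant part of \<open>d\<close>.\<close>

lemma ddq_onto:
  assumes p: "(x, v) \<in> HM A"
  shows "ddq (x, v) ` tangent_space (HM A) (x, v) = UNIV"
proof (rule antisym[OF subset_UNIV], rule subsetI)
  fix d :: "'e \<times> 'e"
  have x: "x \<in> M" using p HM_iff by auto
  define \<xi> where "\<xi> = hlift A x (fst d)"
  define h where "h = hlift A x (C (dq A (x, v)) d)"
  have \<xi>: "\<xi> \<in> HM_fib A x" "ed x \<xi> = fst d" and h: "h \<in> HM_fib A x" "ed x h = C (dq A (x, v)) d"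
    unfolding \<xi>_def h_def using hlift_props[OF x] by auto
  let ?D = "(\<xi>, h - GQ (x, v) \<xi>)"
  have t: "?D \<in> THM A (x, v)" using THM_horizontal_iff[OF p \<xi>(1), of "h - GQ (x, v) \<xi>"] h(1) by simp
  note i = ddq_identities[OF p t]
  have f: "fst (ddq (x, v) ?D) = fst d" using i(1) \<xi> by simp
  have "C (q x, ed x v) (ddq (x, v) ?D) = C (q x, ed x v) d" using i(2) h(2) by (simp add: dq_pair)
  moreover have "C (q x, ed x v) z = snd z + C (q x, ed x v) (fst z, 0)" for z
    using C_split[OF q_pts[OF x], of "ed x v" "fst z" "snd z"] by simp
  ultimately have "snd (ddq (x, v) ?D) = snd d" using f by (metis add_right_cancel)
  then have "ddq (x, v) ?D = d" using f by (simp add: prod_eq_iff)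
  then show "d \<in> ddq (x, v) ` tangent_space (HM A) (x, v)" using t unfolding THM_def by (metis imageI)
qed

lemma Q_map_idempotent:
  assumes p: "(x, v) \<in> HM A"
  shows "Q_map A (x, v) (Q_map A (x, v) \<Delta>) = Q_map A (x, v) \<Delta>"
    "Q_map A (x, v) ` THM A (x, v) = QHM A (x, v)"
proof -
  have x: "x \<in> M" and v: "v \<in> HM_fib A x" using p HM_iff by auto
  have HH: "H x (H x z) = H x z" for z using H_fix[OF x H_mem[OF x]] .
  have Hd: "H x (DH A x (H x z) v) = 0" for z by (rule H_dH[OF H_T[OF H_mem[OF x]] v])
  show "Q_map A (x, v) (Q_map A (x, v) \<Delta>) = Q_map A (x, v) \<Delta>"
    by (cases \<Delta>) (simp add: Q_map_def HH Hd blinfun.add_right)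
  have Qmem: "Q_map A (x, v) \<Delta> \<in> QHM A (x, v)" for \<Delta>
  proof -
    let ?a = "H x (fst \<Delta>)" and ?c = "DH A x (H x (fst \<Delta>)) v + H x (snd \<Delta>)"
    have "DH A x ?a v + H x ?c = ?c" by (simp add: blinfun.add_right Hd HH)
    then have "(?a, ?c) \<in> THM A (x, v)" using THM_iff[OF p] H_T[OF H_mem[OF x]] by blast
    then show ?thesis by (simp add: QHM_def Q_map_def case_prod_beta HH)
  qed
  have Qfix: "Q_map A (x, v) \<Delta> = \<Delta>" if "\<Delta> \<in> QHM A (x, v)" for \<Delta>
    using that THM_iff[OF p, of "fst \<Delta>" "snd \<Delta>"] by (simp add: QHM_def Q_map_def case_prod_beta)
  show "Q_map A (x, v) ` THM A (x, v) = QHM A (x, v)"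
  proof
    show "Q_map A (x, v) ` THM A (x, v) \<subseteq> QHM A (x, v)" using Qmem by blast
    show "QHM A (x, v) \<subseteq> Q_map A (x, v) ` THM A (x, v)"
    proof
      fix \<Delta> assume d: "\<Delta> \<in> QHM A (x, v)"
      then have "\<Delta> \<in> THM A (x, v)" by (simp add: QHM_def)
      then show "\<Delta> \<in> Q_map A (x, v) ` THM A (x, v)" using Qfix[OF d] by (metis imageI)
    qed
  qed
qed

end

locale submersed_metric = submersed_connection A \<Gamma> nab C B + submersed_ghat A ghat
  for A :: "('a::euclidean_space, 'p, 'e::euclidean_space) ambient" and \<Gamma> nab C B ghat
begin

abbreviation "GG \<equiv> G_Q A \<Gamma> B ghat"
abbreviation "natB \<equiv> natural_metric (base A) (base_metric A) (ghat_base A ghat) C"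

lemma riemannian_HM: "riemannian_embedded (HM A) GG"
proof -
  have "smooth_on (HM A) GG"
    by (intro smooth_on_G_Q smooth_fst_comp[OF smooth_g] smooth_ghat smooth_GammaQ smooth_B)
  moreover have "pos_def_op (GG p)" if "p \<in> HM A" for p
    using that fst_HM by (intro pos_def_G_Q pd pd_ghat) auto
  ultimately show ?thesis
    unfolding riemannian_embedded_def metric_operator_def using embedded_HM unfolding pos_def_op_def by blast
qed

lemma natural_metric_eq:
  assumes "r \<in> points TB"
  shows "natB r \<Delta> \<Delta>' = base_metric A (fst r) (fst \<Delta>) (fst \<Delta>') + ghat_base A ghat r (C r \<Delta>) (C r \<Delta>')"
  using assms mfd_deriv_fst[of "fst r" "snd r"] by (simp add: natural_metric_def mem_Times_iff)

lemma inner_product_natural: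
  assumes r: "r \<in> points TB"
  shows "inner_product (natB r)"
proof -
  have b: "fst r \<in> pts" using r by auto
  have lC: "linear (C r)" using linear_C[OF b, of "snd r"] by simp
  note g = inner_product_metric[OF b, unfolded inner_product_def]
  note h = inner_product_ghat_base[OF r, unfolded inner_product_def]
  have "bilinear (base_metric A (fst r))" using g by blast
  then have gl: "linear (\<lambda>u. base_metric A (fst r) u w)" "linear (base_metric A (fst r) w)" for w
    unfolding bilinear_def by auto
  have "bilinear (ghat_base A ghat r)" using h by blast
  then have hl: "linear (\<lambda>u. ghat_base A ghat r u w)" "linear (ghat_base A ghat r w)" for w
    unfolding bilinear_def by auto
  show ?thesis
    unfolding inner_product_def
  proof (intro conjI allI impI)
    show "bilinear (natB r)"
      unfolding bilinear_def natural_metric_eq[OF r, abs_def]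
    proof (intro conjI allI linearI)
    qed (simp_all add: linear_add[OF gl(1)] linear_add[OF gl(2)] linear_add[OF hl(1)] linear_add[OF hl(2)]
        linear_scale[OF gl(1)] linear_scale[OF gl(2)] linear_scale[OF hl(1)] linear_scale[OF hl(2)]
        linear_add[OF lC] linear_scale[OF lC] algebra_simps)
    show "natB r u w = natB r w u" for u w using g h by (simp add: natural_metric_eq[OF r])
    fix u :: "'e \<times> 'e" assume u: "u \<noteq> 0"
    have nn: "0 \<le> base_metric A (fst r) a a" "0 \<le> ghat_base A ghat r a a" for a
      using g h linear_0[OF gl(1)] linear_0[OF hl(1)] by (cases "a = 0"; force intro: less_imp_le)+
    show "0 < natB r u u"
    proof (cases "fst u = 0")
      case True
      then have "snd u \<noteq> 0" using u by (simp add: prod_eq_iff)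
      moreover have "C r u = snd u" using C_vertical[OF b, of "snd r" "snd u"] True by (metis prod.collapse)
      ultimately have "0 < ghat_base A ghat r (C r u) (C r u)" using h by simp
      then show ?thesis using nn(1) by (simp add: natural_metric_eq[OF r] add_nonneg_pos)
    next
      case False
      then have "0 < base_metric A (fst r) (fst u) (fst u)" using g by blast
      then show ?thesis using nn(2) by (simp add: natural_metric_eq[OF r] add_pos_nonneg)
    qed
  qed
qed

text \<open>The first summand is the metric of the base in the chart. The second one is evaluated on the components
  of the connection map in the chart, whose smoothness is part of its definition.\<close>

lemma riemannian_natural: "riemannian_metric TB natB"
  unfolding riemannian_metric_def
proof (intro conjI ballI allI)
  show "inner_product (natB r)" if "r \<in> points TB" for r by (rule inner_product_natural[OF that])
  interpret T: atlas TB by (rule atlas_TB)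
  fix r u w assume r: "r \<in> points TB"
  define b where "b = fst r"
  have b: "b \<in> pts" using r by (auto simp: b_def)
  have re: "r = (b, snd r)" by (simp add: b_def)
  have img: "chart TB r ` chart_dom TB r = cimg b \<times> UNIV" using TB_img[OF b subset_refl, of "snd r"] by (simp add: b_def)
  have oi: "open (cimg b \<times> (UNIV::'e set))" by (rule open_Times[OF open_cimg[OF b] open_UNIV])
  define k where "k \<Delta> z = (let s = chart_inv TB r z in
                coord_change (base A) (fst s) (fst r) (fst s) (C s (coord_change TB r s s \<Delta>)))" for \<Delta> z
  have Ck: "Cinf_on (cimg b \<times> UNIV) (k \<Delta>)" for \<Delta>
    using cm r unfolding connection_map_def img[symmetric] k_def by blast
  define f where "f z = chart_metric b (fst z) (fst u) (fst w) + (let s = chart_inv (base A) b (fst z) in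
     ghat_base A ghat (s, cc b s s (snd z)) (cc b s s (k u z)) (cc b s s (k w z)))" for z
  have "Cinf_on (cimg b \<times> UNIV) f" unfolding f_def
  proof (rule Cinf_on_add[OF oi _ Cinf_ghat_base[OF b Ck Ck]])
    show "Cinf_on (cimg b \<times> (UNIV::'e set)) (\<lambda>z. chart_metric b (fst z) (fst u) (fst w))"
      by (rule Cinf_on_compose[OF oi open_cimg[OF b] _ Cinf_on_fst Cinf_chart_metric[OF b]]) auto
  qed
  moreover have "f z = (let s = chart_inv TB r z in natB s (coord_change TB r s s u) (coord_change TB r s s w))"
    if z: "z \<in> cimg b \<times> UNIV" for z
  proof -
    let ?y = "fst z"
    have y: "?y \<in> cimg b" using z by auto
    define s where "s = chart_inv (base A) b ?y"
    have s: "s \<in> cdom b" "s \<in> pts" using chart_inv_dom[OF y] dom_pts[OF b] by (auto simp: s_def)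
    let ?S = "(s, cc b s s (snd z))"
    have ci: "chart_inv TB r z = ?S" using TB_chart_inv[OF b y, of "snd r" "snd z"] by (simp add: s_def b_def)
    have S: "?S \<in> points TB" using s by simp
    have fc: "fst (coord_change TB r ?S ?S \<Delta>) = cc b s s (fst \<Delta>)" for \<Delta>
      using fst_cc_TB[OF b s(2,1) center[OF s(2)], of "snd r"] re by simp
    have kc: "cc b s s (k \<Delta> z) = C ?S (coord_change TB r ?S ?S \<Delta>)" for \<Delta>
      using cc_inverse[OF s(2) b center[OF s(2)] s(1)] by (simp add: k_def ci Let_def b_def[symmetric])
    show ?thesis
      by (simp add: f_def ci Let_def natural_metric_eq[OF S] fc kc chart_metric_def s_def[symmetric])
  qed
  ultimately show "Cinf_on (chart TB r ` chart_dom TB r)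
          (\<lambda>z. let s = chart_inv TB r z in natB s (coord_change TB r s s u) (coord_change TB r s s w))"
    unfolding img by (rule Cinf_on_cong[OF oi, rotated])
qed

text \<open>The shifted vectors of vertical vectors vanish, so orthogonality for \<open>G_Q\<close> to the vertical bundle is
  orthogonality of the first components for \<open>met A\<close>.\<close>

lemma horizontal_space_HM:
  assumes p: "(x, v) \<in> HM A"
  shows "horizontal_space (HM A) GG TB (dq A) (x, v) = QHM A (x, v)"
proof -
  have x: "x \<in> M" using p HM_iff by auto
  have vert: "\<Delta> \<bullet> GG (x, v) E = fst \<Delta> \<bullet> g x (fst E)" if "E \<in> VHM A (x, v)" for \<Delta> E
  proof -
    have "E \<in> THM A (x, v)" "ddq (x, v) E = 0"
      using that vertical_space_HM[OF p] unfolding vertical_space_def THM_def by auto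
    then have "snd E + GQ (x, v) (fst E) = 0" using ddq_zero_iff[OF p] by blast
    then show ?thesis by (simp add: G_Q_inner blinfun.zero_right)
  qed
  have fstV: "fst ` VHM A (x, v) = VM A x" by (force simp: VHM_def)
  show ?thesis
    unfolding horizontal_space_def vertical_space_HM[OF p] QHM_def THM_def[symmetric]
  proof (rule Collect_cong, rule conj_cong[OF refl])
    fix \<Delta> assume t: "\<Delta> \<in> THM A (x, v)"
    have T: "fst \<Delta> \<in> TM A x" using THM_iff[OF p, of "fst \<Delta>" "snd \<Delta>"] t by simp
    have "(\<forall>E\<in>VHM A (x, v). \<Delta> \<bullet> GG (x, v) E = 0) \<longleftrightarrow> (\<forall>e\<in>fst ` VHM A (x, v). fst \<Delta> \<bullet> g x e = 0)"
      using vert by simp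
    also have "\<dots> \<longleftrightarrow> fst \<Delta> \<in> HM_fib A x" unfolding fstV H_fib_iff using T by blast
    also have "\<dots> \<longleftrightarrow> H (fst (x, v)) (fst \<Delta>) = fst \<Delta>" using H_iff[OF x] by simp
    finally show "(\<forall>E\<in>VHM A (x, v). \<Delta> \<bullet> GG (x, v) E = 0) \<longleftrightarrow> H (fst (x, v)) (fst \<Delta>) = fst \<Delta>" .
  qed
qed

lemma riemannian_submersion_dq: "riemannian_submersion (HM A) GG TB natB (dq A)"
  unfolding riemannian_submersion_def
proof (intro conjI ballI)
  show "riemannian_embedded (HM A) GG" by (rule riemannian_HM)
  show "smooth_manifold TB"
    using smooth_manifold_TB mfd smooth_manifold_iff by blast
  show "riemannian_metric TB natB" by (rule riemannian_natural)
  show "smooth_to (HM A) TB (dq A)" by (rule smooth_to_dq)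
  show "dq A ` HM A = points TB"
  proof
    show "dq A ` HM A \<subseteq> points TB" using smooth_to_dq unfolding smooth_to_def by blast
    show "points TB \<subseteq> dq A ` HM A" by (metis dq_onto image_eqI subsetI)
  qed
  show "ddq p ` tangent_space (HM A) p = UNIV" if "p \<in> HM A" for p
    using ddq_onto[of "fst p" "snd p"] that by simp
  fix p \<Delta> \<Delta>' assume p: "p \<in> HM A" and h: "\<Delta> \<in> horizontal_space (HM A) GG TB (dq A) p"
    "\<Delta>' \<in> horizontal_space (HM A) GG TB (dq A) p"
  obtain x v where pe: "p = (x, v)" by force
  note p' = p[unfolded pe]
  have x: "x \<in> M" using p' HM_iff by auto
  have Q: "\<Delta> \<in> QHM A (x, v)" "\<Delta>' \<in> QHM A (x, v)" using h horizontal_space_HM[OF p'] pe by auto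
  then have t: "\<Delta> \<in> THM A (x, v)" "\<Delta>' \<in> THM A (x, v)" by (auto simp: QHM_def)
  note q1 = QHM_iff[OF p', THEN iffD1, OF Q(1)] and q2 = QHM_iff[OF p', THEN iffD1, OF Q(2)]
  have r: "dq A (x, v) \<in> points TB" using q_pts[OF x] by (simp add: dq_pair)
  show "natB (dq A p) (ddq p \<Delta>) (ddq p \<Delta>') = \<Delta> \<bullet> GG p \<Delta>'"
    unfolding pe natural_metric_eq[OF r] ddq_identities(1)[OF p' t(1)] ddq_identities(1)[OF p' t(2)]
      ddq_identities(2)[OF p' t(1)] ddq_identities(2)[OF p' t(2)]
    using isom[OF x conjunct1[OF q1] conjunct1[OF q2]] ghat_base_lift[OF p' conjunct2[OF q1] conjunct2[OF q2]]
    by (simp add: G_Q_inner dq_pair)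
qed

lemma is_oproj_H_GQ:
  assumes p: "(x, v) \<in> HM A"
  shows "is_oproj (GG (x, v)) (QHM A (x, v)) (H_GQ A \<Gamma> B ghat (x, v))"
proof -
  have x: "x \<in> M" using p HM_iff by auto
  let ?K = "oproj (ghat (x, v)) (HM_fib A x)"
  note g = pd_ghat[OF p]
  have e: "H_GQ A \<Gamma> B ghat (x, v) z = (H x (fst z), ?K (snd z + GQ (x, v) (fst z)) - GQ (x, v) (H x (fst z)))" for z
    by (simp add: H_GQ_def block_apply H_pr_def[symmetric] blinfun.minus_left add.commute)
  show ?thesis
    unfolding is_oproj_def
  proof (intro conjI allI ballI)
    fix z
    show "H_GQ A \<Gamma> B ghat (x, v) z \<in> QHM A (x, v)"
      unfolding QHM_iff[OF p] e using H_mem[OF x] oproj_mem[OF g sub_H[OF x]] by simp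
    fix w assume "w \<in> QHM A (x, v)"
    then have w: "fst w \<in> HM_fib A x" "snd w + GQ (x, v) (fst w) \<in> HM_fib A x" using QHM_iff[OF p] by auto
    show "(z - H_GQ A \<Gamma> B ghat (x, v) z) \<bullet> GG (x, v) w = 0"
      unfolding G_Q_inner e
      using H_orth[OF x w(1), of "fst z"] oproj_orth[OF g sub_H[OF x] w(2), of "snd z + GQ (x, v) (fst z)"]
      by (simp add: blinfun.diff_right algebra_simps)
  qed
qed

lemma H_GQ_fix:
  assumes p: "(x, v) \<in> HM A" and w: "w \<in> QHM A (x, v)"
  shows "H_GQ A \<Gamma> B ghat (x, v) w = w"
proof -
  have x: "x \<in> M" using p HM_iff by auto
  have q: "fst w \<in> HM_fib A x" "snd w + GQ (x, v) (fst w) \<in> HM_fib A x" using QHM_iff[OF p] w by auto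
  show ?thesis
    using H_fix[OF x q(1)] oproj_fix[OF pd_ghat[OF p] sub_H[OF x] q(2)]
    by (simp add: H_GQ_def block_apply H_pr_def[symmetric] blinfun.minus_left prod_eq_iff add.commute)
qed

text \<open>The vector \<open>snd \<Delta> + GQ (x, v) (fst \<Delta>)\<close> is horizontal, so the projection for \<open>ghat\<close> fixes it. The
  correction term in \<open>Q_proj\<close> is the contribution of the vertical part of \<open>fst \<Delta>\<close> to this vector.\<close>

lemma Q_proj_eq:
  assumes p: "(x, v) \<in> HM A" and t: "\<Delta> \<in> THM A (x, v)"
  shows "Q_proj A (x, v) \<Delta> = H_GQ A \<Gamma> B ghat (x, v) \<Delta>"
proof -
  have x: "x \<in> M" and v: "v \<in> HM_fib A x" using p HM_iff by auto
  let ?a = "fst \<Delta>" and ?c = "snd \<Delta>"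
  have t': "?a \<in> TM A x" "DH A x ?a v + H x ?c = ?c" using THM_iff[OF p, of ?a ?c] t by auto
  note s = shifted_vector[OF Bext p t']
  have hh: "H x ?a \<in> HM_fib A x" by (rule H_mem[OF x])
  have VHa: "V x (H x ?a) = 0" by (rule VH0[OF x hh])
  have Hd: "H x (DPi A x (H x ?a) v) = 0" by (rule H_dP[OF H_T[OF hh] H_T[OF v]])
  have "B x (H x ?a) v = 0" using B_apply[OF x H_T[OF hh] v] VHa linear_0[OF lin_dH[OF x]]
    by (simp add: blinfun.zero_right)
  then have g: "GQ (x, v) (H x ?a) = - DH A x (H x ?a) v + H x (\<Gamma> x (H x ?a) v)"
    using H_fix[OF x hh] Hd by (simp add: GammaQ_apply[OF p] GammaQ_fun_def Gamma_H_def blinfun.add_right)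
  have "H_GQ A \<Gamma> B ghat (x, v) \<Delta> = (H x ?a, (?c + GQ (x, v) ?a) - GQ (x, v) (H x ?a))"
    using oproj_fix[OF pd_ghat[OF p] sub_H[OF x] s(2)]
    by (simp add: H_GQ_def block_apply H_pr_def[symmetric] blinfun.minus_left add.commute)
  also have "\<dots> = Q_proj A (x, v) \<Delta>"
    unfolding s(1) g by (simp add: Q_proj_def Q_map_def case_prod_beta algebra_simps)
  finally show ?thesis by simp
qed

lemma Q_proj_properties:
  assumes p: "(x, v) \<in> HM A"
  shows "\<Delta> \<in> THM A (x, v) \<Longrightarrow> Q_proj A (x, v) (Q_proj A (x, v) \<Delta>) = Q_proj A (x, v) \<Delta>"
    "Q_proj A (x, v) ` THM A (x, v) = QHM A (x, v)"
    "\<Delta> \<in> THM A (x, v) \<Longrightarrow> w \<in> QHM A (x, v) \<Longrightarrow> (\<Delta> - Q_proj A (x, v) \<Delta>) \<bullet> GG (x, v) w = 0"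
proof -
  have Qmem: "Q_proj A (x, v) \<Delta> \<in> QHM A (x, v)" if "\<Delta> \<in> THM A (x, v)" for \<Delta>
    unfolding Q_proj_eq[OF p that] using is_oproj_H_GQ[OF p] unfolding is_oproj_def by blast
  have QT: "w \<in> QHM A (x, v) \<Longrightarrow> w \<in> THM A (x, v)" for w by (simp add: QHM_def)
  have Qfix: "Q_proj A (x, v) w = w" if "w \<in> QHM A (x, v)" for w
    using Q_proj_eq[OF p QT[OF that]] H_GQ_fix[OF p that] by simp
  show "Q_proj A (x, v) (Q_proj A (x, v) \<Delta>) = Q_proj A (x, v) \<Delta>" if "\<Delta> \<in> THM A (x, v)"
    using Qfix[OF Qmem[OF that]] .
  show "Q_proj A (x, v) ` THM A (x, v) = QHM A (x, v)"
  proof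
    show "Q_proj A (x, v) ` THM A (x, v) \<subseteq> QHM A (x, v)" using Qmem by blast
    show "QHM A (x, v) \<subseteq> Q_proj A (x, v) ` THM A (x, v)" using Qfix QT by (metis image_eqI subsetI)
  qed
  show "(\<Delta> - Q_proj A (x, v) \<Delta>) \<bullet> GG (x, v) w = 0" if "\<Delta> \<in> THM A (x, v)" "w \<in> QHM A (x, v)"
    unfolding Q_proj_eq[OF p that(1)] using is_oproj_H_GQ[OF p] that(2) unfolding is_oproj_def by blast
qed

end

text \<open>The two structures have the same horizontal spaces, base and connection map, hence by
  \<open>ddq_identities\<close> the same shifted vectors, although the projections and the operators \<open>\<Gamma>Q\<close>
  differ. Shifted vectors are tangent, where the metric operators agree.\<close>

lemma G_Q_depends_on_tangent_values:
  fixes A :: "('a::euclidean_space, 'p, 'e::euclidean_space) ambient"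
    and ghat ghat' :: "'a \<times> 'a \<Rightarrow> 'a \<Rightarrow>\<^sub>L 'a" and g' :: "'a \<Rightarrow> 'a \<Rightarrow>\<^sub>L 'a"
  assumes "submersed_connection A \<Gamma> nab C B" "submersed_connection (A\<lparr>met := g'\<rparr>) \<Gamma>' nab C B'"
    and g': "\<forall>x\<in>tot A. \<forall>\<xi>\<in>TM A x. \<forall>\<eta>\<in>TM A x. \<xi> \<bullet> g' x \<eta> = \<xi> \<bullet> met A x \<eta>"
    and ghat': "\<forall>(x, v)\<in>HM A. \<forall>\<xi>\<in>TM A x. \<forall>\<eta>\<in>TM A x. \<xi> \<bullet> ghat' (x, v) \<eta> = \<xi> \<bullet> ghat (x, v) \<eta>"
    and p: "(x, v) \<in> HM A" and t: "\<Delta> \<in> THM A (x, v)" "\<Delta>' \<in> THM A (x, v)"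
  shows "\<Delta> \<bullet> G_Q (A\<lparr>met := g'\<rparr>) \<Gamma>' B' ghat' (x, v) \<Delta>' = \<Delta> \<bullet> G_Q A \<Gamma> B ghat (x, v) \<Delta>'"
proof -
  let ?A = "A\<lparr>met := g'\<rparr>"
  interpret a: submersed_connection A \<Gamma> nab C B by (rule assms(1))
  interpret b: submersed_connection ?A \<Gamma>' nab C B' by (rule assms(2))
  have TM: "TM ?A y = TM A y" for y by (simp add: TM_def)
  have VM: "VM ?A y = VM A y" for y by (simp add: VM_def)
  have fib: "HM_fib ?A y = HM_fib A y" if "y \<in> tot A" for y
  proof (rule set_eqI)
    fix u show "u \<in> HM_fib ?A y \<longleftrightarrow> u \<in> HM_fib A y"
      unfolding a.H_fib_iff b.H_fib_iff TM VM using g' that a.V_T by (metis ambient.select_convs(5) ambient.surjective ambient.update_convs(5))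
  qed
  have HM: "HM ?A = HM A"
  proof (rule set_eqI)
    fix z show "z \<in> HM ?A \<longleftrightarrow> z \<in> HM A"
      using fib a.HM_iff[of "fst z" "snd z"] b.HM_iff[of "fst z" "snd z"] by auto
  qed
  have THM: "THM ?A z = THM A z" for z by (simp add: THM_def HM)
  have dq: "dq ?A = dq A" by (simp add: dq_def)
  have x: "x \<in> tot A" using p a.HM_iff by auto
  note pb = p[folded HM]
  have shift: "snd \<Delta> + GammaQ ?A \<Gamma>' B' (x, v) (fst \<Delta>) = snd \<Delta> + GammaQ A \<Gamma> B (x, v) (fst \<Delta>)"
    if t: "\<Delta> \<in> THM A (x, v)" for \<Delta>
  proof (rule a.ed_inj_H)
    note tb = t[folded THM]
    show "snd \<Delta> + GammaQ A \<Gamma> B (x, v) (fst \<Delta>) \<in> HM_fib A x" by (rule a.ddq_identities(3)[OF p t])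
    show "snd \<Delta> + GammaQ ?A \<Gamma>' B' (x, v) (fst \<Delta>) \<in> HM_fib A x"
      using b.ddq_identities(3)[OF pb tb] fib[OF x] by simp
    show "a.ed x (snd \<Delta> + GammaQ ?A \<Gamma>' B' (x, v) (fst \<Delta>)) = a.ed x (snd \<Delta> + GammaQ A \<Gamma> B (x, v) (fst \<Delta>))"
      using b.ddq_identities(2)[OF pb tb] a.ddq_identities(2)[OF p t] by (simp add: dq HM)
  qed
  have T: "fst \<Delta> \<in> TM A x" "fst \<Delta>' \<in> TM A x"
    using a.THM_iff[OF p, of "fst \<Delta>" "snd \<Delta>"] a.THM_iff[OF p, of "fst \<Delta>'" "snd \<Delta>'"] t by auto
  have S: "snd \<Delta> + GammaQ A \<Gamma> B (x, v) (fst \<Delta>) \<in> TM A x" "snd \<Delta>' + GammaQ A \<Gamma> B (x, v) (fst \<Delta>') \<in> TM A x"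
    using a.H_T a.ddq_identities(3)[OF p] t by auto
  show ?thesis
    unfolding G_Q_inner shift[OF t(1)] shift[OF t(2)] using g' x T S ghat' p by fastforce
qed

theorem proposition11:
  fixes A :: "('a::euclidean_space, 'p, 'e::euclidean_space) ambient"
    and \<Gamma> B :: "'a \<Rightarrow> 'a \<Rightarrow>\<^sub>L 'a \<Rightarrow>\<^sub>L 'a"
    and ghat :: "'a \<times> 'a \<Rightarrow> 'a \<Rightarrow>\<^sub>L 'a"
    and nab :: "('p \<Rightarrow> 'e) \<Rightarrow> 'p \<Rightarrow> 'e \<Rightarrow> 'e"
    and C :: "'p \<times> 'e \<Rightarrow> 'e \<times> 'e \<Rightarrow> 'e"
  assumes "submersed_ambient A"
    and "christoffel_function (tot A) (met A) \<Gamma>"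
    and "B_extension A B"
    and "metric_operator (HM A) ghat"
    and "base_invariant A ghat"
    and "levi_civita (base A) (base_metric A) nab"
    and "connection_map (base A) nab C"
  shows "(\<forall>(x, v)\<in>HM A.
           (\<forall>\<epsilon>\<in>VM A x. blinfun_apply (blinfun_apply (B x) \<epsilon>) v = B_vert A x v \<epsilon>) \<and>
           (\<forall>\<xi>\<in>HM_fib A x. blinfun_apply (blinfun_apply (B x) \<xi>) v = 0)) \<and>
    ((\<forall>p\<in>HM A. bounded_linear (GammaQ_fun A \<Gamma> B p)) \<and> smooth_on (HM A) (GammaQ A \<Gamma> B)) \<and>
    (riemannian_embedded (HM A) (G_Q A \<Gamma> B ghat)) \<and>
    (\<forall>r\<in>points (tangent_bundle (base A)). inner_product (ghat_base A ghat r)) \<and>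
    (\<forall>(x, v)\<in>HM A. \<forall>\<xi> \<eta> \<xi>M \<eta>M.
           \<xi>M \<in> HM_fib A x \<longrightarrow> \<eta>M \<in> HM_fib A x \<longrightarrow>
           dq A (x, \<xi>M) = (sub A x, \<xi>) \<longrightarrow> dq A (x, \<eta>M) = (sub A x, \<eta>) \<longrightarrow>
           ghat_base A ghat (dq A (x, v)) \<xi> \<eta> = \<xi>M \<bullet> ghat (x, v) \<eta>M) \<and>
    (riemannian_submersion (HM A) (G_Q A \<Gamma> B ghat) (tangent_bundle (base A))
           (natural_metric (base A) (base_metric A) (ghat_base A ghat) C) (dq A)) \<and>
    (\<forall>p\<in>HM A. is_oproj (G_Q A \<Gamma> B ghat p) (QHM A p) (H_GQ A \<Gamma> B ghat p)) \<and>
    (\<forall>g' \<Gamma>' B' ghat'.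
           submersed_ambient (A\<lparr>met := g'\<rparr>) \<longrightarrow>
           christoffel_function (tot A) g' \<Gamma>' \<longrightarrow>
           B_extension (A\<lparr>met := g'\<rparr>) B' \<longrightarrow>
           metric_operator (HM A) ghat' \<longrightarrow>
           (\<forall>x\<in>tot A. \<forall>\<xi>\<in>TM A x. \<forall>\<eta>\<in>TM A x. \<xi> \<bullet> g' x \<eta> = \<xi> \<bullet> met A x \<eta>) \<longrightarrow>
           (\<forall>(x, v)\<in>HM A. \<forall>\<xi>\<in>TM A x. \<forall>\<eta>\<in>TM A x. \<xi> \<bullet> ghat' (x, v) \<eta> = \<xi> \<bullet> ghat (x, v) \<eta>) \<longrightarrow>
           (\<forall>p\<in>HM A. \<forall>\<Delta>\<in>THM A p. \<forall>\<Delta>'\<in>THM A p.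
              \<Delta> \<bullet> G_Q (A\<lparr>met := g'\<rparr>) \<Gamma>' B' ghat' p \<Delta>' = \<Delta> \<bullet> G_Q A \<Gamma> B ghat p \<Delta>')) \<and>
    (\<forall>p\<in>HM A. vertical_space (HM A) (tangent_bundle (base A)) (dq A) p = VHM A p \<and>
           horizontal_space (HM A) (G_Q A \<Gamma> B ghat) (tangent_bundle (base A)) (dq A) p = QHM A p) \<and>
    (\<forall>p\<in>HM A. (\<forall>\<Delta>\<in>THM A p. Q_map A p (Q_map A p \<Delta>) = Q_map A p \<Delta>) \<and>
           Q_map A p ` THM A p = QHM A p) \<and>
    (\<forall>p\<in>HM A. (\<forall>\<Delta>\<in>THM A p. Q_proj A p (Q_proj A p \<Delta>) = Q_proj A p \<Delta>) \<and>
           Q_proj A p ` THM A p = QHM A p \<and>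
           (\<forall>\<Delta>\<in>THM A p. \<forall>w\<in>QHM A p. (\<Delta> - Q_proj A p \<Delta>) \<bullet> G_Q A \<Gamma> B ghat p w = 0) \<and>
           (\<forall>\<Delta>\<in>THM A p. Q_proj A p \<Delta> = H_GQ A \<Gamma> B ghat p \<Delta>))"
proof -
  have conn: "submersed_connection A' \<Gamma>' nab C B'"
    if "submersed_ambient A'" "christoffel_function (tot A') (met A') \<Gamma>'" "B_extension A' B'"
      "levi_civita (base A') (base_metric A') nab" "connection_map (base A') nab C"
    for A' :: "('a, 'p, 'e) ambient" and \<Gamma>' B'
  proof -
    interpret s: submersed A' by unfold_locales (rule that(1))
    show ?thesis by unfold_locales (use that s.riemB in auto)
  qed
  interpret s: submersed_connection A \<Gamma> nab C B using conn assms by blast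
  interpret m: submersed_metric A \<Gamma> nab C B ghat by unfold_locales (use assms in auto)
  have pair: "(\<forall>p\<in>HM A. Q p) \<longleftrightarrow> (\<forall>x v. (x, v) \<in> HM A \<longrightarrow> Q (x, v))" for Q by auto
  \<comment> \<open>the cases follow the conjunction, whose second member is split into cases 2 and 3\<close>
  show ?thesis
  proof (intro conjI, goal_cases)
    case 1
    show ?case
    proof (clarify, intro conjI ballI)
      fix x v assume p: "(x, v) \<in> HM A"
      have x: "x \<in> tot A" and v: "v \<in> HM_fib A x" using p s.HM_iff by auto
      show "B x \<epsilon> v = B_vert A x v \<epsilon>" if e: "\<epsilon> \<in> VM A x" for \<epsilon>
        using s.B_apply[OF x s.V_T[OF e] v] s.V_fix[OF x e] by (simp add: B_vert_def)
      show "B x \<xi> v = 0" if h: "\<xi> \<in> HM_fib A x" for \<xi>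
        using s.B_apply[OF x s.H_T[OF h] v] s.VH0[OF x h] linear_0[OF s.lin_dH[OF x]] by (simp add: blinfun.zero_right)
    qed
  next
    case 2
    show ?case using s.bounded_linear_GammaQ_fun by blast
  next
    case 3
    show ?case by (rule s.smooth_GammaQ[OF s.smooth_B])
  next
    case 4
    show ?case by (rule m.riemannian_HM)
  next
    case 5
    show ?case using m.inner_product_ghat_base by blast
  next
    case 6
    show ?case using m.ghat_base_lift s.dq_pair by auto
  next
    case 7
    show ?case by (rule m.riemannian_submersion_dq)
  next
    case 8
    show ?case unfolding pair using m.is_oproj_H_GQ by blast
  next
    case 9
    show ?case
    proof (intro allI impI ballI)
      fix g' :: "'a \<Rightarrow> 'a \<Rightarrow>\<^sub>L 'a" and \<Gamma>' B' and ghat' :: "'a \<times> 'a \<Rightarrow> 'a \<Rightarrow>\<^sub>L 'a" and p \<Delta> \<Delta>'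
      assume h: "submersed_ambient (A\<lparr>met := g'\<rparr>)" "christoffel_function (tot A) g' \<Gamma>'"
        "B_extension (A\<lparr>met := g'\<rparr>) B'"
        "\<forall>x\<in>tot A. \<forall>\<xi>\<in>TM A x. \<forall>\<eta>\<in>TM A x. \<xi> \<bullet> g' x \<eta> = \<xi> \<bullet> met A x \<eta>"
        "\<forall>(x, v)\<in>HM A. \<forall>\<xi>\<in>TM A x. \<forall>\<eta>\<in>TM A x. \<xi> \<bullet> ghat' (x, v) \<eta> = \<xi> \<bullet> ghat (x, v) \<eta>"
        and p: "p \<in> HM A" and t: "\<Delta> \<in> THM A p" "\<Delta>' \<in> THM A p"
      have "submersed_connection (A\<lparr>met := g'\<rparr>) \<Gamma>' nab C B'"
        by (rule conn) (use h assms in auto)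
      from G_Q_depends_on_tangent_values[OF s.submersed_connection_axioms this h(4,5), of "fst p" "snd p" \<Delta> \<Delta>'] p t
      show "\<Delta> \<bullet> G_Q (A\<lparr>met := g'\<rparr>) \<Gamma>' B' ghat' p \<Delta>' = \<Delta> \<bullet> G_Q A \<Gamma> B ghat p \<Delta>'" by simp
    qed
  next
    case 10
    show ?case unfolding pair using s.vertical_space_HM m.horizontal_space_HM by blast
  next
    case 11
    show ?case unfolding pair using s.Q_map_idempotent by blast
  next
    case 12
    show ?case unfolding pair using m.Q_proj_properties m.Q_proj_eq by blast
  qed
qed

end
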